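(* In the setting described in the context, suppose that all of the conditions (A1)--(A8) and (C1)--(C2) listed there hold, and let $\beta=\frac{d_w}{2}-\frac{d_f-d}{2}$. Then there exists a bounded linear map $\xi$ from $\hat\Lambda^\beta_{2,2}(L)$ to $\mathcal F$ such that $\xi(\Lambda^\beta_{2,2}(L)\cap C(L))\subset\mathcal F\cap C(K)$ and $\widetilde{\xi f}|_L=f$ $\nu$-a.e. for all $f\in\hat\Lambda^\beta_{2,2}(L)$.
   Context: **Self-similar sets.** $(X,\mathsf d)$ is a complete separable metric space, $\alpha>1$, $W$ is a finite index set, and $F_i:X\to X$ ($i\in W$) satisfy $\mathsf d(F_i(x),F_i(y))=\alpha^{-1}\mathsf d(x,y)$ for all $x,y\in X$. $S\subset W$, $N=\#S$, and $K$ is the unique nonempty compact set with $K=\bigcup_{i\in S}F_i(K)$; $K$ is assumed connected. $W^n$ is the set of words of length $n$ over $W$ ($W^0=\{\emptyset\}$), $|w|=n$ for $w\in W^n$, $v\cdot w$ is concatenation, $A\cdot B=\{v\cdot w:v\in A,w\in B\}$. $F_{w_1\cdots w_n}=F_{w_1}\circ\cdots\circ F_{w_n}$, $F_\emptyset=\mathrm{id}$, $K_w=F_w(K)$, $K_A=\bigcup_{v\in A}K_v$ for a set $A$ of words, and $F_w^*f=f\circ F_w$. $\mathfrak G$ is a group of isometries of $K$ such that (i) for each $i\in W$ there are $j(i)\in S$, $\Psi_i\in\mathfrak G$ with $F_i=F_{j(i)}\circ\Psi_i$ on $K$; (ii) for each $\Psi\in\mathfrak G$, $i\in S$ there are $\hat\Psi\in\mathfrak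 G$, $\hat i\in S$ with $\Psi\circ F_i=F_{\hat i}\circ\hat\Psi$. $\pi:W^{\mathbb N}\to K$ is given by $\{\pi(w)\}=\bigcap_mK_{w_1\cdots w_m}$. For $v,w\in W^n$ write $v\stackrel{n,K}{\sim}w$ if $K_v\cap K_w\neq\emptyset$. For $A\subset W^n$: $\mathcal N_0(A)=A$, $\mathcal N_k(A)=\{v\in W^n: v\stackrel{n,K}{\sim}u\text{ for some }u\in\mathcal N_{k-1}(A)\}$, $\mathcal N_k(w)=\mathcal N_k(\{w\})$. $I\subset W$ with $N_I=\#I<N$; $L\subset K$ is the unique nonempty compact set with $L=\bigcup_{i\in I}F_i(L)$. $M\in\mathbb N$ is fixed; for $v,w\in I^n$ write $v\stackrel{n,L}{\leftrightarrow}w$ if $v\in\mathcal N_M(w)$; $M$ is chosen so that any $i,j\in I$ are joined by a finite chain $i\stackrel{1,L}{\leftrightarrow}i_1\stackrel{1,L}{\leftrightarrow}\cdots\stackrel{1,L}{\leftrightarrow}j$ in $I$. $\mu$ (on $K$) and $\nu$ (on $L$) are the images under $\pi$ of the uniform Bernoulli (product) probability measures on $S^{\mathbb N}$ and $I^{\mathbb N}$. $d_f=\log N/\log\alpha$, $d=\log N_I/\log\alpha$. (A1) $\sup_n\max_{w\in S^n}\#(\mathcal N_1(w)\cap S^n)<\infty$ and $\sup_n\max_{w\in I^n}\#(\mathcal N_M(w)\cap I^n)<\infty$. (A2) There are $k_1,k_2>0$ such that for $x,y\in L$, $n\in\mathbb Z_+$, $v,w\in I^n$ with $x\in K_v,y\in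 K_w$: $\mathsf d(x,y)<k_1\alpha^{-n}$ implies $v\stackrel{n,L}{\leftrightarrow}w$, and $v\stackrel{n,L}{\leftrightarrow}w$ implies $\mathsf d(x,y)<k_2\alpha^{-n}$. (A3) There are $k_1,k_2>0$ such that for $x,y\in K$, $n\in\mathbb Z_+$, $v,w\in S^n$ with $x\in K_v,y\in K_w$: $\mathsf d(x,y)<k_1\alpha^{-n}$ implies $v\stackrel{n,K}{\sim}w$, and $v\stackrel{n,K}{\sim}w$ implies $\mathsf d(x,y)<k_2\alpha^{-n}$. (A4) $\mu(\{x\in K:\#(\pi^{-1}(x)\cap S^{\mathbb N})=\infty\})=0$ and $\nu(\{x\in L:\#(\pi^{-1}(x)\cap I^{\mathbb N})=\infty\})=0$. **Dirichlet form.** $(\mathcal E,\mathcal F)$ is a strong local regular Dirichlet form on $L^2(K,\mu)$; $\mathcal E(f)=\mathcal E(f,f)$, $\|f\|_{\mathcal F}=(\mathcal E(f)+\|f\|^2_{L^2(\mu)})^{1/2}$. (A5) $F_i^*f\in\mathcal F$ for $f\in\mathcal F$, $i\in S$, and there is $\rho>0$ with $\mathcal E(f)=\rho\sum_{i\in S}\mathcal E(F_i^*f)$ for $f\in\mathcal F$. (A6) For $\Psi\in\mathfrak G$, $\{f\circ\Psi:f\in\mathcal F\}=\mathcal F$ and $\mathcal E(f\circ\Psi)=\mathcal E(f)$ for $f\in\mathcal F$. (A7) $d_w:=\log(\rho N)/\log\alpha>d_f-d$. (A8) There is $c>0$ with $\nu(D)\le c\,\mathrm{Cap}(D)$ for every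 compact $D\subset K$, where $\mathrm{Cap}(U)=\inf\{\|u\|_{\mathcal F}^2:u\in\mathcal F,u\ge1\ \mu\text{-a.e. on }U\}$ for open $U\subset K$ and $\mathrm{Cap}(D)=\inf\{\mathrm{Cap}(U):U\supset D\text{ open}\}$ in general. $\tilde f$ denotes a quasi-continuous modification of $f\in\mathcal F$. For each $A\subset W^m$, $m\in\mathbb Z_+$, a function space $\mathcal F_A$ on $K_A$ is given with $\{f|_{K_A}:f\in\mathcal F\}\subset\mathcal F_A\subset\{f\in L^2(K_A):F_w^*f\in\mathcal F\ \forall w\in A\}$; put $\mathcal E_A(f,g)=\rho^m\sum_{w\in A}\mathcal E(F_w^*f,F_w^*g)$. It is assumed that $\mathcal F_A=\mathcal F_{A\cdot S^n}$ for all $n\in\mathbb N$ and that $(\mathcal E_A,\mathcal F_A)$ is a closed form on $L^2(K_A,\mu|_{K_A})$. $A\subset W^m$ and $B\subset W^n$ are *of the same type* if there are a homeomorphism $F:K_A\to K_B$ and a bijection $\chi:A\to B$ with $F\circ F_u=F_{\chi(u)}$ for all $u\in A$ and $F^*(\mathcal F_B)=\mathcal F_A$. **Whitney-type decomposition.** Let $\Omega^{(n)}=\bigcup_{m=0}^nI^m$. For $w=\emptyset\in I^0$ put $A_w=W\setminus\mathcal N_2(I)$, $B_w=W\setminus\mathcal N_1(I)$. For $w\in I^n$, $n\in\mathbb N$, put $A_w=(\mathcal N_2(w)\cdot W)\setminus\mathcal N_2(I^{n+1})$, $\hat A_w=\mathcal N_2(w)\cdot W$, $B_w=(\mathcal N_3(w)\cdot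 W)\setminus\mathcal N_1(I^{n+1})$, $\hat B_w=\mathcal N_3(w)\cdot W$. For $n\in\mathbb N$, $w\in\Omega^{(n)}$: $A_w^{(n)}=A_w$, $B_w^{(n)}=B_w$ if $|w|<n$, and $A_w^{(n)}=\hat A_w$, $B_w^{(n)}=\hat B_w$ if $|w|=n$; $R_w^{(n)}=\{w'\in\Omega^{(n)}:K_{B_w^{(n)}}\cap K_{B_{w'}^{(n)}}\ne\emptyset\}$. (C1) There is a finite subset $\Gamma$ of $\bigcup_{n\in\mathbb N}(\{n\}\times\Omega^{(n)})$ such that for any $n\in\mathbb N$ and $w\in\Omega^{(n)}$ there are $(m,v)\in\Gamma$, a bijection $\iota:R_w^{(n)}\to R_v^{(m)}$ with $\iota(w)=v$, and a homeomorphism $F:\bigcup_{u\in R_w^{(n)}}K_{B_u^{(n)}}\to\bigcup_{u\in R_v^{(m)}}K_{B_u^{(m)}}$ such that for every $u\in R_w^{(n)}$, $A_u^{(n)}$ and $A_{\iota(u)}^{(m)}$ are of the same type, and so are $B_u^{(n)}$ and $B_{\iota(u)}^{(m)}$, for the homeomorphism (restriction of) $F$. For each $(m,v)\in\Gamma$ fix $\bar\varphi_v^{(m)}\in\mathcal F\cap C(K)$ with $0\le\bar\varphi_v^{(m)}\le1$, $\bar\varphi_v^{(m)}=1$ on $K_{A_v^{(m)}}$, and $\bar\varphi_v^{(m)}=0$ on $K_{W^{|v|+1}\setminus B_v^{(m)}}$. For $n\in\mathbb N$, $w\in\Omega^{(n)}$ set $\varphi_w^{(n)}(x)=\bar\varphi_v^{(m)}(F(x))$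 if $x\in K_{B_w^{(n)}}$ and $\varphi_w^{(n)}(x)=0$ otherwise, with $m,v,F$ as in (C1). (C2) $\varphi_w^{(n)}\in\mathcal F\cap C(K)$ for every $n\in\mathbb N$ and $w\in\Omega^{(n)}$. **Besov spaces.** For $\beta\ge0$, $f\in L^2(L,\nu)$ and a fixed $c>0$ let $a_m(\beta,f)=\alpha^{m\beta}\bigl(\alpha^{md}\iint_{\{(x,y)\in L\times L:\mathsf d(x,y)<c\alpha^{-m}\}}|f(x)-f(y)|^2d\nu(x)d\nu(y)\bigr)^{1/2}$. $\Lambda^\beta_{2,2}(L)$ is the set of $f\in L^2(L,\nu)$ with $\{a_m(\beta,f)\}_{m\ge0}\in l^2$, normed by $\|f\|_{\Lambda^\beta_{2,2}(L)}=\|f\|_{L^2(L)}+\|\{a_m(\beta,f)\}\|_{l^2}$ (different $c$ give equivalent norms). $\hat\Lambda^\beta_{2,2}(L)$ is the closure of $\Lambda^\beta_{2,2}(L)\cap C(L)$ in $\Lambda^\beta_{2,2}(L)$. *)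

theory Defs
  imports "HOL-Probability.Probability" "HOL-Algebra.Bij"
begin

section \<open>Words, cells and adjacency\<close>

text \<open>
  The ambient complete separable metric space is a type of class \<^class>\<open>polish_space\<close>.
  \<open>K\<close> is a subset of it, and functions on \<open>K\<close> (or on a subset of \<open>K\<close>) are total functions whose
  values elsewhere are irrelevant.
\<close>

definition words :: "'i set \<Rightarrow> nat \<Rightarrow> 'i list set" where
  "words A n = {w. set w \<subseteq> A \<and> length w = n}"

definition conc :: "'i list set \<Rightarrow> 'i list set \<Rightarrow> 'i list set" where
  "conc A B = {v @ w | v w. v \<in> A \<and> w \<in> B}"

definition word_map :: "('i \<Rightarrow> 'x \<Rightarrow> 'x) \<Rightarrow> 'i list \<Rightarrow> 'x \<Rightarrow> 'x" where
  "word_map F w = foldr (\<lambda>i g. F i \<circ> g) w id"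

definition cell :: "('i \<Rightarrow> 'x \<Rightarrow> 'x) \<Rightarrow> 'x set \<Rightarrow> 'i list \<Rightarrow> 'x set" where
  "cell F K w = word_map F w ` K"

definition cells :: "('i \<Rightarrow> 'x \<Rightarrow> 'x) \<Rightarrow> 'x set \<Rightarrow> 'i list set \<Rightarrow> 'x set" where
  "cells F K A = (\<Union>w\<in>A. cell F K w)"

definition adjacent :: "('i \<Rightarrow> 'x \<Rightarrow> 'x) \<Rightarrow> 'x set \<Rightarrow> 'i list \<Rightarrow> 'i list \<Rightarrow> bool" where
  "adjacent F K v w \<longleftrightarrow> length v = length w \<and> cell F K v \<inter> cell F K w \<noteq> {}"

text \<open>\<open>nbhd W F K k A\<close> is \<open>\<N>\<^sub>k(A)\<close>; the neighbours are taken among all words over \<open>W\<close> of the same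
  length, not only among those over the alphabet of \<open>A\<close>.\<close>

fun nbhd :: "'i set \<Rightarrow> ('i \<Rightarrow> 'x \<Rightarrow> 'x) \<Rightarrow> 'x set \<Rightarrow> nat \<Rightarrow> 'i list set \<Rightarrow> 'i list set" where
  "nbhd W F K 0 A = A"
| "nbhd W F K (Suc k) A = {v. set v \<subseteq> W \<and> (\<exists>u\<in>nbhd W F K k A. adjacent F K v u)}"

text \<open>The coding map \<open>\<pi>\<close>; infinite words are indexed from \<open>0\<close>.\<close>

definition coding :: "('i \<Rightarrow> 'x \<Rightarrow> 'x) \<Rightarrow> 'x set \<Rightarrow> (nat \<Rightarrow> 'i) \<Rightarrow> 'x" where
  "coding F K \<omega> = the_elem (\<Inter>m. cell F K (map \<omega> [0..<m]))"

text \<open>The image under \<open>\<pi>\<close> of the uniform Bernoulli measure on infinite words over \<open>J\<close>, as a Borel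
  measure on \<open>P\<close>. It is used with \<open>(J, P) = (S, K)\<close> and \<open>(J, P) = (I, L)\<close>.\<close>

definition bernoulli_image ::
  "('i \<Rightarrow> 'x::polish_space \<Rightarrow> 'x) \<Rightarrow> 'x set \<Rightarrow> 'i set \<Rightarrow> 'x set \<Rightarrow> 'x measure" where
  "bernoulli_image F K J P =
     distr (Pi\<^sub>M (UNIV :: nat set) (\<lambda>_. uniform_count_measure J)) (restrict_space borel P) (coding F K)"


section \<open>Closed forms and Dirichlet forms\<close>

text \<open>Elements of \<open>L\<^sup>2(M)\<close> are represented by functions, not by classes. Accordingly, domains of
  forms are required to be saturated under almost everywhere equality.\<close>

definition L2_space :: "'a measure \<Rightarrow> ('a \<Rightarrow> real) set" where
  "L2_space M = {f \<in> borel_measurable M. integrable M (\<lambda>x. (f x)\<^sup>2)}"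

definition L2_norm :: "'a measure \<Rightarrow> ('a \<Rightarrow> real) \<Rightarrow> real" where
  "L2_norm M f = sqrt (\<integral>x. (f x)\<^sup>2 \<partial>M)"

definition form_norm ::
  "'a measure \<Rightarrow> (('a \<Rightarrow> real) \<Rightarrow> ('a \<Rightarrow> real) \<Rightarrow> real) \<Rightarrow> ('a \<Rightarrow> real) \<Rightarrow> real" where
  "form_norm M \<E> f = sqrt (\<E> f f + (L2_norm M f)\<^sup>2)"

definition closed_form ::
  "'a measure \<Rightarrow> ('a \<Rightarrow> real) set \<Rightarrow> (('a \<Rightarrow> real) \<Rightarrow> ('a \<Rightarrow> real) \<Rightarrow> real) \<Rightarrow> bool" where
  "closed_form M D \<E> \<longleftrightarrow>
     D \<subseteq> L2_space M \<and>
     (\<forall>f\<in>D. \<forall>g\<in>borel_measurable M. (AE x in M. f x = g x) \<longrightarrow> g \<in> D \<and> (\<forall>h\<in>D. \<E> f h = \<E> g h)) \<and>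
     (\<forall>f\<in>D. \<forall>g\<in>D. \<forall>a b. (\<lambda>x. a * f x + b * g x) \<in> D \<and>
        (\<forall>h\<in>D. \<E> (\<lambda>x. a * f x + b * g x) h = a * \<E> f h + b * \<E> g h)) \<and>
     (\<forall>f\<in>D. \<forall>g\<in>D. \<E> f g = \<E> g f) \<and>
     (\<forall>f\<in>D. 0 \<le> \<E> f f) \<and>
     (\<forall>f\<in>L2_space M. \<forall>\<epsilon>>0. \<exists>g\<in>D. L2_norm M (\<lambda>x. f x - g x) < \<epsilon>) \<and>
     (\<forall>u :: nat \<Rightarrow> 'a \<Rightarrow> real.
        (\<forall>n. u n \<in> D) \<and>
        (\<forall>\<epsilon>>0. \<exists>n0. \<forall>m\<ge>n0. \<forall>n\<ge>n0. form_norm M \<E> (\<lambda>x. u m x - u n x) < \<epsilon>) \<longrightarrow>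
        (\<exists>f\<in>D. (\<lambda>n. form_norm M \<E> (\<lambda>x. u n x - f x)) \<longlonglongrightarrow> 0))"

definition dirichlet_form ::
  "'a measure \<Rightarrow> ('a \<Rightarrow> real) set \<Rightarrow> (('a \<Rightarrow> real) \<Rightarrow> ('a \<Rightarrow> real) \<Rightarrow> real) \<Rightarrow> bool" where
  "dirichlet_form M D \<E> \<longleftrightarrow> closed_form M D \<E> \<and>
     (\<forall>f\<in>D. (\<lambda>x. min (max (f x) 0) 1) \<in> D \<and>
        \<E> (\<lambda>x. min (max (f x) 0) 1) (\<lambda>x. min (max (f x) 0) 1) \<le> \<E> f f)"

text \<open>Since \<open>K\<close> is compact, compactly supported continuous functions on \<open>K\<close> are just continuous
  functions, and all supports are compact.\<close>

definition regular_form ::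
  "'a::metric_space measure \<Rightarrow> 'a set \<Rightarrow> ('a \<Rightarrow> real) set \<Rightarrow>
   (('a \<Rightarrow> real) \<Rightarrow> ('a \<Rightarrow> real) \<Rightarrow> real) \<Rightarrow> bool" where
  "regular_form M K D \<E> \<longleftrightarrow>
     (\<forall>f\<in>D. \<forall>\<epsilon>>0. \<exists>g\<in>D. continuous_on K g \<and> form_norm M \<E> (\<lambda>x. f x - g x) < \<epsilon>) \<and>
     (\<forall>f. continuous_on K f \<longrightarrow>
        (\<forall>\<epsilon>>0. \<exists>g\<in>D. continuous_on K g \<and> (\<forall>x\<in>K. \<bar>f x - g x\<bar> < \<epsilon>)))"

text \<open>The support of the measure \<open>\<bar>f\<bar> dM\<close>.\<close>

definition ess_support :: "'a::metric_space measure \<Rightarrow> 'a set \<Rightarrow> ('a \<Rightarrow> real) \<Rightarrow> 'a set" where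
  "ess_support M K f = {x\<in>K. \<forall>U. open U \<and> x \<in> U \<longrightarrow> \<not> (AE y in M. y \<in> U \<longrightarrow> f y = 0)}"

definition strong_local ::
  "'a::metric_space measure \<Rightarrow> 'a set \<Rightarrow> ('a \<Rightarrow> real) set \<Rightarrow>
   (('a \<Rightarrow> real) \<Rightarrow> ('a \<Rightarrow> real) \<Rightarrow> real) \<Rightarrow> bool" where
  "strong_local M K D \<E> \<longleftrightarrow>
     (\<forall>f\<in>D. \<forall>g\<in>D. (\<exists>U c. open U \<and> ess_support M K f \<subseteq> U \<and> (AE x in M. x \<in> U \<longrightarrow> g x = c)) \<longrightarrow>
        \<E> f g = 0)"

text \<open>The class of all \<open>f \<circ> \<Phi>\<close> with \<open>f \<in> D\<close>, saturated under almost everywhere equality.\<close>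

definition pullback ::
  "'a measure \<Rightarrow> ('a \<Rightarrow> 'a) \<Rightarrow> ('a \<Rightarrow> real) set \<Rightarrow> ('a \<Rightarrow> real) set" where
  "pullback M \<Phi> D = {g \<in> borel_measurable M. \<exists>f\<in>D. AE x in M. g x = f (\<Phi> x)}"


section \<open>Capacity and quasi-continuity\<close>

definition open_capacity ::
  "'a measure \<Rightarrow> ('a \<Rightarrow> real) set \<Rightarrow> (('a \<Rightarrow> real) \<Rightarrow> ('a \<Rightarrow> real) \<Rightarrow> real) \<Rightarrow>
   'a set \<Rightarrow> ennreal" where
  "open_capacity M D \<E> U =
     (INF u\<in>{u\<in>D. AE x in M. x \<in> U \<longrightarrow> 1 \<le> u x}. ennreal ((form_norm M \<E> u)\<^sup>2))"

definition capacity ::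
  "'a::metric_space measure \<Rightarrow> 'a set \<Rightarrow> ('a \<Rightarrow> real) set \<Rightarrow>
   (('a \<Rightarrow> real) \<Rightarrow> ('a \<Rightarrow> real) \<Rightarrow> real) \<Rightarrow> 'a set \<Rightarrow> ennreal" where
  "capacity M K D \<E> A = (INF U\<in>{U. openin (top_of_set K) U \<and> A \<subseteq> U}. open_capacity M D \<E> U)"

definition quasi_cont_modification ::
  "'a::metric_space measure \<Rightarrow> 'a set \<Rightarrow> ('a \<Rightarrow> real) set \<Rightarrow>
   (('a \<Rightarrow> real) \<Rightarrow> ('a \<Rightarrow> real) \<Rightarrow> real) \<Rightarrow> ('a \<Rightarrow> real) \<Rightarrow> ('a \<Rightarrow> real) \<Rightarrow> bool" where
  "quasi_cont_modification M K D \<E> f g \<longleftrightarrow>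
     (AE x in M. g x = f x) \<and>
     (\<forall>\<epsilon>>0. \<exists>G. openin (top_of_set K) G \<and> capacity M K D \<E> G < \<epsilon> \<and> continuous_on (K - G) g)"


section \<open>Forms on unions of cells\<close>

text \<open>For \<open>A\<close> consisting of words of length \<open>m\<close> the weight below is \<open>\<rho>\<^sup>m\<close>.\<close>

definition cell_form ::
  "('i \<Rightarrow> 'x \<Rightarrow> 'x) \<Rightarrow> real \<Rightarrow> (('x \<Rightarrow> real) \<Rightarrow> ('x \<Rightarrow> real) \<Rightarrow> real) \<Rightarrow> 'i list set \<Rightarrow>
   ('x \<Rightarrow> real) \<Rightarrow> ('x \<Rightarrow> real) \<Rightarrow> real" where
  "cell_form F \<rho> \<E> A f g = (\<Sum>w\<in>A. \<rho> ^ length w * \<E> (f \<circ> word_map F w) (g \<circ> word_map F w))"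

text \<open>\<open>A\<close> and \<open>B\<close> are of the same type, witnessed by the homeomorphism \<open>\<Phi>\<close> restricted to the union
  of the cells of \<open>A\<close>; \<open>FA\<close> is the given family of function spaces.\<close>

definition same_type_via ::
  "('i \<Rightarrow> 'x::metric_space \<Rightarrow> 'x) \<Rightarrow> 'x set \<Rightarrow> 'x measure \<Rightarrow> ('i list set \<Rightarrow> ('x \<Rightarrow> real) set) \<Rightarrow>
   ('x \<Rightarrow> 'x) \<Rightarrow> 'i list set \<Rightarrow> 'i list set \<Rightarrow> bool" where
  "same_type_via F K \<mu> FA \<Phi> A B \<longleftrightarrow>
     (\<exists>\<Phi>'. homeomorphism (cells F K A) (cells F K B) \<Phi> \<Phi>') \<and>
     (\<exists>h. bij_betw h A B \<and>
        (\<forall>u\<in>A. \<forall>x\<in>K. \<Phi> (word_map F u x) = word_map F (h u) x)) \<and>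
     pullback (restrict_space \<mu> (cells F K A)) \<Phi> (FA B) = FA A"


section \<open>Whitney-type decomposition\<close>

definition words_upto :: "'i set \<Rightarrow> nat \<Rightarrow> 'i list set" where
  "words_upto I n = (\<Union>m\<le>n. words I m)"

definition whitney_hat ::
  "'i set \<Rightarrow> ('i \<Rightarrow> 'x \<Rightarrow> 'x) \<Rightarrow> 'x set \<Rightarrow> nat \<Rightarrow> 'i list \<Rightarrow> 'i list set" where
  "whitney_hat W F K k w = conc (nbhd W F K k {w}) (words W 1)"

text \<open>\<open>A\<^sub>w\<close> and \<open>B\<^sub>w\<close> are given by \<open>(k, l) = (2, 2)\<close> and \<open>(k, l) = (3, 1)\<close>.\<close>

definition whitney ::
  "'i set \<Rightarrow> ('i \<Rightarrow> 'x \<Rightarrow> 'x) \<Rightarrow> 'x set \<Rightarrow> 'i set \<Rightarrow> nat \<Rightarrow> nat \<Rightarrow> 'i list \<Rightarrow> 'i list set" where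
  "whitney W F K I k l w =
     (if w = [] then words W 1 - nbhd W F K l (words I 1)
      else whitney_hat W F K k w - nbhd W F K l (words I (length w + 1)))"

definition whitney_A ::
  "'i set \<Rightarrow> ('i \<Rightarrow> 'x \<Rightarrow> 'x) \<Rightarrow> 'x set \<Rightarrow> 'i set \<Rightarrow> nat \<Rightarrow> 'i list \<Rightarrow> 'i list set" where
  "whitney_A W F K I n w =
     (if length w < n then whitney W F K I 2 2 w else whitney_hat W F K 2 w)"

definition whitney_B ::
  "'i set \<Rightarrow> ('i \<Rightarrow> 'x \<Rightarrow> 'x) \<Rightarrow> 'x set \<Rightarrow> 'i set \<Rightarrow> nat \<Rightarrow> 'i list \<Rightarrow> 'i list set" where
  "whitney_B W F K I n w =
     (if length w < n then whitney W F K I 3 1 w else whitney_hat W F K 3 w)"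

definition whitney_R ::
  "'i set \<Rightarrow> ('i \<Rightarrow> 'x \<Rightarrow> 'x) \<Rightarrow> 'x set \<Rightarrow> 'i set \<Rightarrow> nat \<Rightarrow> 'i list \<Rightarrow> 'i list set" where
  "whitney_R W F K I n w =
     {w' \<in> words_upto I n. cells F K (whitney_B W F K I n w) \<inter> cells F K (whitney_B W F K I n w') \<noteq> {}}"

text \<open>\<open>whitney_match \<dots> n w m v \<iota> \<Phi>\<close> says that the bijection \<open>\<iota>\<close> and the homeomorphism \<open>\<Phi>\<close> identify
  the configuration around \<open>w\<close> at level \<open>n\<close> with that around \<open>v\<close> at level \<open>m\<close>.\<close>

definition whitney_match ::
  "'i set \<Rightarrow> ('i \<Rightarrow> 'x::metric_space \<Rightarrow> 'x) \<Rightarrow> 'x set \<Rightarrow> 'i set \<Rightarrow> 'x measure \<Rightarrow>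
   ('i list set \<Rightarrow> ('x \<Rightarrow> real) set) \<Rightarrow> nat \<Rightarrow> 'i list \<Rightarrow> nat \<Rightarrow> 'i list \<Rightarrow>
   ('i list \<Rightarrow> 'i list) \<Rightarrow> ('x \<Rightarrow> 'x) \<Rightarrow> bool" where
  "whitney_match W F K I \<mu> FA n w m v \<iota> \<Phi> \<longleftrightarrow>
     bij_betw \<iota> (whitney_R W F K I n w) (whitney_R W F K I m v) \<and> \<iota> w = v \<and>
     (\<exists>\<Phi>'. homeomorphism (\<Union>u\<in>whitney_R W F K I n w. cells F K (whitney_B W F K I n u))
                           (\<Union>u\<in>whitney_R W F K I m v. cells F K (whitney_B W F K I m u)) \<Phi> \<Phi>') \<and>
     (\<forall>u\<in>whitney_R W F K I n w.
        same_type_via F K \<mu> FA \<Phi> (whitney_A W F K I n u) (whitney_A W F K I m (\<iota> u)) \<and>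
        same_type_via F K \<mu> FA \<Phi> (whitney_B W F K I n u) (whitney_B W F K I m (\<iota> u)))"


section \<open>Besov spaces\<close>

definition besov_coeff ::
  "'x::metric_space measure \<Rightarrow> 'x set \<Rightarrow> real \<Rightarrow> real \<Rightarrow> real \<Rightarrow> real \<Rightarrow> nat \<Rightarrow> ('x \<Rightarrow> real) \<Rightarrow> real" where
  "besov_coeff \<nu> L \<alpha> d c \<beta> m f =
     \<alpha> powr (real m * \<beta>) *
     sqrt (\<alpha> powr (real m * d) *
       (LINT z:{z \<in> L \<times> L. dist (fst z) (snd z) < c * \<alpha> powr (- real m)}|(\<nu> \<Otimes>\<^sub>M \<nu>).
          \<bar>f (fst z) - f (snd z)\<bar>\<^sup>2))"

definition besov_space ::
  "'x::metric_space measure \<Rightarrow> 'x set \<Rightarrow> real \<Rightarrow> real \<Rightarrow> real \<Rightarrow> real \<Rightarrow> ('x \<Rightarrow> real) set" where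
  "besov_space \<nu> L \<alpha> d c \<beta> =
     {f \<in> L2_space \<nu>. summable (\<lambda>m. (besov_coeff \<nu> L \<alpha> d c \<beta> m f)\<^sup>2)}"

definition besov_norm ::
  "'x::metric_space measure \<Rightarrow> 'x set \<Rightarrow> real \<Rightarrow> real \<Rightarrow> real \<Rightarrow> real \<Rightarrow> ('x \<Rightarrow> real) \<Rightarrow> real" where
  "besov_norm \<nu> L \<alpha> d c \<beta> f =
     L2_norm \<nu> f + sqrt (\<Sum>m. (besov_coeff \<nu> L \<alpha> d c \<beta> m f)\<^sup>2)"

definition besov_closure ::
  "'x::metric_space measure \<Rightarrow> 'x set \<Rightarrow> real \<Rightarrow> real \<Rightarrow> real \<Rightarrow> real \<Rightarrow> ('x \<Rightarrow> real) set" where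
  "besov_closure \<nu> L \<alpha> d c \<beta> =
     {f \<in> besov_space \<nu> L \<alpha> d c \<beta>. \<forall>\<epsilon>>0. \<exists>g\<in>besov_space \<nu> L \<alpha> d c \<beta>.
        continuous_on L g \<and> besov_norm \<nu> L \<alpha> d c \<beta> (\<lambda>x. f x - g x) < \<epsilon>}"

end

theory Submission
  imports Defs
begin

text \<open>
  For \<open>f\<close> on \<open>L\<close> let \<open>f\<^sub>w\<close> be the average of \<open>f\<close> over the cell \<open>w\<close> of \<open>L\<close>. The extension of \<open>f\<close> is the limit
  of \<open>\<Sum>\<^sub>w f\<^sub>w \<psi>\<^sub>w\<close>, summed over the words of length at most \<open>n\<close>, where the \<open>\<psi>\<^sub>w\<close> form a partition of unity
  built from the bump functions of the Whitney decomposition. By self-similarity (A5) and (C1) the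
  bump of \<open>w\<close> has energy of order \<open>\<rho>\<close> to the power of the length of \<open>w\<close>. On a cell of \<open>K\<close> only boundedly
  many words are visible, so locality bounds the energy of the sum by the squared differences of \<open>f\<^sub>w\<close>
  over neighbouring words, weighted by these powers. By (A3) neighbouring words have comparable lengths
  and close cells, hence Jensen's inequality bounds level \<open>j\<close> of this sum by the \<open>j\<close>-th squared Besov
  coefficient. Two approximations differ only on cells that see long words; so the same
  estimate, applied to the tails, shows convergence in the form norm, and uniform
  continuity of \<open>f\<close> gives uniform convergence. The statement about traces follows by density, since
  (A8) turns small capacity into small \<open>\<nu>\<close>-measure.
\<close>

section \<open>Dirichlet forms, capacity and quasi-continuity\<close>

text \<open>(A5) splits the energy, and self-similarity of \<mu> the L2 norm, into sums over the
  words of length k over S; all estimates are made on one cell and then summed. This is done with n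
  < k, because the decomposition of level n consists of words of length at most n + 1. Strong
  locality is applied to constants: it lets a constant be subtracted on each cell separately, so
  that differences of averages appear. The obstacle is that the Whitney sets consist of words over
  W, many of which may share a cell, while (A5) speaks of words over S. The symmetries in
  \<open>\<GG>\<close> replace a word over W by one over S with the same cell, and (A4) makes the
  cells of distinct words of equal length over S overlap in null sets, so that a bump is seen only
  from its own cells. The value of \<beta> reflects a balance: \<open>\<rho> ^ j\<close> for the
  energy of a bump times N_I^(2 j) for the inverse mass of a pair of cells is the weight \<alpha>^(j
  (2 \<beta> + d)) of the squared Besov coefficient. The L2 part costs a geometric series of ratio
  N_I / N < 1.\<close>

lemma geometric_eventually_less:
  fixes a q e :: real
  assumes "0 \<le> q" "q < 1" "0 < e"
  shows "\<exists>n0. \<forall>n\<ge>n0. a * q ^ n < e"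
proof -
  have "(\<lambda>n. a * q ^ n) \<longlonglongrightarrow> a * 0"
    using assms by (intro tendsto_intros LIMSEQ_realpow_zero)
  then have "eventually (\<lambda>n. a * q ^ n < e) sequentially"
    using assms by (intro order_tendstoD(2)[of _ 0]) auto
  then show ?thesis by (simp add: eventually_sequentially)
qed

lemma L2_spaceD:
  assumes "f \<in> L2_space M"
  shows "f \<in> borel_measurable M" "integrable M (\<lambda>x. (f x)\<^sup>2)"
  using assms by (auto simp: L2_space_def)

lemma square_add_le: "(x + y)\<^sup>2 \<le> 2 * x\<^sup>2 + 2 * (y::real)\<^sup>2"
  using zero_le_power2[of "x - y"] by (simp add: power2_sum power2_diff)

lemma L2_space_lincomb:
  assumes f: "f \<in> L2_space M" and g: "g \<in> L2_space M"
  shows "(\<lambda>x. a * f x + b * g x) \<in> L2_space M"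
proof -
  note [measurable] = L2_spaceD(1)[OF f] L2_spaceD(1)[OF g]
  have "integrable M (\<lambda>x. 2 * (a\<^sup>2 * (f x)\<^sup>2) + 2 * (b\<^sup>2 * (g x)\<^sup>2))"
    using L2_spaceD(2)[OF f] L2_spaceD(2)[OF g] by auto
  then have "integrable M (\<lambda>x. (a * f x + b * g x)\<^sup>2)"
    by (rule Bochner_Integration.integrable_bound)
      (auto simp: power_mult_distrib[symmetric] intro!: AE_I2 square_add_le order_trans[OF _ abs_ge_self])
  then show ?thesis by (simp add: L2_space_def)
qed

lemma L2_space_diff: "f \<in> L2_space M \<Longrightarrow> g \<in> L2_space M \<Longrightarrow> (\<lambda>x. f x - g x) \<in> L2_space M"
  using L2_space_lincomb[of f M g 1 "-1"] by simp

lemma L2_integral_add_le: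
  assumes f: "f \<in> L2_space M" and g: "g \<in> L2_space M"
  shows "(\<integral>x. (f x + g x)\<^sup>2 \<partial>M) \<le> 2 * (\<integral>x. (f x)\<^sup>2 \<partial>M) + 2 * (\<integral>x. (g x)\<^sup>2 \<partial>M)"
proof -
  have "(\<integral>x. (f x + g x)\<^sup>2 \<partial>M) \<le> (\<integral>x. 2 * (f x)\<^sup>2 + 2 * (g x)\<^sup>2 \<partial>M)"
    using L2_spaceD(2)[OF f] L2_spaceD(2)[OF g] L2_space_lincomb[OF f g, of 1 1]
    by (intro integral_mono) (auto simp: L2_space_def intro: square_add_le)
  then show ?thesis
    using L2_spaceD(2)[OF f] L2_spaceD(2)[OF g] by simp
qed

lemma L2_norm_power2: "(L2_norm M f)\<^sup>2 = (\<integral>x. (f x)\<^sup>2 \<partial>M)"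
  by (simp add: L2_norm_def)

lemma L2_norm_nonneg: "0 \<le> L2_norm M f"
  by (simp add: L2_norm_def)

text \<open>The squared differences tend to 0 in L1, hence almost everywhere along a
  subsequence.\<close>

lemma L2_tendsto_AE_subseq:
  assumes H: "\<And>n. H n \<in> L2_space M" and h: "h \<in> L2_space M"
    and lim: "(\<lambda>n. \<integral>x. (H n x - h x)\<^sup>2 \<partial>M) \<longlonglongrightarrow> 0"
  shows "\<exists>r::nat \<Rightarrow> nat. strict_mono r \<and> (AE x in M. (\<lambda>n. H (r n) x) \<longlonglongrightarrow> h x)"
proof -
  have int: "integrable M (\<lambda>x. (H n x - h x)\<^sup>2)" for n
    using L2_space_diff[OF H h] by (simp add: L2_space_def)
  obtain r :: "nat \<Rightarrow> nat" where r: "strict_mono r"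
      and ae: "AE x in M. (\<lambda>n. (H (r n) x - h x)\<^sup>2) \<longlonglongrightarrow> 0"
    using tendsto_L1_AE_subseq[of M "\<lambda>n x. (H n x - h x)\<^sup>2"] int lim by auto
  have "AE x in M. (\<lambda>n. H (r n) x) \<longlonglongrightarrow> h x"
    using ae
  proof eventually_elim
    case (elim x)
    have "(\<lambda>n. sqrt ((H (r n) x - h x)\<^sup>2)) \<longlonglongrightarrow> sqrt 0"
      using elim by (intro tendsto_real_sqrt)
    then have "(\<lambda>n. H (r n) x - h x) \<longlonglongrightarrow> 0"
      by (simp add: tendsto_rabs_zero_iff)
    then show ?case by (simp add: LIM_zero_iff)
  qed
  with r show ?thesis by blast
qed

lemma L2_limit_unique:
  assumes "\<And>n. H n \<in> L2_space M" "h \<in> L2_space M" "h' \<in> L2_space M"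
    and "(\<lambda>n. \<integral>x. (H n x - h x)\<^sup>2 \<partial>M) \<longlonglongrightarrow> 0" "(\<lambda>n. \<integral>x. (H n x - h' x)\<^sup>2 \<partial>M) \<longlonglongrightarrow> 0"
  shows "AE x in M. h x = h' x"
proof -
  obtain r :: "nat \<Rightarrow> nat" where r: "strict_mono r" "AE x in M. (\<lambda>n. H (r n) x) \<longlonglongrightarrow> h x"
    using L2_tendsto_AE_subseq[OF assms(1,2,4)] by blast
  have "(\<lambda>n. \<integral>x. (H (r n) x - h' x)\<^sup>2 \<partial>M) \<longlonglongrightarrow> 0"
    using LIMSEQ_subseq_LIMSEQ[OF assms(5) r(1)] by (simp add: o_def)
  then obtain s :: "nat \<Rightarrow> nat" where s: "strict_mono s" "AE x in M. (\<lambda>n. H (r (s n)) x) \<longlonglongrightarrow> h' x"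
    using L2_tendsto_AE_subseq[of "\<lambda>n. H (r n)" M h'] assms(1,3) by blast
  show ?thesis
    using r(2) s(2)
  proof eventually_elim
    case (elim x)
    have "(\<lambda>n. H (r (s n)) x) \<longlonglongrightarrow> h x"
      using LIMSEQ_subseq_LIMSEQ[OF elim(1) s(1)] by (simp add: o_def)
    with elim(2) show ?case using LIMSEQ_unique by blast
  qed
qed

lemma (in finite_measure) L2_space_integrable:
  assumes "f \<in> L2_space M"
  shows "integrable M f"
proof (rule Bochner_Integration.integrable_bound)
  show "integrable M (\<lambda>x. 1 + (f x)\<^sup>2)"
    using assms by (auto simp: L2_space_def)
  have "\<bar>y\<bar> \<le> 1 + y\<^sup>2" for y :: real
  proof -
    have "(\<bar>y\<bar> - 1)\<^sup>2 = y\<^sup>2 - 2 * \<bar>y\<bar> + 1" by (simp add: power2_diff)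
    then show ?thesis using zero_le_power2[of "\<bar>y\<bar> - 1"] zero_le_power2[of y] by linarith
  qed
  then show "AE x in M. norm (f x) \<le> norm (1 + (f x)\<^sup>2)" by simp
qed (use assms in \<open>auto simp: L2_space_def\<close>)

locale dirichlet =
  fixes M :: "'x::polish_space measure" and K :: "'x set"
    and D :: "('x \<Rightarrow> real) set" and \<E> :: "('x \<Rightarrow> real) \<Rightarrow> ('x \<Rightarrow> real) \<Rightarrow> real"
  assumes fin: "finite_measure M" and setsM: "sets M = sets (restrict_space borel K)"
    and compactK: "compact K" and dform: "dirichlet_form M D \<E>"
begin

sublocale finite_measure M by (rule fin)

lemma spaceM: "space M = K"
  using sets_eq_imp_space_eq[OF setsM] by (simp add: space_restrict_space)

lemma cform: "closed_form M D \<E>"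
  using dform by (simp add: dirichlet_form_def)

lemma D_L2: "f \<in> D \<Longrightarrow> f \<in> L2_space M"
  using cform by (auto simp: closed_form_def)

lemma D_meas: "f \<in> D \<Longrightarrow> f \<in> borel_measurable M"
  using D_L2 by (auto simp: L2_space_def)

lemma continuous_meas:
  assumes "continuous_on K f"
  shows "f \<in> borel_measurable M"
  using borel_measurable_continuous_on_restrict[OF assms] unfolding measurable_cong_sets[OF setsM refl] .

lemma openin_sets: "openin (top_of_set K) U \<Longrightarrow> U \<in> sets M"
  unfolding openin_open setsM sets_restrict_space using borel_open by blast

text \<open>Elements of \<open>D\<close> stand for classes, and every change of representative goes
  through this lemma. \<open>closed_form\<close> exchanges f for g in the first argument only;
  symmetry gives the second.\<close>

lemma D_AE:
  assumes "f \<in> D" "g \<in> borel_measurable M" "AE x in M. f x = g x"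
  shows "g \<in> D" "\<E> g g = \<E> f f"
proof -
  have *: "\<forall>f\<in>D. \<forall>g\<in>borel_measurable M. (AE x in M. f x = g x) \<longrightarrow> g \<in> D \<and> (\<forall>h\<in>D. \<E> f h = \<E> g h)"
    using cform unfolding closed_form_def by meson
  then show g: "g \<in> D" using assms by blast
  have "\<E> f f = \<E> g f" "\<E> f g = \<E> g g"
    using * assms g by blast+
  moreover have "\<E> f g = \<E> g f"
    using cform assms g unfolding closed_form_def by meson
  ultimately show "\<E> g g = \<E> f f" by simp
qed

lemma D_cong:
  assumes "f \<in> D" "\<And>x. x \<in> K \<Longrightarrow> f x = g x"
  shows "g \<in> D" "\<E> g g = \<E> f f"
proof -
  have "g \<in> borel_measurable M"
    using D_meas[OF assms(1)] measurable_cong[of M f g borel] assms(2) spaceM by simp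
  moreover have "AE x in M. f x = g x"
    using assms(2) spaceM by (intro AE_I2) auto
  ultimately show "g \<in> D" "\<E> g g = \<E> f f"
    using D_AE[OF assms(1)] by auto
qed

lemma D_lincomb: "f \<in> D \<Longrightarrow> g \<in> D \<Longrightarrow> (\<lambda>x. a * f x + b * g x) \<in> D"
  using cform unfolding closed_form_def by meson

lemma E_lincomb:
  "f \<in> D \<Longrightarrow> g \<in> D \<Longrightarrow> h \<in> D \<Longrightarrow> \<E> (\<lambda>x. a * f x + b * g x) h = a * \<E> f h + b * \<E> g h"
  using cform unfolding closed_form_def by meson

lemma E_sym: "f \<in> D \<Longrightarrow> g \<in> D \<Longrightarrow> \<E> f g = \<E> g f"
  using cform unfolding closed_form_def by meson

lemma E_nonneg: "f \<in> D \<Longrightarrow> 0 \<le> \<E> f f"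
  using cform unfolding closed_form_def by meson

lemma D_add: "f \<in> D \<Longrightarrow> g \<in> D \<Longrightarrow> (\<lambda>x. f x + g x) \<in> D"
  using D_lincomb[of f g 1 1] by simp

lemma D_diff: "f \<in> D \<Longrightarrow> g \<in> D \<Longrightarrow> (\<lambda>x. f x - g x) \<in> D"
  using D_lincomb[of f g 1 "-1"] by simp

lemma D_scale: "f \<in> D \<Longrightarrow> (\<lambda>x. a * f x) \<in> D"
  using D_lincomb[of f f a 0] by simp

lemma E_lincomb2:
  assumes "f \<in> D" "g \<in> D"
  shows "\<E> (\<lambda>x. a * f x + b * g x) (\<lambda>x. a * f x + b * g x) = a\<^sup>2 * \<E> f f + 2 * a * b * \<E> f g + b\<^sup>2 * \<E> g g"
proof -
  have "\<E> (\<lambda>x. a * f x + b * g x) f = a * \<E> f f + b * \<E> g f"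
       "\<E> (\<lambda>x. a * f x + b * g x) g = a * \<E> f g + b * \<E> g g"
    using assms by (auto simp: E_lincomb)
  moreover have "\<E> (\<lambda>x. a * f x + b * g x) (\<lambda>x. a * f x + b * g x)
      = a * \<E> f (\<lambda>x. a * f x + b * g x) + b * \<E> g (\<lambda>x. a * f x + b * g x)"
    by (intro E_lincomb D_lincomb assms)
  moreover have "\<E> f (\<lambda>x. a * f x + b * g x) = \<E> (\<lambda>x. a * f x + b * g x) f"
    "\<E> g (\<lambda>x. a * f x + b * g x) = \<E> (\<lambda>x. a * f x + b * g x) g"
    by (intro E_sym D_lincomb assms)+
  moreover have "\<E> g f = \<E> f g" by (intro E_sym assms)
  ultimately show ?thesis
    by (simp only: power2_eq_square) (simp add: algebra_simps)
qed

lemma E_scale: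
  assumes "f \<in> D"
  shows "\<E> (\<lambda>x. a * f x) (\<lambda>x. a * f x) = a\<^sup>2 * \<E> f f"
  using E_lincomb2[OF assms assms, of a 0] by simp

text \<open>Nonnegativity of the energy of f - g, which serves in place of the Cauchy-Schwarz
  inequality.\<close>

lemma E_cross_le:
  assumes "f \<in> D" "g \<in> D"
  shows "2 * \<E> f g \<le> \<E> f f + \<E> g g"
  using E_nonneg[OF D_lincomb[OF assms, of 1 "-1"]] E_lincomb2[OF assms, of 1 "-1"] by simp

lemma E_add_le:
  assumes "f \<in> D" "g \<in> D"
  shows "\<E> (\<lambda>x. f x + g x) (\<lambda>x. f x + g x) \<le> 2 * \<E> f f + 2 * \<E> g g"
  using E_lincomb2[OF assms, of 1 1] E_cross_le[OF assms] by simp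

lemma E_diff_le:
  assumes "f \<in> D" "g \<in> D"
  shows "\<E> (\<lambda>x. f x - g x) (\<lambda>x. f x - g x) \<le> 2 * \<E> f f + 2 * \<E> g g"
  using E_add_le[OF assms(1) D_scale[OF assms(2)], of "-1"] E_scale[OF assms(2), of "-1"] by simp

text \<open>A is nonempty because the zero function is at hand only as a multiple of a given
  member.\<close>

lemma D_sum:
  assumes "finite A" "A \<noteq> {}" "\<And>i. i \<in> A \<Longrightarrow> f i \<in> D"
  shows "(\<lambda>x. \<Sum>i\<in>A. f i x) \<in> D"
  using assms by (induction rule: finite_ne_induct) (auto intro: D_add)

lemma E_sum_left:
  assumes "finite A" "A \<noteq> {}" "\<And>i. i \<in> A \<Longrightarrow> f i \<in> D" "h \<in> D"
  shows "\<E> (\<lambda>x. \<Sum>i\<in>A. f i x) h = (\<Sum>i\<in>A. \<E> (f i) h)"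
  using assms
proof (induction rule: finite_ne_induct)
  case (insert a A)
  then show ?case
    using E_lincomb[OF _ D_sum[of A f], of "f a" h 1 1] by simp
qed simp

text \<open>Each mixed term of the expanded square is at most the mean of its two diagonal terms.
  The factor \<open>card A\<close> is harmless later, where boundedly many bumps are visible on a
  cell.\<close>

lemma E_sum_le:
  assumes A: "finite A" "A \<noteq> {}" "\<And>i. i \<in> A \<Longrightarrow> f i \<in> D"
  shows "\<E> (\<lambda>x. \<Sum>i\<in>A. f i x) (\<lambda>x. \<Sum>i\<in>A. f i x) \<le> real (card A) * (\<Sum>i\<in>A. \<E> (f i) (f i))"
proof -
  let ?s = "\<lambda>x. \<Sum>i\<in>A. f i x"
  have "\<E> ?s ?s = (\<Sum>i\<in>A. \<E> (f i) ?s)"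
    using A by (intro E_sum_left D_sum)
  also have "\<dots> = (\<Sum>i\<in>A. \<E> ?s (f i))"
    using A by (intro sum.cong refl E_sym D_sum)
  also have "\<dots> = (\<Sum>i\<in>A. \<Sum>j\<in>A. \<E> (f j) (f i))"
    using A by (intro sum.cong refl E_sum_left)
  also have "\<dots> \<le> (\<Sum>i\<in>A. \<Sum>j\<in>A. (\<E> (f j) (f j) + \<E> (f i) (f i)) / 2)"
  proof (intro sum_mono)
    fix i j assume "i \<in> A" "j \<in> A"
    then show "\<E> (f j) (f i) \<le> (\<E> (f j) (f j) + \<E> (f i) (f i)) / 2"
      using E_cross_le[of "f j" "f i"] A(3) by simp
  qed
  also have "\<dots> = real (card A) * (\<Sum>i\<in>A. \<E> (f i) (f i))"
    by (simp add: add_divide_distrib sum.distrib sum_distrib_left sum_divide_distrib[symmetric])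
  finally show ?thesis .
qed

lemma unit_contraction:
  assumes "f \<in> D"
  shows "(\<lambda>x. min (max (f x) 0) 1) \<in> D"
    "\<E> (\<lambda>x. min (max (f x) 0) 1) (\<lambda>x. min (max (f x) 0) 1) \<le> \<E> f f"
  using dform assms unfolding dirichlet_form_def by blast+

lemma min_one_contraction:
  assumes f: "f \<in> D" "\<And>x. x \<in> K \<Longrightarrow> 0 \<le> f x"
  shows "(\<lambda>x. min 1 (f x)) \<in> D" "\<E> (\<lambda>x. min 1 (f x)) (\<lambda>x. min 1 (f x)) \<le> \<E> f f"
proof -
  have eq: "min (max (f x) 0) 1 = min 1 (f x)" if "x \<in> K" for x
    using f(2)[OF that] by simp
  show "(\<lambda>x. min 1 (f x)) \<in> D"
    by (rule D_cong(1)[OF unit_contraction(1)[OF f(1)] eq])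
  show "\<E> (\<lambda>x. min 1 (f x)) (\<lambda>x. min 1 (f x)) \<le> \<E> f f"
    using D_cong(2)[OF unit_contraction(1)[OF f(1)] eq] unit_contraction(2)[OF f(1)] by simp
qed

text \<open>The square of \<open>form_norm\<close> on \<open>D\<close>. With squares the triangle
  inequality becomes \<open>nrm_add_le\<close> with the factor 2, and no roots have to be carried
  along.\<close>

definition nrm :: "('x \<Rightarrow> real) \<Rightarrow> real" where
  "nrm f = \<E> f f + (\<integral>x. (f x)\<^sup>2 \<partial>M)"

lemma form_norm_eq: "form_norm M \<E> f = sqrt (nrm f)"
  by (simp add: form_norm_def nrm_def L2_norm_power2)

lemma nrm_nonneg: "f \<in> D \<Longrightarrow> 0 \<le> nrm f"
  by (simp add: nrm_def E_nonneg)

lemma form_norm_power2: "f \<in> D \<Longrightarrow> (form_norm M \<E> f)\<^sup>2 = nrm f"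
  by (simp add: form_norm_eq nrm_nonneg)

lemma L2_le_nrm: "f \<in> D \<Longrightarrow> (\<integral>x. (f x)\<^sup>2 \<partial>M) \<le> nrm f"
  by (simp add: nrm_def E_nonneg)

lemma nrm_add_le:
  assumes "f \<in> D" "g \<in> D"
  shows "nrm (\<lambda>x. f x + g x) \<le> 2 * nrm f + 2 * nrm g"
  using E_add_le[OF assms] L2_integral_add_le[OF D_L2[OF assms(1)] D_L2[OF assms(2)]]
  by (simp add: nrm_def)

lemma nrm_scale:
  assumes "f \<in> D"
  shows "nrm (\<lambda>x. a * f x) = a\<^sup>2 * nrm f"
  using E_scale[OF assms] by (simp add: nrm_def power_mult_distrib algebra_simps)

lemma nrm_uminus: "f \<in> D \<Longrightarrow> nrm (\<lambda>x. - f x) = nrm f"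
  using nrm_scale[of f "-1"] by simp

lemma nrm_diff_le:
  assumes "f \<in> D" "g \<in> D"
  shows "nrm (\<lambda>x. f x - g x) \<le> 2 * nrm f + 2 * nrm g"
  using nrm_add_le[OF assms(1) D_scale[OF assms(2)], of "-1"] nrm_scale[OF assms(2), of "-1"] by simp

lemma nrm_diff_commute: "f \<in> D \<Longrightarrow> g \<in> D \<Longrightarrow> nrm (\<lambda>x. f x - g x) = nrm (\<lambda>x. g x - f x)"
  using nrm_uminus[OF D_diff, of f g] by simp

lemma nrm_AE:
  assumes "f \<in> D" "g \<in> borel_measurable M" "AE x in M. f x = g x"
  shows "nrm g = nrm f"
proof -
  have "(\<integral>x. (g x)\<^sup>2 \<partial>M) = (\<integral>x. (f x)\<^sup>2 \<partial>M)"
    using assms D_meas[OF assms(1)] by (intro integral_cong_AE) auto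
  then show ?thesis using D_AE[OF assms] by (simp add: nrm_def)
qed

lemma nrm_unit_contraction:
  assumes "f \<in> D"
  shows "nrm (\<lambda>x. min (max (f x) 0) 1) \<le> nrm f"
proof -
  have "(\<integral>x. (min (max (f x) 0) 1)\<^sup>2 \<partial>M) \<le> (\<integral>x. (f x)\<^sup>2 \<partial>M)"
  proof (intro integral_mono)
    show "(min (max (f x) 0) 1)\<^sup>2 \<le> (f x)\<^sup>2" for x
      by (rule abs_le_square_iff[THEN iffD1]) (auto simp: min_def max_def)
  qed (use D_L2[OF assms] D_L2[OF unit_contraction(1)[OF assms]] in \<open>auto simp: L2_space_def\<close>)
  then show ?thesis using unit_contraction[OF assms] by (simp add: nrm_def)
qed

text \<open>Ordered pairs m \<le> n suffice in the Cauchy condition by symmetry; this is the form in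
  which differences of approximations are estimated.\<close>

lemma nrm_complete:
  assumes u: "\<And>n. u n \<in> D" and cauchy: "\<And>e. 0 < e \<Longrightarrow> \<exists>n0. \<forall>m\<ge>n0. \<forall>n\<ge>m. nrm (\<lambda>x. u n x - u m x) < e"
  shows "\<exists>f\<in>D. (\<lambda>n. nrm (\<lambda>x. u n x - f x)) \<longlonglongrightarrow> 0"
proof -
  have "\<exists>n0. \<forall>m\<ge>n0. \<forall>n\<ge>n0. form_norm M \<E> (\<lambda>x. u m x - u n x) < e" if e: "0 < e" for e
  proof -
    obtain n0 where n0: "\<forall>m\<ge>n0. \<forall>n\<ge>m. nrm (\<lambda>x. u n x - u m x) < e\<^sup>2"
      using cauchy[of "e\<^sup>2"] e by auto
    have "form_norm M \<E> (\<lambda>x. u m x - u n x) < e" if "n0 \<le> m" "n0 \<le> n" for m n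
    proof -
      have "nrm (\<lambda>x. u m x - u n x) < e\<^sup>2"
        using n0 that nrm_diff_commute[OF u u] by (cases "n \<le> m") force+
      then have "sqrt (nrm (\<lambda>x. u m x - u n x)) < sqrt (e\<^sup>2)"
        by (rule real_sqrt_less_mono)
      then show ?thesis using e by (simp add: form_norm_eq)
    qed
    then show ?thesis by blast
  qed
  then have "(\<forall>n. u n \<in> D) \<and> (\<forall>e>0. \<exists>n0. \<forall>m\<ge>n0. \<forall>n\<ge>n0. form_norm M \<E> (\<lambda>x. u m x - u n x) < e)"
    using u by blast
  moreover have "(\<forall>n. u n \<in> D) \<and> (\<forall>e>0. \<exists>n0. \<forall>m\<ge>n0. \<forall>n\<ge>n0. form_norm M \<E> (\<lambda>x. u m x - u n x) < e) \<longrightarrow>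
      (\<exists>f\<in>D. (\<lambda>n. form_norm M \<E> (\<lambda>x. u n x - f x)) \<longlonglongrightarrow> 0)"
    using cform unfolding closed_form_def by (elim conjE) (erule allE[of _ u])
  ultimately obtain f where f: "f \<in> D" "(\<lambda>n. form_norm M \<E> (\<lambda>x. u n x - f x)) \<longlonglongrightarrow> 0"
    by blast
  have "(\<lambda>n. (form_norm M \<E> (\<lambda>x. u n x - f x))\<^sup>2) \<longlonglongrightarrow> 0\<^sup>2"
    using f(2) by (intro tendsto_power)
  moreover have "(form_norm M \<E> (\<lambda>x. u n x - f x))\<^sup>2 = nrm (\<lambda>x. u n x - f x)" for n
    by (intro form_norm_power2 D_diff u f)
  ultimately have "(\<lambda>n. nrm (\<lambda>x. u n x - f x)) \<longlonglongrightarrow> 0" by simp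
  then show ?thesis using f(1) by blast
qed

lemma nrm_tendsto_L2:
  assumes "\<And>n. u n \<in> D" "f \<in> D" "(\<lambda>n. nrm (\<lambda>x. u n x - f x)) \<longlonglongrightarrow> 0"
  shows "(\<lambda>n. \<integral>x. (u n x - f x)\<^sup>2 \<partial>M) \<longlonglongrightarrow> 0"
  using assms(3)
  by (rule tendsto_sandwich[OF _ _ tendsto_const, rotated 2]) (auto intro!: always_eventually L2_le_nrm D_diff assms)

section \<open>Capacity of open sets\<close>

lemma open_capacity_le:
  assumes "u \<in> D" "AE x in M. x \<in> U \<longrightarrow> 1 \<le> u x"
  shows "open_capacity M D \<E> U \<le> ennreal (nrm u)"
  unfolding open_capacity_def using assms form_norm_power2[OF assms(1)]
  by (intro INF_lower2[of u]) auto

text \<open>Unit contraction keeps a near-minimizer admissible and does not raise its norm. It also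
  makes it nonnegative, so that test functions of different sets can be added.\<close>

lemma open_capacity_obtain:
  assumes "open_capacity M D \<E> U < ennreal e"
  obtains u where "u \<in> D" "AE x in M. x \<in> U \<longrightarrow> 1 \<le> u x" "nrm u < e"
    "AE x in M. 0 \<le> u x"
proof -
  obtain u where u: "u \<in> D" "AE x in M. x \<in> U \<longrightarrow> 1 \<le> u x" "ennreal (nrm u) < ennreal e"
    using assms form_norm_power2 unfolding open_capacity_def INF_less_iff by force
  have "nrm u < e"
    using u(1,3) nrm_nonneg by (simp add: ennreal_less_iff)
  moreover have "AE x in M. x \<in> U \<longrightarrow> 1 \<le> min (max (u x) 0) 1"
    using u(2) by eventually_elim auto
  ultimately show ?thesis
    using that[OF unit_contraction(1)[OF u(1)]] nrm_unit_contraction[OF u(1)] by auto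
qed

lemma capacity_open:
  assumes "openin (top_of_set K) U"
  shows "capacity M K D \<E> U = open_capacity M D \<E> U"
proof (rule antisym)
  show "capacity M K D \<E> U \<le> open_capacity M D \<E> U"
    unfolding capacity_def using assms by (intro INF_lower2[of U]) auto
  show "open_capacity M D \<E> U \<le> capacity M K D \<E> U"
    unfolding capacity_def open_capacity_def
    by (intro INF_greatest INF_superset_mono) auto
qed

lemma capacity_mono_open:
  assumes "openin (top_of_set K) U" "A \<subseteq> U"
  shows "capacity M K D \<E> A \<le> open_capacity M D \<E> U"
  unfolding capacity_def using assms by (intro INF_lower2[of U]) auto

text \<open>Chebyshev: \<open>u\<^sup>2\<close> dominates the indicator of U almost everywhere, and
  its integral is part of the squared norm.\<close>

lemma measure_le_open_capacity:
  assumes U: "U \<in> sets M"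
  shows "emeasure M U \<le> open_capacity M D \<E> U"
  unfolding open_capacity_def
proof (rule INF_greatest)
  fix u assume "u \<in> {u \<in> D. AE x in M. x \<in> U \<longrightarrow> 1 \<le> u x}"
  then have u: "u \<in> D" "AE x in M. x \<in> U \<longrightarrow> 1 \<le> u x" by auto
  have "emeasure M U = (\<integral>\<^sup>+x. indicator U x \<partial>M)" using U by simp
  also have "\<dots> \<le> (\<integral>\<^sup>+x. ennreal ((u x)\<^sup>2) \<partial>M)"
    using u(2) by (intro nn_integral_mono_AE, eventually_elim) (auto split: split_indicator intro: power_increasing simp: one_le_power)
  also have "\<dots> = ennreal (\<integral>x. (u x)\<^sup>2 \<partial>M)"
    using D_L2[OF u(1)] by (intro nn_integral_eq_integral) (auto simp: L2_space_def)
  also have "\<dots> \<le> ennreal ((form_norm M \<E> u)\<^sup>2)"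
    using L2_le_nrm[OF u(1)] by (simp add: form_norm_power2[OF u(1)] ennreal_leI)
  finally show "emeasure M U \<le> ennreal ((form_norm M \<E> u)\<^sup>2)" .
qed

text \<open>The first summand is split off. It contributes 2 e / 4^(m+1) and the rest, by induction,
  the same, which makes e / 4^m: the ratio 4 absorbs the factor 2 of
  \<open>nrm_add_le\<close>.\<close>

lemma nrm_partial_sum_le:
  assumes u: "\<And>k. u k \<in> D" and e: "\<And>k. nrm (u k) \<le> e / 4 ^ (k + 1)" "0 \<le> e"
  shows "nrm (\<lambda>x. \<Sum>k\<in>{m..<m + n}. u k x) \<le> e / 4 ^ m" (is "?L m n \<le> _")
    and "(\<lambda>x. \<Sum>k\<in>{m..<m + n}. u k x) \<in> D"
proof -
  have zero: "(\<lambda>x. 0) \<in> D" "nrm (\<lambda>x. 0) = 0"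
    using D_scale[OF u[of 0], of 0] nrm_scale[OF u[of 0], of 0] by auto
  have D: "(\<lambda>x. \<Sum>k\<in>{m..<m + n}. u k x) \<in> D" for m n
    using D_sum[of "{m..<m + n}" u] zero(1) u by (cases n) auto
  show "(\<lambda>x. \<Sum>k\<in>{m..<m + n}. u k x) \<in> D" by fact
  show "?L m n \<le> e / 4 ^ m"
  proof (induction n arbitrary: m)
    case 0
    then show ?case using zero e by simp
  next
    case (Suc n)
    have eq: "{m..<m + Suc n} = insert m {Suc m..<Suc m + n}" by auto
    have "?L m (Suc n) = nrm (\<lambda>x. u m x + (\<Sum>k\<in>{Suc m..<Suc m + n}. u k x))"
      unfolding eq by simp
    also have "\<dots> \<le> 2 * nrm (u m) + 2 * ?L (Suc m) n"
      by (intro nrm_add_le u D)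
    also have "\<dots> \<le> 2 * (e / 4 ^ (m + 1)) + 2 * (e / 4 ^ Suc m)"
      using e(1)[of m] Suc[of "Suc m"] by simp
    finally show ?case by simp
  qed
qed

text \<open>The weights \<open>4\<^sup>k\<close> replace the subadditivity of the capacity, which would require more than the
  unit contraction.\<close>

lemma open_capacity_Union_le:
  assumes u: "\<And>k. u k \<in> D" "\<And>k. AE x in M. 0 \<le> u k x" "\<And>k::nat. AE x in M. x \<in> U k \<longrightarrow> 1 \<le> u k x"
    and e: "\<And>k. nrm (u k) \<le> e / 4 ^ (k + 1)" "0 < e"
  shows "open_capacity M D \<E> (\<Union>k. U k) \<le> ennreal (4 * e)"
proof -
  define s where "s n = (\<lambda>x. \<Sum>k\<in>{0..<n}. u k x)" for n :: nat
  have s: "s n \<in> D" and s_nrm: "nrm (s n) \<le> e" for n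
    unfolding s_def using nrm_partial_sum_le[OF u(1) e(1), of 0 n] e(2) by auto
  have diff: "nrm (\<lambda>x. s n x - s m x) \<le> e / 4 ^ m" if "m \<le> n" for m n
  proof -
    have "(\<lambda>x. s n x - s m x) = (\<lambda>x. \<Sum>k\<in>{m..<m + (n - m)}. u k x)"
      using that unfolding s_def by (intro ext) (simp add: sum_diff_nat_ivl)
    then show ?thesis using nrm_partial_sum_le(1)[OF u(1) e(1), of m "n - m"] e(2) by simp
  qed
  have "\<exists>f\<in>D. (\<lambda>n. nrm (\<lambda>x. s n x - f x)) \<longlonglongrightarrow> 0"
  proof (rule nrm_complete[OF s])
    fix \<epsilon> :: real assume "0 < \<epsilon>"
    obtain n0 where n0: "\<forall>m\<ge>n0. e * (1 / 4) ^ m < \<epsilon>"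
      using geometric_eventually_less[of "1 / 4" \<epsilon> e] \<open>0 < \<epsilon>\<close> by auto
    show "\<exists>n0. \<forall>m\<ge>n0. \<forall>n\<ge>m. nrm (\<lambda>x. s n x - s m x) < \<epsilon>"
    proof (intro exI[of _ n0] allI impI)
      fix m n assume "n0 \<le> m" "m \<le> n"
      then have "nrm (\<lambda>x. s n x - s m x) \<le> e * (1 / 4) ^ m" "e * (1 / 4) ^ m < \<epsilon>"
        using diff[of m n] n0 by (simp_all add: power_one_over)
      then show "nrm (\<lambda>x. s n x - s m x) < \<epsilon>" by simp
    qed
  qed
  then obtain f where f: "f \<in> D" "(\<lambda>n. nrm (\<lambda>x. s n x - f x)) \<longlonglongrightarrow> 0" by blast
  have "eventually (\<lambda>n. nrm (\<lambda>x. s n x - f x) < e) sequentially"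
    using f(2) e(2) by (rule order_tendstoD(2))
  then obtain n where n: "nrm (\<lambda>x. s n x - f x) < e"
    by (auto simp: eventually_sequentially)
  \<comment> \<open>f is written as a difference of two functions of squared norm at most e, whence
    2 e + 2 e.\<close>
  have "nrm (\<lambda>x. s n x - (s n x - f x)) \<le> 2 * nrm (s n) + 2 * nrm (\<lambda>x. s n x - f x)"
    by (intro nrm_diff_le s D_diff f)
  then have nrm_f: "nrm f \<le> 4 * e" using s_nrm[of n] n by simp
  obtain r :: "nat \<Rightarrow> nat" where r: "strict_mono r" "AE x in M. (\<lambda>n. s (r n) x) \<longlonglongrightarrow> f x"
    using L2_tendsto_AE_subseq[OF D_L2[OF s] D_L2[OF f(1)] nrm_tendsto_L2[OF s f]] by blast
  have "AE x in M. \<forall>k. 0 \<le> u k x" "AE x in M. \<forall>k. x \<in> U k \<longrightarrow> 1 \<le> u k x"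
    using u(2,3) by (simp_all add: AE_all_countable)
  with r(2) have "AE x in M. x \<in> (\<Union>k. U k) \<longrightarrow> 1 \<le> f x"
  proof eventually_elim
    case (elim x)
    show ?case
    proof
      assume "x \<in> (\<Union>k. U k)"
      then obtain k where k: "x \<in> U k" by blast
      \<comment> \<open>All summands are nonnegative, the k-th one is at least 1 on
        \<open>U k\<close>, and r n \<ge> n > k puts it into the partial sum.\<close>
      have "1 \<le> s (r n) x" if "n \<ge> Suc k" for n
      proof -
        have "Suc k \<le> r n" using that strict_mono_imp_increasing[OF r(1), of n] by linarith
        then have "u k x \<le> s (r n) x"
          unfolding s_def using elim(2) by (intro member_le_sum) auto
        then show ?thesis using elim(3) k by force
      qed
      then show "1 \<le> f x"
        by (intro tendsto_lowerbound[OF elim(1)]) (auto simp: eventually_sequentially)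
    qed
  qed
  then have "open_capacity M D \<E> (\<Union>k. U k) \<le> ennreal (nrm f)"
    by (rule open_capacity_le[OF f(1)])
  also have "\<dots> \<le> ennreal (4 * e)" using nrm_f by (rule ennreal_leI)
  finally show ?thesis .
qed

lemma open_capacity_Un_le:
  assumes "open_capacity M D \<E> U < ennreal e" "open_capacity M D \<E> V < ennreal e"
  shows "open_capacity M D \<E> (U \<union> V) \<le> ennreal (4 * e)"
proof -
  obtain u where u: "u \<in> D" "AE x in M. x \<in> U \<longrightarrow> 1 \<le> u x" "nrm u < e" "AE x in M. 0 \<le> u x"
    using open_capacity_obtain[OF assms(1)] .
  obtain v where v: "v \<in> D" "AE x in M. x \<in> V \<longrightarrow> 1 \<le> v x" "nrm v < e" "AE x in M. 0 \<le> v x"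
    using open_capacity_obtain[OF assms(2)] .
  have "AE x in M. x \<in> U \<union> V \<longrightarrow> 1 \<le> u x + v x"
    using u(2,4) v(2,4) by eventually_elim auto
  then have "open_capacity M D \<E> (U \<union> V) \<le> ennreal (nrm (\<lambda>x. u x + v x))"
    by (intro open_capacity_le D_add u v)
  also have "\<dots> \<le> ennreal (4 * e)"
    using nrm_add_le[OF u(1) v(1)] u(3) v(3) by (intro ennreal_leI) simp
  finally show ?thesis .
qed

section \<open>Quasi-continuous modifications\<close>

text \<open>Let \<open>U k\<close> be where consecutive terms differ by more than 2^-k. Scaling by
  2^k gives it a test function of squared norm of order 4^k / 64^k = 16^-k, which leaves room for
  the weights 4^k of \<open>open_capacity_Union_le\<close>. Outside \<open>G m\<close>, the union of
  the later \<open>U k\<close>, convergence is uniform, so the limit is continuous there.\<close>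

lemma rapid_limit_quasi_continuous:
  assumes h: "h \<in> D" and H: "\<And>k. H k \<in> D" "\<And>k. continuous_on K (H k)"
    and lim: "(\<lambda>k. nrm (\<lambda>x. H k x - h x)) \<longlonglongrightarrow> 0"
    and rapid: "\<And>k::nat. nrm (\<lambda>x. H (Suc k) x - H k x) \<le> 1 / 64 ^ k"
  shows "\<exists>g G. quasi_cont_modification M K D \<E> h g \<and>
    (\<forall>m. openin (top_of_set K) (G m) \<and> open_capacity M D \<E> (G m) \<le> ennreal (64 / 16 ^ m) \<and>
      (\<forall>x\<in>K - G m. (\<lambda>k. H k x) \<longlonglongrightarrow> g x))"
proof -
  define d where "d k x = H (Suc k) x - H k x" for k x
  have d: "d k \<in> D" "continuous_on K (d k)" for k
    unfolding d_def using H by (auto intro!: D_diff continuous_intros)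
  define U where "U k = {x\<in>K. 1 < \<bar>2 ^ k * d k x\<bar>}" for k
  define G where "G m = (\<Union>k. U (m + k))" for m
  define g where "g x = lim (\<lambda>k. H k x)" for x
  have "U k = K \<inter> (\<lambda>x. \<bar>2 ^ k * d k x\<bar>) -` {1<..}" for k
    by (auto simp: U_def)
  moreover have "openin (top_of_set K) (K \<inter> (\<lambda>x. \<bar>2 ^ k * d k x\<bar>) -` {1<..})" for k
    by (intro continuous_openin_preimage_gen continuous_intros d open_greaterThan)
  ultimately have U: "openin (top_of_set K) (U k)" for k by simp
  have G_open: "openin (top_of_set K) (G m)" for m
    unfolding G_def using U by blast
  \<comment> \<open>To use the unit contraction alone, the positive and the negative part of the
    scaled difference are truncated separately; on \<open>U k\<close> exactly one of them is 1 and
    the other 0.\<close>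
  define u where "u k x = min (max (2 ^ k * d k x) 0) 1 + min (max (- (2 ^ k) * d k x) 0) 1" for k x
  have u_D: "u k \<in> D" for k
    unfolding u_def by (intro D_add unit_contraction D_scale d)
  have u_nrm: "nrm (u k) \<le> 4 / 16 ^ k" for k
  proof -
    note D = D_scale[OF d(1)[of k], of "2 ^ k"] D_scale[OF d(1)[of k], of "- (2 ^ k)"]
    have "nrm (u k) \<le> 2 * nrm (\<lambda>x. min (max (2 ^ k * d k x) 0) 1) + 2 * nrm (\<lambda>x. min (max (- (2 ^ k) * d k x) 0) 1)"
      unfolding u_def by (intro nrm_add_le unit_contraction D)
    also have "\<dots> \<le> 2 * nrm (\<lambda>x. 2 ^ k * d k x) + 2 * nrm (\<lambda>x. - (2 ^ k) * d k x)"
      using nrm_unit_contraction[OF D(1)] nrm_unit_contraction[OF D(2)] by linarith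
    also have "\<dots> = 4 * (4 ^ k * nrm (d k))"
      using nrm_scale[OF d(1)[of k], of "2 ^ k"] nrm_scale[OF d(1)[of k], of "- (2 ^ k)"]
      by (simp add: power2_eq_square flip: power_mult_distrib)
    also have "\<dots> \<le> 4 * (4 ^ k * (1 / 64 ^ k))"
      using rapid[of k] unfolding d_def by (intro mult_left_mono) auto
    also have "\<dots> = 4 / 16 ^ k"
      using power_mult_distrib[of "4::real" 16 k] by (simp add: field_simps)
    finally show ?thesis .
  qed
  have G_cap: "open_capacity M D \<E> (G m) \<le> ennreal (64 / 16 ^ m)" for m
  proof -
    \<comment> \<open>Here e is 16 / 16^m, since 4 / 16^(m+k) is at most e / 4^(k+1).\<close>
    have "open_capacity M D \<E> (\<Union>k. U (m + k)) \<le> ennreal (4 * (16 / 16 ^ m))"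
    proof (rule open_capacity_Union_le[of "\<lambda>k. u (m + k)"])
      show "nrm (u (m + k)) \<le> 16 / 16 ^ m / 4 ^ (k + 1)" for k
      proof -
        have "nrm (u (m + k)) \<le> 4 / 16 ^ m / 16 ^ k" using u_nrm[of "m + k"] by (simp add: power_add)
        also have "\<dots> \<le> 4 / 16 ^ m / 4 ^ k"
          by (intro divide_left_mono power_mono) auto
        finally show ?thesis by (simp add: field_simps)
      qed
      show "AE x in M. x \<in> U (m + k) \<longrightarrow> 1 \<le> u (m + k) x" for k
        by (rule AE_I2) (auto simp: U_def u_def min_def max_def abs_if split: if_splits)
      show "AE x in M. 0 \<le> u (m + k) x" for k by (auto simp: u_def)
    qed (use u_D in auto)
    then show ?thesis by (simp add: G_def)
  qed
  have small: "\<exists>m. open_capacity M D \<E> (G m) < e" if e: "0 < e" for e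
  proof -
    obtain e' where e': "0 < e'" "ennreal e' < e"
    proof (cases e)
      case (real r)
      then show ?thesis using that[of "r / 2"] e by (auto simp: ennreal_lessI)
    next
      case top
      then show ?thesis using that[of 1] by simp
    qed
    obtain m where "64 * (1 / 16) ^ m < e'"
      using geometric_eventually_less[of "1 / 16" e' "64"] e'(1) by auto
    then have "ennreal (64 / 16 ^ m) \<le> ennreal e'"
      by (intro ennreal_leI) (simp add: power_one_over)
    then show ?thesis using G_cap[of m] e'(2) by (meson le_less_trans order_trans)
  qed
  have dist_le: "\<bar>H n x - H k x\<bar> \<le> 2 / 2 ^ k" if "x \<in> K - G m" "m \<le> k" "k \<le> n" for x m k n
  proof -
    have le: "\<bar>d j x\<bar> \<le> (1 / 2) ^ j" if "m \<le> j" for j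
    proof -
      have "x \<notin> U (m + (j - m))" using \<open>x \<in> K - G m\<close> unfolding G_def by blast
      then have "\<bar>2 ^ j * d j x\<bar> \<le> 1" using \<open>x \<in> K - G m\<close> that by (auto simp: U_def not_less)
      then show ?thesis by (simp add: abs_mult field_simps)
    qed
    have "\<bar>H n x - H k x\<bar> \<le> 2 * (1 / 2) ^ k - 2 * (1 / 2) ^ n"
      using \<open>k \<le> n\<close>
    proof (induction n rule: dec_induct)
      case (step n)
      have "\<bar>H (Suc n) x - H k x\<bar> \<le> \<bar>d n x\<bar> + \<bar>H n x - H k x\<bar>" by (simp add: d_def)
      also have "\<dots> \<le> (1 / 2) ^ n + (2 * (1 / 2) ^ k - 2 * (1 / 2) ^ n)"
        using le[of n] step that(2) by (intro add_mono) auto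
      finally show ?case by simp
    qed simp
    also have "\<dots> \<le> 2 / 2 ^ k" by (simp add: power_one_over)
    finally show ?thesis .
  qed
  have half: "\<exists>k\<ge>m. 2 / 2 ^ k < e" if "0 < e" for e :: real and m
  proof -
    obtain k0 where "\<forall>k\<ge>k0. 2 * (1 / 2) ^ k < e"
      using geometric_eventually_less[of "1 / 2" e 2] \<open>0 < e\<close> by auto
    then have "2 * (1 / 2) ^ (max m k0) < e" by simp
    then show ?thesis by (intro exI[of _ "max m k0"]) (simp add: power_one_over)
  qed
  have conv: "(\<lambda>k. H k x) \<longlonglongrightarrow> g x" if x: "x \<in> K - G m" for x m
  proof -
    have "Cauchy (\<lambda>k. H k x)"
    proof (rule CauchyI')
      fix e :: real assume "0 < e"
      then obtain k where k: "m \<le> k" "2 / 2 ^ k < e" using half by blast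
      have "\<bar>H n x - H j x\<bar> < e" if "k \<le> j" "j < n" for j n
      proof -
        have "\<bar>H n x - H j x\<bar> \<le> 2 / 2 ^ j" using dist_le[OF x, of j n] that k by simp
        also have "\<dots> \<le> 2 / 2 ^ k" using that by (intro divide_left_mono power_increasing) auto
        finally show ?thesis using k by simp
      qed
      then show "\<exists>M. \<forall>m\<ge>M. \<forall>n>m. dist (H m x) (H n x) < e"
        by (intro exI[of _ k]) (auto simp: dist_real_def abs_minus_commute)
    qed
    then show ?thesis
      unfolding g_def using Cauchy_convergent convergent_LIMSEQ_iff by blast
  qed
  have close: "\<bar>H k x - g x\<bar> \<le> 2 / 2 ^ k" if x: "x \<in> K - G m" and "m \<le> k" for x m k
  proof -
    have "(\<lambda>n. \<bar>H n x - H k x\<bar>) \<longlonglongrightarrow> \<bar>g x - H k x\<bar>"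
      using conv[OF x] by (intro tendsto_intros)
    then have "\<bar>g x - H k x\<bar> \<le> 2 / 2 ^ k"
      by (rule tendsto_upperbound)
        (use dist_le[OF x \<open>m \<le> k\<close>] in \<open>auto simp: eventually_sequentially intro!: exI[of _ k]\<close>)
    then show ?thesis by (simp add: abs_minus_commute)
  qed
  have cont: "continuous_on (K - G m) g" for m
  proof (rule uniform_limit_theorem)
    show "\<forall>\<^sub>F k in sequentially. continuous_on (K - G m) (H k)"
      using H(2) by (intro always_eventually allI continuous_on_subset[OF H(2)]) auto
    show "uniform_limit (K - G m) H g sequentially"
    proof (rule uniform_limitI)
      fix e :: real assume "0 < e"
      then obtain k where k: "m \<le> k" "2 / 2 ^ k < e" using half by blast
      have "dist (H n x) (g x) < e" if "k \<le> n" "x \<in> K - G m" for n x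
      proof -
        have "\<bar>H n x - g x\<bar> \<le> 2 / 2 ^ n" using close[OF that(2), of n] that k by simp
        also have "\<dots> \<le> 2 / 2 ^ k" using that by (intro divide_left_mono power_increasing) auto
        finally show ?thesis using k by (simp add: dist_real_def)
      qed
      then show "\<forall>\<^sub>F n in sequentially. \<forall>x\<in>K - G m. dist (H n x) (g x) < e"
        by (intro eventually_sequentiallyI[of k]) auto
    qed
  qed simp
  \<comment> \<open>The intersection of all \<open>G m\<close> is null because capacity dominates M.
    Off it g is the pointwise limit, which must be the almost everywhere limit h of a
    subsequence.\<close>
  have "AE x in M. g x = h x"
  proof -
    have "emeasure M (\<Inter>m. G m) \<le> e" if e: "0 < e" for e
    proof -
      obtain m where m: "open_capacity M D \<E> (G m) < e" using small[OF e] by blast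
      have "emeasure M (\<Inter>m. G m) \<le> emeasure M (G m)"
        by (intro emeasure_mono openin_sets G_open) auto
      also have "\<dots> \<le> open_capacity M D \<E> (G m)"
        by (intro measure_le_open_capacity openin_sets G_open)
      finally show ?thesis using m by simp
    qed
    then have "emeasure M (\<Inter>m. G m) = 0"
      by (metis dense_ge le_zero_eq)
    then have "AE x in M. x \<notin> (\<Inter>m. G m)"
      using openin_sets[OF G_open] by (intro AE_I[of _ _ "\<Inter>m. G m"]) auto
    moreover obtain r :: "nat \<Rightarrow> nat" where r: "strict_mono r" and ae: "AE x in M. (\<lambda>n. H (r n) x) \<longlonglongrightarrow> h x"
      using L2_tendsto_AE_subseq[OF D_L2[OF H(1)] D_L2[OF h] nrm_tendsto_L2[OF H(1) h lim]] by blast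
    note ae
    moreover have "AE x in M. x \<in> K" using spaceM by auto
    ultimately show ?thesis
    proof eventually_elim
      case (elim x)
      then obtain m where "x \<in> K - G m" by blast
      from LIMSEQ_subseq_LIMSEQ[OF conv[OF this] r] elim(2) show ?case
        using LIMSEQ_unique by (auto simp: o_def)
    qed
  qed
  moreover have "\<exists>V. openin (top_of_set K) V \<and> capacity M K D \<E> V < e \<and> continuous_on (K - V) g"
    if "0 < e" for e
    using small[OF that] G_open cont capacity_open by metis
  ultimately have "quasi_cont_modification M K D \<E> h g"
    unfolding quasi_cont_modification_def by blast
  then show ?thesis
    using G_open G_cap conv by blast
qed

text \<open>Errors at most 1 / (4 64^k) along a subsequence meet the rate required above: by
  \<open>nrm_diff_le\<close> consecutive terms differ by at most twice the sum of two such
  errors.\<close>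

lemma quasi_continuous_modification_exists:
  assumes h: "h \<in> D" and H: "\<And>k. H k \<in> D" "\<And>k. continuous_on K (H k)"
    and lim: "(\<lambda>k. nrm (\<lambda>x. H k x - h x)) \<longlonglongrightarrow> 0"
  shows "\<exists>g G r. strict_mono (r :: nat \<Rightarrow> nat) \<and> quasi_cont_modification M K D \<E> h g \<and>
    (\<forall>m. openin (top_of_set K) (G m) \<and> open_capacity M D \<E> (G m) \<le> ennreal (64 / 16 ^ m) \<and>
      (\<forall>x\<in>K - G m. (\<lambda>k. H (r k) x) \<longlonglongrightarrow> g x))"
proof -
  have "\<exists>n0. \<forall>n\<ge>n0. nrm (\<lambda>x. H n x - h x) < 1 / (4 * 64 ^ k)" for k :: nat
    using order_tendstoD(2)[OF lim, of "1 / (4 * 64 ^ k)"] by (simp add: eventually_sequentially)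
  then obtain n0 where n0: "\<And>k n. n \<ge> n0 k \<Longrightarrow> nrm (\<lambda>x. H n x - h x) < 1 / (4 * 64 ^ k)"
    by metis
  \<comment> \<open>\<open>Suc rk\<close> forces strict growth and \<open>n0 (Suc k)\<close> the
    error bound.\<close>
  define r where "r = rec_nat (n0 0) (\<lambda>k rk. max (Suc rk) (n0 (Suc k)))"
  have "r k < r (Suc k)" for k by (simp add: r_def)
  then have r: "strict_mono r" by (rule strict_monoI_Suc)
  have "n0 k \<le> r k" for k by (cases k) (auto simp: r_def)
  then have small: "nrm (\<lambda>x. H (r k) x - h x) \<le> 1 / (4 * 64 ^ k)" for k
    using n0 less_imp_le by blast
  have "nrm (\<lambda>x. H (r (Suc k)) x - H (r k) x) \<le> 1 / 64 ^ k" for k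
  proof -
    have "nrm (\<lambda>x. (H (r (Suc k)) x - h x) - (H (r k) x - h x))
        \<le> 2 * nrm (\<lambda>x. H (r (Suc k)) x - h x) + 2 * nrm (\<lambda>x. H (r k) x - h x)"
      by (intro nrm_diff_le D_diff H h)
    also have "\<dots> \<le> 2 * (1 / (4 * 64 ^ Suc k)) + 2 * (1 / (4 * 64 ^ k))"
      using small[of k] small[of "Suc k"] by (intro add_mono mult_left_mono) auto
    also have "\<dots> \<le> 1 / 64 ^ k" by (simp add: field_simps)
    finally show ?thesis by simp
  qed
  moreover have "(\<lambda>k. nrm (\<lambda>x. H (r k) x - h x)) \<longlonglongrightarrow> 0"
    using LIMSEQ_subseq_LIMSEQ[OF lim r] by (simp add: o_def)
  ultimately show ?thesis
    using rapid_limit_quasi_continuous[OF h, of "\<lambda>k. H (r k)"] H r by meson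
qed

text \<open>Enlarging \<open>G\<close> by the relatively open set \<open>{g \<noteq> g'} - G\<close>, which is \<open>M\<close>-null, does not
  change its capacity; so no topological support condition on \<open>M\<close> is needed.\<close>

lemma quasi_continuous_modification_unique:
  assumes g: "quasi_cont_modification M K D \<E> h g" and g': "quasi_cont_modification M K D \<E> h g'"
    and e: "0 < e"
  shows "\<exists>V. openin (top_of_set K) V \<and> open_capacity M D \<E> V \<le> ennreal (4 * e) \<and> (\<forall>x\<in>K - V. g x = g' x)"
proof -
  obtain G where G: "openin (top_of_set K) G" "capacity M K D \<E> G < ennreal e" "continuous_on (K - G) g"
    using g e unfolding quasi_cont_modification_def by (meson ennreal_less_zero_iff)
  obtain G' where G': "openin (top_of_set K) G'" "capacity M K D \<E> G' < ennreal e" "continuous_on (K - G') g'"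
    using g' e unfolding quasi_cont_modification_def by (meson ennreal_less_zero_iff)
  define U where "U = G \<union> G'"
  have U: "openin (top_of_set K) U" unfolding U_def using G G' by blast
  have "continuous_on (K - U) (\<lambda>x. g x - g' x)"
    unfolding U_def by (intro continuous_intros continuous_on_subset[OF G(3)] continuous_on_subset[OF G'(3)]) auto
  then have "openin (top_of_set (K - U)) ((K - U) \<inter> (\<lambda>x. g x - g' x) -` (- {0}))"
    by (intro continuous_openin_preimage_gen) auto
  then obtain T where T: "open T" "(K - U) \<inter> (\<lambda>x. g x - g' x) -` (- {0}) = (K - U) \<inter> T"
    by (auto simp: openin_open)
  \<comment> \<open>The set of points of K - U where g and g' differ is open in K - U only; together
    with U it becomes open in K.\<close>
  define V where "V = U \<union> (K \<inter> T)"
  have V: "openin (top_of_set K) V"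
    unfolding V_def using U T by (auto intro: openin_open_Int)
  have "AE x in M. x \<in> V \<longrightarrow> x \<in> U"
  proof -
    have "AE x in M. g x = h x" "AE x in M. g' x = h x" "AE x in M. x \<in> K"
      using g g' spaceM by (auto simp: quasi_cont_modification_def)
    then show ?thesis
    proof eventually_elim
      case (elim x)
      show ?case
      proof (intro impI, rule ccontr)
        assume "x \<in> V" "x \<notin> U"
        then have "x \<in> (K - U) \<inter> T" by (auto simp: V_def)
        then have "x \<in> (K - U) \<inter> (\<lambda>x. g x - g' x) -` (- {0})" by (simp only: T(2))
        then show False using elim by simp
      qed
    qed
  qed
  then have "open_capacity M D \<E> V \<le> open_capacity M D \<E> U"
    unfolding open_capacity_def by (intro INF_superset_mono) (auto elim: eventually_elim2)
  also have "\<dots> \<le> ennreal (4 * e)"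
    unfolding U_def using G G' capacity_open by (intro open_capacity_Un_le) auto
  finally have "open_capacity M D \<E> V \<le> ennreal (4 * e)" .
  moreover have "g x = g' x" if "x \<in> K - V" for x
  proof (rule ccontr)
    assume "g x \<noteq> g' x"
    then have "x \<in> (K - U) \<inter> (\<lambda>x. g x - g' x) -` (- {0})"
      using that by (auto simp: V_def)
    then have "x \<in> (K - U) \<inter> T" by (simp only: T(2))
    then show False using that by (auto simp: V_def)
  qed
  ultimately show ?thesis using V by blast
qed

section \<open>Capacity and a measure on a smaller set\<close>

text \<open>The assumption concerns compact sets; inner regularity of finite Borel measures on a
  Polish space carries it over to relatively open ones.\<close>

lemma measure_le_capacity_openin:
  assumes N: "finite_measure N" "sets N = sets (restrict_space borel L)" "L \<subseteq> K" "closed L"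
    and cap: "\<And>A. compact A \<Longrightarrow> A \<subseteq> K \<Longrightarrow> emeasure N (A \<inter> L) \<le> ennreal C * capacity M K D \<E> A"
    and U: "openin (top_of_set K) U"
  shows "emeasure N (U \<inter> L) \<le> ennreal C * open_capacity M D \<E> U"
proof -
  interpret N: finite_measure N by fact
  have space_N: "space N = L"
    using sets_eq_imp_space_eq[OF N(2)] by (simp add: space_restrict_space)
  have "(\<lambda>x. x) \<in> measurable (restrict_space borel L) borel"
    by (intro measurable_restrict_space1) simp
  then have id_meas: "(\<lambda>x. x) \<in> measurable N borel"
    unfolding measurable_cong_sets[OF N(2) refl] .
  \<comment> \<open>Inner regularity speaks of Borel measures on the whole space, so N is pushed
    forward along the inclusion.\<close>
  let ?N = "distr N borel (\<lambda>x. x)"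
  have emN: "emeasure ?N A = emeasure N (A \<inter> L)" if "A \<in> sets borel" for A
    using emeasure_distr[OF id_meas that] by (simp add: space_N)
  have "closed K" using compactK by (rule compact_imp_closed)
  then have UB: "U \<in> sets borel"
    using U by (auto simp: openin_open simp del: borel_closed intro: sets.Int[OF borel_closed borel_open])
  have "U \<subseteq> K" using U by (auto simp: openin_open)
  have "emeasure N (U \<inter> L) = (SUP A\<in>{A. A \<subseteq> U \<and> compact A}. emeasure ?N A)"
    unfolding emN[OF UB, symmetric]
    by (rule inner_regular) (auto simp: UB emeasure_distr[OF id_meas] N.emeasure_eq_measure)
  also have "\<dots> \<le> ennreal C * open_capacity M D \<E> U"
  proof (rule SUP_least)
    fix A assume A: "A \<in> {A. A \<subseteq> U \<and> compact A}"
    then have "emeasure ?N A = emeasure N (A \<inter> L)"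
      by (intro emN borel_closed compact_imp_closed) auto
    also have "\<dots> \<le> ennreal C * capacity M K D \<E> A"
      using A \<open>U \<subseteq> K\<close> by (intro cap) auto
    also have "\<dots> \<le> ennreal C * open_capacity M D \<E> U"
      using A by (intro mult_left_mono capacity_mono_open U) auto
    finally show "emeasure ?N A \<le> ennreal C * open_capacity M D \<E> U" .
  qed
  finally show ?thesis .
qed

text \<open>A subsequence of \<open>H k\<close> converges to a quasi-continuous g off sets of small
  capacity, which are small for N, hence N-almost everywhere. The same sequence tends to f in
  \<open>L\<^sup>2\<close> of N, so g and f agree N-almost everywhere. Any other modification
  differs from g only inside sets of small capacity.\<close>

lemma quasi_continuous_trace:
  assumes N: "finite_measure N" "sets N = sets (restrict_space borel L)" "L \<subseteq> K" "closed L"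
    and C: "0 \<le> C"
    and cap: "\<And>A. compact A \<Longrightarrow> A \<subseteq> K \<Longrightarrow> emeasure N (A \<inter> L) \<le> ennreal C * capacity M K D \<E> A"
    and h: "h \<in> D" and H: "\<And>k. H k \<in> D" "\<And>k. continuous_on K (H k)"
    and lim: "(\<lambda>k. nrm (\<lambda>x. H k x - h x)) \<longlonglongrightarrow> 0"
    and f: "f \<in> L2_space N" "\<And>k. H k \<in> L2_space N" "(\<lambda>k. \<integral>x. (H k x - f x)\<^sup>2 \<partial>N) \<longlonglongrightarrow> 0"
  shows "\<exists>g. quasi_cont_modification M K D \<E> h g"
    and "quasi_cont_modification M K D \<E> h g' \<Longrightarrow> AE x in N. g' x = f x"
proof -
  interpret N: finite_measure N by fact
  have space_N: "space N = L"
    using sets_eq_imp_space_eq[OF N(2)] by (simp add: space_restrict_space)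
  \<comment> \<open>The exceptional sets have arbitrarily small capacity, so their intersection is
    N-null.\<close>
  have null: "AE x in N. \<exists>e\<in>E. x \<notin> V e"
    if V: "\<And>e. e \<in> E \<Longrightarrow> openin (top_of_set K) (V e)"
      and small: "\<And>\<epsilon>. 0 < \<epsilon> \<Longrightarrow> \<exists>e\<in>E. open_capacity M D \<E> (V e) \<le> ennreal \<epsilon>" for V and E :: "nat set"
  proof -
    have VL: "V e \<inter> L \<in> sets N" if e: "e \<in> E" for e
    proof -
      obtain T where "open T" "V e = K \<inter> T" using V[OF e] by (auto simp: openin_open)
      then have "V e \<inter> L = L \<inter> T" using N(3) by blast
      then show ?thesis using \<open>open T\<close> by (auto simp: N(2) sets_restrict_space)
    qed
    have ne: "E \<noteq> {}" using small[of 1] by auto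
    let ?Z = "\<Inter>e\<in>E. V e \<inter> L"
    have Z: "?Z \<in> sets N" using VL ne by (intro sets.countable_INT') auto
    have "emeasure N ?Z \<le> 0 + ennreal \<delta>" if "0 < \<delta>" for \<delta>
    proof -
      \<comment> \<open>C + 1 instead of C, which may be 0.\<close>
      have "0 < \<delta> / (C + 1)" using C that by simp
      then obtain e where e: "e \<in> E" "open_capacity M D \<E> (V e) \<le> ennreal (\<delta> / (C + 1))"
        using small by blast
      have "emeasure N ?Z \<le> emeasure N (V e \<inter> L)"
        using e VL by (intro emeasure_mono) auto
      also have "\<dots> \<le> ennreal C * open_capacity M D \<E> (V e)"
        by (rule measure_le_capacity_openin[OF N cap V[OF e(1)]])
      also have "\<dots> \<le> ennreal C * ennreal (\<delta> / (C + 1))"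
        by (intro mult_left_mono e) auto
      also have "\<dots> = ennreal (C * (\<delta> / (C + 1)))"
        using C \<open>0 < \<delta>\<close> by (intro ennreal_mult[symmetric]) auto
      also have "\<dots> \<le> ennreal \<delta>"
        using C that by (intro ennreal_leI) (simp add: field_simps)
      finally show ?thesis by simp
    qed
    then have "emeasure N ?Z \<le> 0"
      by (rule ennreal_le_epsilon)
    then have "AE x in N. x \<notin> ?Z"
      using Z by (intro AE_I[of _ _ ?Z]) auto
    moreover have "AE x in N. x \<in> L" using space_N by auto
    ultimately show ?thesis
    proof eventually_elim
      case (elim x)
      then show ?case using ne by blast
    qed
  qed
  have small: "\<exists>m::nat. a / 16 ^ m \<le> \<epsilon>" if "0 < \<epsilon>" for a \<epsilon> :: real
  proof -
    obtain m where "a * (1 / 16) ^ m < \<epsilon>"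
      using geometric_eventually_less[of "1 / 16" \<epsilon> a] \<open>0 < \<epsilon>\<close> by auto
    then show ?thesis by (intro exI[of _ m]) (simp add: power_one_over)
  qed
  obtain g G r where r: "strict_mono (r :: nat \<Rightarrow> nat)" and g: "quasi_cont_modification M K D \<E> h g"
    and G: "\<And>m::nat. openin (top_of_set K) (G m)" "\<And>m. open_capacity M D \<E> (G m) \<le> ennreal (64 / 16 ^ m)"
    and conv: "\<And>m x. x \<in> K - G m \<Longrightarrow> (\<lambda>k. H (r k) x) \<longlonglongrightarrow> g x"
    using quasi_continuous_modification_exists[OF h H lim] by blast
  show "\<exists>g. quasi_cont_modification M K D \<E> h g" using g by blast
  assume g': "quasi_cont_modification M K D \<E> h g'"
  have "\<exists>V. \<forall>m. openin (top_of_set K) (V m) \<and> open_capacity M D \<E> (V m) \<le> ennreal (4 * (1 / 16 ^ m))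
      \<and> (\<forall>x\<in>K - V m. g' x = g x)"
    using quasi_continuous_modification_unique[OF g' g, of "1 / 16 ^ m" for m] by (intro choice allI) auto
  then obtain V where V: "\<And>m::nat. openin (top_of_set K) (V m)"
      "\<And>m. open_capacity M D \<E> (V m) \<le> ennreal (4 * (1 / 16 ^ m))" "\<And>m x. x \<in> K - V m \<Longrightarrow> g' x = g x"
    by blast
  have "AE x in N. \<exists>m\<in>UNIV. x \<notin> G m"
  proof (rule null)
    fix \<epsilon> :: real assume "0 < \<epsilon>"
    then obtain m where "64 / 16 ^ m \<le> \<epsilon>" using small by blast
    then show "\<exists>m\<in>UNIV. open_capacity M D \<E> (G m) \<le> ennreal \<epsilon>"
      using G(2)[of m] by (meson UNIV_I ennreal_leI order_trans)
  qed (use G in auto)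
  moreover have "AE x in N. \<exists>m\<in>UNIV. x \<notin> V m"
  proof (rule null)
    fix \<epsilon> :: real assume "0 < \<epsilon>"
    then obtain m where "4 / 16 ^ m \<le> \<epsilon>" using small by blast
    then show "\<exists>m\<in>UNIV. open_capacity M D \<E> (V m) \<le> ennreal \<epsilon>"
      using V(2)[of m] by (metis UNIV_I ennreal_leI order_trans times_divide_eq_right mult.right_neutral)
  qed (use V in auto)
  moreover have "(\<lambda>k. \<integral>x. (H (r k) x - f x)\<^sup>2 \<partial>N) \<longlonglongrightarrow> 0"
    using LIMSEQ_subseq_LIMSEQ[OF f(3) r] by (simp add: o_def)
  then obtain s :: "nat \<Rightarrow> nat" where s: "strict_mono s" and ae: "AE x in N. (\<lambda>k. H (r (s k)) x) \<longlonglongrightarrow> f x"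
    using L2_tendsto_AE_subseq[of "\<lambda>k. H (r k)" N f] f by blast
  note ae
  moreover have "AE x in N. x \<in> L" using space_N by auto
  ultimately show "AE x in N. g' x = f x"
  proof eventually_elim
    case (elim x)
    then obtain m m' where m: "x \<in> K - G m" "x \<in> K - V m'" using N(3) by blast
    have "(\<lambda>k. H (r (s k)) x) \<longlonglongrightarrow> g x"
      using LIMSEQ_subseq_LIMSEQ[OF conv[OF m(1)] s] by (simp add: o_def)
    then have "g x = f x" using elim(3) LIMSEQ_unique by blast
    then show ?case using V(3)[OF m(2)] by simp
  qed
qed

end

section \<open>Codings and Bernoulli measures of self-similar sets\<close>

lemma words_0 [simp]: "words A 0 = {[]}"
  by (auto simp: words_def)

lemma words_Suc: "words A (Suc n) = (\<lambda>(i, w). i # w) ` (A \<times> words A n)"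
  by (force simp: words_def length_Suc_conv image_iff)

lemma finite_words: "finite A \<Longrightarrow> finite (words A n)"
  unfolding words_def by (rule finite_lists_length_eq)

lemma sum_words_Suc:
  "(\<Sum>w\<in>words A (Suc n). g w) = (\<Sum>i\<in>A. \<Sum>w\<in>words A n. g (i # w))"
proof -
  have "inj_on (\<lambda>(i, w). i # w) (A \<times> words A n)" by (auto simp: inj_on_def)
  then show ?thesis
    unfolding words_Suc by (simp add: sum.reindex o_def case_prod_unfold sum.cartesian_product)
qed

lemma take_words: "w \<in> words A n \<Longrightarrow> k \<le> n \<Longrightarrow> take k w \<in> words A k"
  using set_take_subset[of k w] by (auto simp: words_def)

lemma drop_words: "w \<in> words A n \<Longrightarrow> drop k w \<in> words A (n - k)"
  using set_drop_subset[of k w] by (auto simp: words_def)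

lemma words_mono: "A \<subseteq> B \<Longrightarrow> words A n \<subseteq> words B n"
  by (auto simp: words_def)

lemma word_map_Nil [simp]: "word_map F [] x = x"
  by (simp add: word_map_def)

lemma word_map_Cons [simp]: "word_map F (i # w) x = F i (word_map F w x)"
  by (simp add: word_map_def)

lemma word_map_append [simp]: "word_map F (v @ w) x = word_map F v (word_map F w x)"
  by (induction v) auto

lemma word_map_mem:
  assumes "\<And>i. i \<in> set w \<Longrightarrow> F i ` P \<subseteq> P" "x \<in> P"
  shows "word_map F w x \<in> P"
  using assms by (induction w) auto

section \<open>Cells and the coding map\<close>

locale similitudes =
  fixes F :: "'i \<Rightarrow> 'x::polish_space \<Rightarrow> 'x" and W :: "'i set" and \<alpha> :: real and K :: "'x set"
  assumes alpha: "1 < \<alpha>"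
    and similitude: "\<And>i x y. i \<in> W \<Longrightarrow> dist (F i x) (F i y) = inverse \<alpha> * dist x y"
    and compact_K: "compact K" and K_ne: "K \<noteq> {}"
    and F_K: "\<And>i. i \<in> W \<Longrightarrow> F i ` K \<subseteq> K"
begin

definition diam :: real where "diam = diameter K"

lemma dist_le_diam: "x \<in> K \<Longrightarrow> y \<in> K \<Longrightarrow> dist x y \<le> diam"
  unfolding diam_def using compact_K by (intro diameter_bounded_bound compact_imp_bounded)

lemma diam_nonneg: "0 \<le> diam"
  unfolding diam_def using compact_K by (intro diameter_ge_0 compact_imp_bounded)

lemma inverse_alpha: "0 < inverse \<alpha>" "inverse \<alpha> < 1"
  using alpha by (auto simp: field_simps)

lemma dist_word_map:
  "set w \<subseteq> W \<Longrightarrow> dist (word_map F w x) (word_map F w y) = inverse \<alpha> ^ length w * dist x y"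
  by (induction w) (auto simp: similitude)

lemma word_map_K: "set w \<subseteq> W \<Longrightarrow> x \<in> K \<Longrightarrow> word_map F w x \<in> K"
  using F_K by (intro word_map_mem) auto

lemma cell_subset: "set w \<subseteq> W \<Longrightarrow> cell F K w \<subseteq> K"
  unfolding cell_def using word_map_K by auto

lemma cell_append_subset: "set w \<subseteq> W \<Longrightarrow> cell F K (v @ w) \<subseteq> cell F K v"
  unfolding cell_def using word_map_K by auto

lemma cell_take_subset: "set w \<subseteq> W \<Longrightarrow> cell F K w \<subseteq> cell F K (take k w)"
  using cell_append_subset[of "drop k w" "take k w"] set_drop_subset[of k w] by auto

lemma cell_ne: "cell F K w \<noteq> {}"
  using K_ne by (simp add: cell_def)

lemma dist_cell_le:
  assumes "set w \<subseteq> W" "x \<in> cell F K w" "y \<in> cell F K w"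
  shows "dist x y \<le> inverse \<alpha> ^ length w * diam"
proof -
  obtain a b where "a \<in> K" "b \<in> K" "x = word_map F w a" "y = word_map F w b"
    using assms by (auto simp: cell_def)
  then show ?thesis
    using dist_word_map[OF assms(1)] dist_le_diam[of a b] inverse_alpha
    by (simp add: mult_left_mono)
qed

lemma continuous_word_map: "set w \<subseteq> W \<Longrightarrow> continuous_on A (word_map F w)"
proof (intro continuous_onI)
  fix x and e :: real assume w: "set w \<subseteq> W" and e: "0 < e"
  have le: "dist (word_map F w y) (word_map F w x) \<le> dist y x" for y
    using dist_word_map[OF w] power_le_one[of "inverse \<alpha>" "length w"] inverse_alpha
    by (simp add: mult_left_le_one_le)
  show "\<exists>d>0. \<forall>y\<in>A. dist y x < d \<longrightarrow> dist (word_map F w y) (word_map F w x) \<le> e"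
    using e order_trans[OF le] by (intro exI[of _ e]) auto
qed

lemma compact_cell: "set w \<subseteq> W \<Longrightarrow> compact (cell F K w)"
  unfolding cell_def by (intro compact_continuous_image continuous_word_map compact_K)

lemma alpha_power_tendsto: "(\<lambda>n. inverse \<alpha> ^ n * c) \<longlonglongrightarrow> 0"
  using inverse_alpha by (intro tendsto_mult_left_zero LIMSEQ_realpow_zero) auto

lemma prefix_subset: "(\<And>k. \<omega> k \<in> J) \<Longrightarrow> map \<omega> [0..<m] \<in> words J m"
  by (auto simp: words_def)

lemma cell_prefix_eq:
  assumes "\<And>k. \<omega> k \<in> W" "\<And>m. x \<in> cell F K (map \<omega> [0..<m])" "\<And>m. y \<in> cell F K (map \<omega> [0..<m])"
  shows "x = y"
proof -
  have "dist x y \<le> inverse \<alpha> ^ m * diam" for m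
    using dist_cell_le[of "map \<omega> [0..<m]" x y] assms by auto
  then have "dist x y \<le> 0"
    using alpha_power_tendsto[of diam] by (intro tendsto_lowerbound[OF _ always_eventually]) auto
  then show ?thesis by simp
qed

text \<open>\<open>coding\<close> is defined by \<open>the_elem\<close>, so the cells of the
  prefixes must first be shown to meet in a single point: they are nested, closed, and of diameter
  tending to 0 in a complete space.\<close>

lemma coding_in_cell:
  assumes "\<And>k. \<omega> k \<in> W"
  shows "coding F K \<omega> \<in> cell F K (map \<omega> [0..<m])"
proof -
  let ?C = "\<lambda>m. cell F K (map \<omega> [0..<m])"
  have W: "set (map \<omega> [0..<m]) \<subseteq> W" for m using assms by auto
  have "\<exists>x. (\<Inter>m. ?C m) = {x}"
  proof (rule decreasing_closed_nest_sing)
    show "closed (?C m)" "?C m \<noteq> {}" for m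
      using compact_imp_closed[OF compact_cell[OF W]] cell_ne by auto
    show "?C n \<subseteq> ?C m" if "m \<le> n" for m n
    proof -
      have "map \<omega> [0..<m] = take m (map \<omega> [0..<n])" using that by (simp add: take_map)
      then show ?thesis using cell_take_subset[OF W[of n]] by simp
    qed
    fix e :: real assume "0 < e"
    then have "eventually (\<lambda>m. inverse \<alpha> ^ m * diam < e) sequentially"
      by (intro order_tendstoD(2)[OF alpha_power_tendsto])
    then obtain m where m: "inverse \<alpha> ^ m * diam < e" by (auto simp: eventually_sequentially)
    have "dist x y < e" if "x \<in> ?C m" "y \<in> ?C m" for x y
      using dist_cell_le[OF W that] m by simp
    then show "\<exists>m. \<forall>x\<in>?C m. \<forall>y\<in>?C m. dist x y < e" by blast
  qed
  then obtain x where x: "(\<Inter>m. ?C m) = {x}" by blast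
  then have "coding F K \<omega> = x" unfolding coding_def by simp
  then show ?thesis using x by blast
qed

lemma coding_unique:
  assumes "\<And>k. \<omega> k \<in> W" "\<And>m. x \<in> cell F K (map \<omega> [0..<m])"
  shows "coding F K \<omega> = x"
  by (rule cell_prefix_eq[OF assms(1) coding_in_cell[OF assms(1)] assms(2)])

lemma coding_case_nat:
  assumes "i \<in> W" "\<And>k. \<omega> k \<in> W"
  shows "coding F K (case_nat i \<omega>) = F i (coding F K \<omega>)"
proof (rule coding_unique)
  show "case_nat i \<omega> k \<in> W" for k using assms by (cases k) auto
  show "F i (coding F K \<omega>) \<in> cell F K (map (case_nat i \<omega>) [0..<m])" for m
  proof (cases m)
    case 0
    have "coding F K \<omega> \<in> cell F K (map \<omega> [0..<0])" using assms(2) by (rule coding_in_cell)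
    then show ?thesis using 0 F_K[OF assms(1)] by (auto simp: cell_def)
  next
    case (Suc n)
    have "map (case_nat i \<omega>) [0..<m] = i # map \<omega> [0..<n]"
      unfolding Suc by (simp add: map_upt_Suc del: upt_Suc)
    moreover have "coding F K \<omega> \<in> cell F K (map \<omega> [0..<n])" using assms(2) by (rule coding_in_cell)
    ultimately show ?thesis by (auto simp: cell_def)
  qed
qed

text \<open>\<open>comb_seq n \<omega> \<eta>\<close> continues the first n letters of \<omega> with
  \<eta>. Hence a tail may be replaced by another coding of the same point without moving the coded
  point.\<close>

lemma coding_comb_seq:
  assumes "\<And>k. \<omega> k \<in> W" "\<And>k. \<eta> k \<in> W"
  shows "coding F K (comb_seq n \<omega> \<eta>) = word_map F (map \<omega> [0..<n]) (coding F K \<eta>)"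
  using assms
proof (induction n arbitrary: \<eta>)
  case 0
  then show ?case by (simp add: comb_seq_0)
next
  case (Suc n)
  \<comment> \<open>\<open>comb_seq_Suc\<close> moves the letter \<omega> n to the front of \<eta>,
    which is why the induction runs over all \<eta>.\<close>
  have "coding F K (comb_seq (Suc n) \<omega> \<eta>) = word_map F (map \<omega> [0..<n]) (coding F K (case_nat (\<omega> n) \<eta>))"
    unfolding comb_seq_Suc using Suc.prems by (intro Suc.IH) (auto split: nat.split)
  then show ?case using Suc.prems by (simp add: coding_case_nat)
qed

end

section \<open>Attractors with their Bernoulli measures, for both (S, K) and (I, L)\<close>

locale attractor = similitudes F W \<alpha> K
  for F :: "'i \<Rightarrow> 'x::polish_space \<Rightarrow> 'x" and W :: "'i set" and \<alpha> :: real and K :: "'x set" +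
  fixes J :: "'i set" and P :: "'x set"
  assumes J_sub: "J \<subseteq> W" and finite_J: "finite J"
    and compact_P: "compact P" and P_ne: "P \<noteq> {}" and P_eq: "P = (\<Union>i\<in>J. F i ` P)" and P_K: "P \<subseteq> K"
begin

abbreviation N :: real where "N \<equiv> real (card J)"

definition seqs :: "(nat \<Rightarrow> 'i) measure" where
  "seqs = Pi\<^sub>M UNIV (\<lambda>_. uniform_count_measure J)"

definition meas :: "'x measure" where
  "meas = bernoulli_image F K J P"

lemma J_ne: "J \<noteq> {}" using P_ne P_eq by auto

lemma N_pos: "0 < N" using J_ne finite_J by (simp add: card_gt_0_iff)

lemma words_W: "w \<in> words J n \<Longrightarrow> set w \<subseteq> W"
  using J_sub by (auto simp: words_def)

lemma F_P: "i \<in> J \<Longrightarrow> F i ` P \<subseteq> P" using P_eq by blast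

lemma word_map_P: "w \<in> words J n \<Longrightarrow> x \<in> P \<Longrightarrow> word_map F w x \<in> P"
  using F_P by (intro word_map_mem) (auto simp: words_def)

lemma P_cells: "P = (\<Union>w\<in>words J n. word_map F w ` P)"
proof (induction n)
  case (Suc n)
  have "P = (\<Union>i\<in>J. F i ` P)" by (rule P_eq)
  also have "\<dots> = (\<Union>i\<in>J. F i ` (\<Union>w\<in>words J n. word_map F w ` P))" using Suc by simp
  also have "\<dots> = (\<Union>i\<in>J. \<Union>w\<in>words J n. word_map F (i # w) ` P)"
    by (simp add: image_UN image_image)
  also have "\<dots> = (\<Union>w\<in>words J (Suc n). word_map F w ` P)"
    unfolding words_Suc by fastforce
  finally show ?case .
qed auto

lemma prob_uniform: "prob_space (uniform_count_measure J)"
  using finite_J J_ne by (rule prob_space_uniform_count_measure)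

sublocale U: prob_space "uniform_count_measure J" by (rule prob_uniform)
sublocale sequence_space "uniform_count_measure J" by unfold_locales

lemma prob_seqs: "prob_space seqs"
  unfolding seqs_def by (intro prob_space_PiM prob_uniform)

sublocale Q: prob_space seqs by (rule prob_seqs)

lemma space_seqs: "space seqs = {\<omega>. \<forall>k. \<omega> k \<in> J}"
  by (auto simp: seqs_def space_PiM space_uniform_count_measure PiE_iff)

lemma seqs_W: "\<omega> \<in> space seqs \<Longrightarrow> \<omega> k \<in> W"
  using J_sub by (auto simp: space_seqs)

text \<open>Both points lie in the cell of the prefix. The approximants depend on finitely many
  letters, which makes the coding measurable, and they stay in P if p is taken there, which puts its
  values into P.\<close>

lemma coding_limit:
  assumes \<omega>: "\<omega> \<in> space seqs" and p: "p \<in> K"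
  shows "(\<lambda>m. word_map F (map \<omega> [0..<m]) p) \<longlonglongrightarrow> coding F K \<omega>"
proof (rule tendsto_dist_iff[THEN iffD2], rule tendsto_sandwich[OF _ _ tendsto_const alpha_power_tendsto[of diam]])
  show "\<forall>\<^sub>F m in sequentially. dist (word_map F (map \<omega> [0..<m]) p) (coding F K \<omega>) \<le> inverse \<alpha> ^ m * diam"
  proof (intro always_eventually allI)
    fix m
    have "set (map \<omega> [0..<m]) \<subseteq> W" using seqs_W[OF \<omega>] by auto
    moreover have "word_map F (map \<omega> [0..<m]) p \<in> cell F K (map \<omega> [0..<m])"
      using p by (auto simp: cell_def)
    moreover have "coding F K \<omega> \<in> cell F K (map \<omega> [0..<m])"
      using seqs_W[OF \<omega>] by (rule coding_in_cell)
    ultimately show "dist (word_map F (map \<omega> [0..<m]) p) (coding F K \<omega>) \<le> inverse \<alpha> ^ m * diam"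
      using dist_cell_le by fastforce
  qed
qed simp

lemma coding_in_P:
  assumes "\<omega> \<in> space seqs"
  shows "coding F K \<omega> \<in> P"
proof -
  obtain p where p: "p \<in> P" using P_ne by blast
  have lim: "(\<lambda>m. word_map F (map \<omega> [0..<m]) p) \<longlonglongrightarrow> coding F K \<omega>"
    using p P_K by (intro coding_limit assms) auto
  have "\<omega> k \<in> J" for k using assms by (simp add: space_seqs)
  then have "word_map F (map \<omega> [0..<m]) p \<in> P" for m
    using prefix_subset word_map_P p by blast
  then show ?thesis
    using closed_sequentially[OF compact_imp_closed[OF compact_P] _ lim] by blast
qed

lemma coding_surj:
  assumes "x \<in> P"
  obtains \<omega> where "\<omega> \<in> space seqs" "coding F K \<omega> = x"
proof -
  have "\<forall>y. \<exists>i z. y \<in> P \<longrightarrow> i \<in> J \<and> z \<in> P \<and> y = F i z"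
    using P_eq by blast
  \<comment> \<open>\<open>t\<close> chooses an inverse branch and \<open>c\<close> its letter; the
    coding of x will be its itinerary under \<open>t\<close>.\<close>
  then obtain c t where ct: "\<And>y. y \<in> P \<Longrightarrow> c y \<in> J \<and> t y \<in> P \<and> y = F (c y) (t y)"
    by metis
  define y where "y n = (t ^^ n) x" for n
  define \<omega> where "\<omega> n = c (y n)" for n
  have y: "y n \<in> P" for n
    by (induction n) (use assms ct in \<open>auto simp: y_def\<close>)
  have \<omega>: "\<omega> n \<in> J" for n using ct[OF y] by (simp add: \<omega>_def)
  have eq: "x = word_map F (map \<omega> [0..<m]) (y m)" for m
  proof (induction m)
    case (Suc m)
    have "y m = F (\<omega> m) (y (Suc m))" using ct[OF y[of m]] by (simp add: \<omega>_def y_def)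
    then show ?case using Suc by simp
  qed (simp add: y_def)
  have "coding F K \<omega> = x"
  proof (rule coding_unique)
    show "\<omega> k \<in> W" for k using \<omega> J_sub by blast
    show "x \<in> cell F K (map \<omega> [0..<m])" for m
      using eq[of m] y[of m] P_K by (auto simp: cell_def)
  qed
  moreover have "\<omega> \<in> space seqs" using \<omega> by (simp add: space_seqs)
  ultimately show ?thesis using that by blast
qed

lemma measurable_coord [measurable]: "(\<lambda>\<omega>. \<omega> k) \<in> measurable seqs (count_space J)"
proof -
  have "(\<lambda>\<omega>. \<omega> k) \<in> measurable seqs (uniform_count_measure J)"
    unfolding seqs_def by measurable
  then show ?thesis
    by (simp add: measurable_cong_sets[OF refl sets_uniform_count_measure_count_space])
qed

lemma measurable_prefix: "(\<lambda>\<omega>. word_map F (map \<omega> [0..<m]) p) \<in> borel_measurable seqs"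
proof (induction m arbitrary: p)
  case (Suc m)
  \<comment> \<open>The last letter is absorbed into the base point, hence the arbitrary p. It has
    finitely many values, and for each the induction hypothesis applies.\<close>
  have "(\<lambda>\<omega>. word_map F (map \<omega> [0..<m]) (F (\<omega> m) p)) \<in> borel_measurable seqs"
    by (rule measurable_compose_countable'[where g = "\<lambda>\<omega>. \<omega> m" and I = J])
      (use Suc finite_J in \<open>auto intro: countable_finite\<close>)
  then show ?case by simp
qed simp

lemma coding_measurable: "coding F K \<in> measurable seqs (restrict_space borel P)"
proof (rule measurable_restrict_space2)
  show "coding F K \<in> space seqs \<rightarrow> P" using coding_in_P by auto
  obtain p where p: "p \<in> K" using P_ne P_K by blast
  show "coding F K \<in> borel_measurable seqs"
    by (rule borel_measurable_LIMSEQ_metric[OF measurable_prefix coding_limit[OF _ p]])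
qed

lemma meas_eq: "meas = distr seqs (restrict_space borel P) (coding F K)"
  by (simp add: meas_def bernoulli_image_def seqs_def)

lemma sets_meas: "sets meas = sets (restrict_space borel P)"
  by (simp add: meas_eq)

lemma space_meas: "space meas = P"
  by (simp add: meas_eq space_restrict_space)

lemma prob_meas: "prob_space meas"
  unfolding meas_eq by (intro Q.prob_space_distr coding_measurable)

sublocale m: prob_space meas by (rule prob_meas)

lemma F_measurable:
  assumes "i \<in> J"
  shows "F i \<in> measurable meas meas"
proof -
  have "word_map F [i] = F i" by (rule ext) simp
  then have "continuous_on P (F i)"
    using continuous_word_map[of "[i]" P] assms J_sub by auto
  then have "F i \<in> measurable (restrict_space borel P) (restrict_space borel P)"
    using F_P[OF assms]
    by (intro measurable_restrict_space2 borel_measurable_continuous_on_restrict)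
      (auto simp: space_restrict_space)
  then show ?thesis
    unfolding measurable_cong_sets[OF sets_meas sets_meas] .
qed

lemma word_map_measurable: "w \<in> words J n \<Longrightarrow> word_map F w \<in> measurable meas meas"
proof (induction n arbitrary: w)
  case (Suc n)
  then obtain i v where w: "w = i # v" "i \<in> J" "v \<in> words J n"
    by (auto simp: words_Suc)
  have "F i \<circ> word_map F v \<in> measurable meas meas"
    by (rule measurable_comp[OF Suc.IH[OF w(3)] F_measurable[OF w(2)]])
  moreover have "F i \<circ> word_map F v = word_map F w" unfolding w by (rule ext) simp
  ultimately show ?case by simp
qed (simp add: word_map_def id_def)

text \<open>A sequence is a uniform first letter followed by an independent sequence of the same law
  (\<open>PiM_iter\<close>), and prepending the letter i applies \<open>F i\<close> to the coded
  point. Nonnegative integrals avoid integrability conditions.\<close>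

lemma nn_integral_step:
  assumes f: "f \<in> borel_measurable meas"
  shows "(\<integral>\<^sup>+x. f x \<partial>meas) = ennreal (1 / N) * (\<Sum>i\<in>J. \<integral>\<^sup>+x. f (F i x) \<partial>meas)"
proof -
  note [measurable] = coding_measurable
  have f': "f \<in> borel_measurable (restrict_space borel P)"
    using f unfolding measurable_cong_sets[OF sets_meas refl] .
  have g [measurable]: "(\<lambda>\<omega>. f (coding F K \<omega>)) \<in> borel_measurable seqs"
    by (rule measurable_compose[OF coding_measurable f'])
  have m1: "(\<lambda>(s, \<omega>). case_nat s \<omega>) \<in> measurable (uniform_count_measure J \<Otimes>\<^sub>M seqs) seqs"
    unfolding seqs_def by measurable
  have "(\<integral>\<^sup>+x. f x \<partial>meas) = (\<integral>\<^sup>+\<omega>. f (coding F K \<omega>) \<partial>seqs)"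
    unfolding meas_eq by (intro nn_integral_distr coding_measurable) (simp add: f')
  also have "\<dots> = (\<integral>\<^sup>+\<omega>. f (coding F K \<omega>) \<partial>distr (uniform_count_measure J \<Otimes>\<^sub>M seqs) seqs (\<lambda>(s, \<omega>). case_nat s \<omega>))"
    using PiM_iter by (simp add: seqs_def)
  also have "\<dots> = (\<integral>\<^sup>+z. f (coding F K (case z of (s, \<omega>) \<Rightarrow> case_nat s \<omega>)) \<partial>(uniform_count_measure J \<Otimes>\<^sub>M seqs))"
    by (rule nn_integral_distr[OF m1]) (simp add: g)
  also have "\<dots> = (\<integral>\<^sup>+i. \<integral>\<^sup>+\<omega>. f (coding F K (case_nat i \<omega>)) \<partial>seqs \<partial>uniform_count_measure J)"
    using measurable_compose[OF m1 g] by (subst Q.nn_integral_fst[symmetric]) (auto simp: split_beta')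
  also have "\<dots> = (\<Sum>i\<in>J. (\<integral>\<^sup>+\<omega>. f (coding F K (case_nat i \<omega>)) \<partial>seqs) * ennreal (1 / N))"
    unfolding uniform_count_measure_def using finite_J by (subst nn_integral_point_measure_finite) (auto simp: mult.commute)
  also have "\<dots> = (\<Sum>i\<in>J. (\<integral>\<^sup>+x. f (F i x) \<partial>meas) * ennreal (1 / N))"
  proof (intro sum.cong refl arg_cong2[where f = "(*)"])
    fix i assume i: "i \<in> J"
    have "(\<lambda>x. f (F i x)) \<in> borel_measurable meas"
      by (rule measurable_compose[OF F_measurable[OF i] f])
    then have fF: "(\<lambda>x. f (F i x)) \<in> borel_measurable (restrict_space borel P)"
      unfolding measurable_cong_sets[OF sets_meas refl] .
    have "(\<integral>\<^sup>+\<omega>. f (coding F K (case_nat i \<omega>)) \<partial>seqs) = (\<integral>\<^sup>+\<omega>. f (F i (coding F K \<omega>)) \<partial>seqs)"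
      using i J_sub seqs_W by (intro nn_integral_cong) (auto simp: coding_case_nat subset_eq)
    also have "\<dots> = (\<integral>\<^sup>+x. f (F i x) \<partial>meas)"
      unfolding meas_eq by (rule nn_integral_distr[OF coding_measurable, symmetric]) (simp add: fF)
    finally show "(\<integral>\<^sup>+\<omega>. f (coding F K (case_nat i \<omega>)) \<partial>seqs) = (\<integral>\<^sup>+x. f (F i x) \<partial>meas)" .
  qed
  finally show ?thesis by (simp add: sum_distrib_left mult.commute)
qed

lemma nn_integral_words:
  assumes "f \<in> borel_measurable meas"
  shows "(\<integral>\<^sup>+x. f x \<partial>meas) = ennreal (1 / N ^ n) * (\<Sum>w\<in>words J n. \<integral>\<^sup>+x. f (word_map F w x) \<partial>meas)"
  using assms
proof (induction n arbitrary: f)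
  case (Suc n)
  have "(\<integral>\<^sup>+x. f x \<partial>meas) = ennreal (1 / N) * (\<Sum>i\<in>J. \<integral>\<^sup>+x. f (F i x) \<partial>meas)"
    by (rule nn_integral_step[OF Suc.prems])
  also have "\<dots> = ennreal (1 / N) * (\<Sum>i\<in>J. ennreal (1 / N ^ n) * (\<Sum>w\<in>words J n. \<integral>\<^sup>+x. f (F i (word_map F w x)) \<partial>meas))"
    using measurable_compose[OF F_measurable Suc.prems]
    by (intro arg_cong2[where f = "(*)"] refl sum.cong Suc.IH) auto
  also have "\<dots> = ennreal (1 / N) * ennreal (1 / N ^ n) * (\<Sum>w\<in>words J (Suc n). \<integral>\<^sup>+x. f (word_map F w x) \<partial>meas)"
    by (simp add: sum_words_Suc sum_distrib_left mult.assoc)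
  also have "ennreal (1 / N) * ennreal (1 / N ^ n) = ennreal (1 / N ^ Suc n)"
    by (subst ennreal_mult[symmetric]) auto
  finally show ?case .
qed simp

text \<open>A single nonnegative term is at most the finite sum in
  \<open>nn_integral_words\<close>.\<close>

lemma L2_word_map:
  assumes f: "f \<in> L2_space meas" and w: "w \<in> words J n"
  shows "(\<lambda>x. f (word_map F w x)) \<in> L2_space meas"
proof -
  note fm = L2_spaceD(1)[OF f]
  have m: "(\<lambda>x. f (word_map F w x)) \<in> borel_measurable meas"
    by (rule measurable_compose[OF word_map_measurable[OF w] fm])
  have "(\<integral>\<^sup>+x. ennreal ((f (word_map F w x))\<^sup>2) \<partial>meas) \<le> (\<Sum>w\<in>words J n. \<integral>\<^sup>+x. ennreal ((f (word_map F w x))\<^sup>2) \<partial>meas)"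
    using w finite_words[OF finite_J] by (intro member_le_sum) auto
  also have "\<dots> < \<infinity>"
  proof -
    have "(\<integral>\<^sup>+x. ennreal ((f x)\<^sup>2) \<partial>meas) < \<infinity>"
      using L2_spaceD(2)[OF f] by (simp add: integrable_iff_bounded)
    then have "ennreal (1 / N ^ n) * (\<Sum>w\<in>words J n. \<integral>\<^sup>+x. ennreal ((f (word_map F w x))\<^sup>2) \<partial>meas) < \<infinity>"
      using nn_integral_words[of "\<lambda>x. ennreal ((f x)\<^sup>2)" n] fm by simp
    then show ?thesis using N_pos by (auto simp: ennreal_mult_less_top)
  qed
  finally have "integrable meas (\<lambda>x. (f (word_map F w x))\<^sup>2)"
    using m by (intro integrableI_nonneg) auto
  then show ?thesis using m by (simp add: L2_space_def)
qed

lemma L2_integral_words: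
  assumes f: "f \<in> L2_space meas"
  shows "(\<integral>x. (f x)\<^sup>2 \<partial>meas) = (1 / N ^ n) * (\<Sum>w\<in>words J n. \<integral>x. (f (word_map F w x))\<^sup>2 \<partial>meas)"
proof -
  have "ennreal (\<integral>x. (f x)\<^sup>2 \<partial>meas) = (\<integral>\<^sup>+x. ennreal ((f x)\<^sup>2) \<partial>meas)"
    using L2_spaceD(2)[OF f] by (simp add: nn_integral_eq_integral)
  also have "\<dots> = ennreal (1 / N ^ n) * (\<Sum>w\<in>words J n. \<integral>\<^sup>+x. ennreal ((f (word_map F w x))\<^sup>2) \<partial>meas)"
    using L2_spaceD(1)[OF f] by (intro nn_integral_words) auto
  also have "\<dots> = ennreal (1 / N ^ n) * (\<Sum>w\<in>words J n. ennreal (\<integral>x. (f (word_map F w x))\<^sup>2 \<partial>meas))"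
    using L2_spaceD(2)[OF L2_word_map[OF f]] by (simp add: nn_integral_eq_integral)
  also have "\<dots> = ennreal ((1 / N ^ n) * (\<Sum>w\<in>words J n. \<integral>x. (f (word_map F w x))\<^sup>2 \<partial>meas))"
    by (subst sum_ennreal, simp, subst ennreal_mult[symmetric]) (auto intro: sum_nonneg)
  finally show ?thesis
    by (subst (asm) ennreal_inj) (auto intro!: sum_nonneg divide_nonneg_nonneg)
qed

text \<open>Null sets pull back to null sets: in \<open>nn_integral_words\<close> for the indicator
  of the exceptional set every term must vanish.\<close>

lemma AE_word_map:
  assumes "Measurable.pred meas Q" "AE x in meas. Q x" "w \<in> words J n"
  shows "AE x in meas. Q (word_map F w x)"
proof -
  have [measurable]: "Measurable.pred meas (\<lambda>x. Q (word_map F w x))"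
    by (rule measurable_compose[OF word_map_measurable[OF assms(3)] assms(1)])
  let ?f = "\<lambda>x. indicator {x. \<not> Q x} x :: ennreal"
  have fm: "?f \<in> borel_measurable meas" using assms(1) by (simp add: indicator_def)
  have "(\<integral>\<^sup>+x. ?f x \<partial>meas) = 0"
    using assms(2) fm by (subst nn_integral_0_iff_AE) (auto split: split_indicator)
  then have "(\<Sum>w\<in>words J n. \<integral>\<^sup>+x. ?f (word_map F w x) \<partial>meas) = 0"
    using nn_integral_words[OF fm, of n] N_pos by simp
  then have "(\<integral>\<^sup>+x. ?f (word_map F w x) \<partial>meas) = 0"
    using assms(3) finite_words[OF finite_J] by (simp add: sum_eq_0_iff)
  then have "AE x in meas. ?f (word_map F w x) = 0"
    using measurable_compose[OF word_map_measurable[OF assms(3)] fm] by (subst (asm) nn_integral_0_iff_AE) auto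
  then show ?thesis by eventually_elim (auto split: split_indicator_asm)
qed

end

section \<open>Cells, overlaps and the Whitney decomposition\<close>

locale trace_geometry =
  fixes F :: "'i \<Rightarrow> 'x::polish_space \<Rightarrow> 'x" and W S I :: "'i set" and \<alpha> :: real and K L :: "'x set"
    and \<GG> :: "('x \<Rightarrow> 'x) set"
  assumes alpha_gt: "1 < \<alpha>" and W_fin: "finite W"
    and simil: "\<And>i x y. i \<in> W \<Longrightarrow> dist (F i x) (F i y) = inverse \<alpha> * dist x y"
    and S_sub: "S \<subseteq> W"
    and K_compact: "compact K" and K_nonempty: "K \<noteq> {}" and K_eq: "K = (\<Union>i\<in>S. F i ` K)"
    and G_group: "subgroup \<GG> (BijGroup K)"
    and G_i: "\<And>i. i \<in> W \<Longrightarrow> \<exists>j\<in>S. \<exists>\<Psi>\<in>\<GG>. \<forall>x\<in>K. F i x = F j (\<Psi> x)"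
    and G_ii: "\<And>\<Psi> i. \<Psi> \<in> \<GG> \<Longrightarrow> i \<in> S \<Longrightarrow> \<exists>\<Psi>'\<in>\<GG>. \<exists>i'\<in>S. \<forall>x\<in>K. \<Psi> (F i x) = F i' (\<Psi>' x)"
    and I_sub: "I \<subseteq> W" and I_card: "card I < card S"
    and L_compact: "compact L" and L_nonempty: "L \<noteq> {}" and L_eq: "L = (\<Union>i\<in>I. F i ` L)" and L_K: "L \<subseteq> K"
    and A3: "\<exists>k1>0. \<forall>x\<in>K. \<forall>y\<in>K. \<forall>n. \<forall>v\<in>words S n. \<forall>w\<in>words S n.
        x \<in> cell F K v \<and> y \<in> cell F K w \<and> dist x y < k1 * inverse \<alpha> ^ n \<longrightarrow> adjacent F K v w"
    and A4: "{x\<in>K. infinite {\<omega>. (\<forall>k. \<omega> k \<in> S) \<and> coding F K \<omega> = x}} \<in> null_sets (bernoulli_image F K S K)"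
begin

lemma G_bij: "\<Psi> \<in> \<GG> \<Longrightarrow> bij_betw \<Psi> K K"
  using subgroup.subset[OF G_group] by (auto simp: BijGroup_def Bij_def)

lemma G_image: "\<Psi> \<in> \<GG> \<Longrightarrow> \<Psi> ` K = K"
  using G_bij by (simp add: bij_betw_def)

lemma G_id: "\<exists>\<Psi>\<in>\<GG>. \<forall>x\<in>K. \<Psi> x = x"
  using subgroup.one_closed[OF G_group]
  by (intro bexI[of _ "\<lambda>x\<in>K. x"]) (auto simp: BijGroup_def)

lemma G_compose:
  assumes "\<Psi> \<in> \<GG>" "\<Psi>' \<in> \<GG>"
  shows "\<exists>\<Psi>''\<in>\<GG>. \<forall>x\<in>K. \<Psi>'' x = \<Psi> (\<Psi>' x)"
proof -
  have "\<Psi> \<otimes>\<^bsub>BijGroup K\<^esub> \<Psi>' \<in> \<GG>"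
    using subgroup.m_closed[OF G_group] assms by blast
  moreover have "\<Psi> \<in> Bij K" "\<Psi>' \<in> Bij K"
    using subgroup.subset[OF G_group] assms by (auto simp: BijGroup_def)
  ultimately show ?thesis
    by (intro bexI) (auto simp: BijGroup_def compose_def)
qed

lemma F_W_K:
  assumes "i \<in> W"
  shows "F i ` K \<subseteq> K"
proof
  fix y assume "y \<in> F i ` K"
  then obtain x where x: "x \<in> K" "y = F i x" by blast
  obtain j \<Psi> where j: "j \<in> S" "\<Psi> \<in> \<GG>" "\<forall>x\<in>K. F i x = F j (\<Psi> x)"
    using G_i[OF assms] by blast
  then have "\<Psi> x \<in> K" using G_image[OF j(2)] x(1) by blast
  then have "F j (\<Psi> x) \<in> K" using K_eq j(1) by blast
  then show "y \<in> K" using j(3) x by simp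
qed

sublocale similitudes F W \<alpha> K
  using alpha_gt simil K_compact K_nonempty F_W_K by unfold_locales auto

sublocale S: attractor F W \<alpha> K S K
  by unfold_locales (fact S_sub finite_subset[OF S_sub W_fin] K_compact K_nonempty K_eq subset_refl)+

sublocale I: attractor F W \<alpha> K I L
  by unfold_locales (fact I_sub finite_subset[OF I_sub W_fin] L_compact L_nonempty L_eq L_K)+

lemma S_words_W: "w \<in> words S n \<Longrightarrow> w \<in> words W n"
  using S_sub by (auto simp: words_def)

lemma I_words_W: "w \<in> words I n \<Longrightarrow> w \<in> words W n"
  using I_sub by (auto simp: words_def)

text \<open>(ii) moves the symmetry past one letter at a time.\<close>

lemma G_word_map:
  assumes "\<Psi> \<in> \<GG>" "t \<in> words S n"
  shows "\<exists>s\<in>words S n. \<exists>\<Psi>'\<in>\<GG>. \<forall>x\<in>K. \<Psi> (word_map F t x) = word_map F s (\<Psi>' x)"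
  using assms
proof (induction n arbitrary: t \<Psi>)
  case 0
  then show ?case by auto
next
  case (Suc n)
  then obtain i v where t: "t = i # v" "i \<in> S" "v \<in> words S n"
    by (auto simp: words_Suc)
  obtain \<Psi>1 j where j: "\<Psi>1 \<in> \<GG>" "j \<in> S" "\<And>x. x \<in> K \<Longrightarrow> \<Psi> (F i x) = F j (\<Psi>1 x)"
    using G_ii[OF Suc.prems(1) t(2)] by meson
  obtain s \<Psi>2 where s: "s \<in> words S n" "\<Psi>2 \<in> \<GG>" "\<And>x. x \<in> K \<Longrightarrow> \<Psi>1 (word_map F v x) = word_map F s (\<Psi>2 x)"
    using Suc.IH[OF j(1) t(3)] by meson
  have "\<Psi> (word_map F t x) = word_map F (j # s) (\<Psi>2 x)" if "x \<in> K" for x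
    using j(3)[OF word_map_K[OF S.words_W[OF t(3)] that]] s(3)[OF that] t(1) by simp
  moreover have "j # s \<in> words S (Suc n)" using j s by (auto simp: words_Suc)
  ultimately show ?case using s(2) by blast
qed

text \<open>(i) replaces the first letter, and the symmetry this creates is moved by
  \<open>G_word_map\<close> past the rest, which the induction has already rewritten over S.\<close>

lemma representative_exists:
  assumes "u \<in> words W n"
  shows "\<exists>t\<in>words S n. \<exists>\<Psi>\<in>\<GG>. \<forall>x\<in>K. word_map F u x = word_map F t (\<Psi> x)"
  using assms
proof (induction n arbitrary: u)
  case 0
  obtain \<Psi> where "\<Psi> \<in> \<GG>" "\<forall>x\<in>K. \<Psi> x = x" using G_id by blast
  then show ?case using 0 by (intro bexI[of _ "[]"] bexI[of _ \<Psi>]) auto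
next
  case (Suc n)
  then obtain i v where u: "u = i # v" "i \<in> W" "v \<in> words W n"
    by (auto simp: words_Suc)
  obtain t \<Psi> where t: "t \<in> words S n" "\<Psi> \<in> \<GG>" "\<And>x. x \<in> K \<Longrightarrow> word_map F v x = word_map F t (\<Psi> x)"
    using Suc.IH[OF u(3)] by meson
  obtain j \<Psi>1 where j: "j \<in> S" "\<Psi>1 \<in> \<GG>" "\<And>x. x \<in> K \<Longrightarrow> F i x = F j (\<Psi>1 x)"
    using G_i[OF u(2)] by meson
  obtain s \<Psi>2 where s: "s \<in> words S n" "\<Psi>2 \<in> \<GG>" "\<And>x. x \<in> K \<Longrightarrow> \<Psi>1 (word_map F t x) = word_map F s (\<Psi>2 x)"
    using G_word_map[OF j(2) t(1)] by meson
  obtain \<Psi>3 where p: "\<Psi>3 \<in> \<GG>" "\<And>x. x \<in> K \<Longrightarrow> \<Psi>3 x = \<Psi>2 (\<Psi> x)"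
    using G_compose[OF s(2) t(2)] by meson
  have "word_map F u x = word_map F (j # s) (\<Psi>3 x)" if "x \<in> K" for x
  proof -
    have "\<Psi> x \<in> K" using G_image[OF t(2)] that by blast
    have "word_map F u x = F j (\<Psi>1 (word_map F v x))"
      using j(3)[OF word_map_K[of v x]] u that by (auto simp: words_def)
    then show ?thesis using t(3)[OF that] s(3)[OF \<open>\<Psi> x \<in> K\<close>] p(2)[OF that] by simp
  qed
  moreover have "j # s \<in> words S (Suc n)" using j s by (auto simp: words_Suc)
  ultimately show ?case using p(1) by blast
qed

text \<open>Whitney sets consist of words over W, while (A5) and \<mu> are described by words over
  S; \<open>rep\<close> translates from the former to the latter without changing the cell.\<close>

definition rep :: "'i list \<Rightarrow> 'i list" where
  "rep u = (SOME t. t \<in> words S (length u) \<and> (\<exists>\<Psi>\<in>\<GG>. \<forall>x\<in>K. word_map F u x = word_map F t (\<Psi> x)))"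

lemma rep:
  assumes "u \<in> words W n"
  shows "rep u \<in> words S n" "\<exists>\<Psi>\<in>\<GG>. \<forall>x\<in>K. word_map F u x = word_map F (rep u) (\<Psi> x)"
proof -
  have "length u = n" using assms by (simp add: words_def)
  then show "rep u \<in> words S n" "\<exists>\<Psi>\<in>\<GG>. \<forall>x\<in>K. word_map F u x = word_map F (rep u) (\<Psi> x)"
    using someI_ex[of "\<lambda>t. t \<in> words S (length u) \<and> (\<exists>\<Psi>\<in>\<GG>. \<forall>x\<in>K. word_map F u x = word_map F t (\<Psi> x))"]
      representative_exists[OF assms] by (auto simp: rep_def)
qed

lemma cell_rep:
  assumes "u \<in> words W n"
  shows "cell F K (rep u) = cell F K u"
proof -
  obtain \<Psi> where \<Psi>: "\<Psi> \<in> \<GG>" "\<And>x. x \<in> K \<Longrightarrow> word_map F u x = word_map F (rep u) (\<Psi> x)"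
    using rep(2)[OF assms] by meson
  have "cell F K u = word_map F (rep u) ` \<Psi> ` K"
    using \<Psi>(2) by (auto simp: cell_def image_image)
  then show ?thesis using G_image[OF \<Psi>(1)] by (simp add: cell_def)
qed

lemma shift_preserving: "distr S.seqs S.seqs (\<lambda>\<omega> n. \<omega> (n + k)) = S.seqs"
proof -
  have "distr (Pi\<^sub>M UNIV (\<lambda>_. uniform_count_measure S)) (\<Pi>\<^sub>M i\<in>UNIV. uniform_count_measure S)
      (\<lambda>\<omega>. \<lambda>n\<in>UNIV. \<omega> (n + k)) = (\<Pi>\<^sub>M i\<in>(UNIV::nat set). uniform_count_measure S)"
    by (rule distr_PiM_reindex) (auto simp: S.prob_uniform inj_on_def)
  then show ?thesis by (simp add: S.seqs_def restrict_def)
qed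

lemma shift_measurable: "(\<lambda>\<omega> n. \<omega> (n + k)) \<in> measurable S.seqs S.seqs"
  unfolding S.seqs_def by (rule measurable_PiM_single') (auto simp: space_PiM PiE_iff)

text \<open>A second word for the cell of a tail of \<open>\<omega>\<close> gives a second coding of the point coded by \<open>\<omega>\<close>;
  if this happens along infinitely many tails, the point has infinitely many codings.\<close>

lemma infinite_codings:
  assumes uv: "u \<in> words S n" "v \<in> words S n" "u \<noteq> v"
    and \<omega>: "\<omega> \<in> space S.seqs"
    and inf: "\<And>m. \<exists>k\<ge>m. coding F K (\<lambda>i. \<omega> (i + k)) \<in> cell F K u \<inter> cell F K v"
  shows "infinite {\<omega>'. (\<forall>k. \<omega>' k \<in> S) \<and> coding F K \<omega>' = coding F K \<omega>}" (is "infinite ?Z")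
proof
  assume fin: "finite ?Z"
  have \<omega>S: "\<omega> k \<in> S" for k using \<omega> by (simp add: S.space_seqs)
  then have \<omega>W: "\<omega> k \<in> W" for k using S_sub by blast
  \<comment> \<open>\<open>d\<close> marks a position where another sequence differs from \<omega>.
    If there were finitely many codings, these positions would all lie below some m.\<close>
  have "\<exists>d. \<forall>\<omega>'. \<omega>' \<noteq> \<omega> \<longrightarrow> \<omega>' (d \<omega>') \<noteq> (\<omega> (d \<omega>') :: 'i)"
    by (intro choice allI) auto
  then obtain d where d: "\<And>\<omega>'. \<omega>' \<noteq> \<omega> \<Longrightarrow> \<omega>' (d \<omega>') \<noteq> \<omega> (d \<omega>')" by blast
  obtain m where m: "\<And>\<omega>'. \<omega>' \<in> ?Z \<Longrightarrow> d \<omega>' < m"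
    using finite_nat_set_iff_bounded[of "d ` ?Z"] fin by auto
  obtain k where k: "m \<le> k" "coding F K (\<lambda>i. \<omega> (i + k)) \<in> cell F K u \<inter> cell F K v"
    using inf by blast
  define \<sigma> where "\<sigma> = (\<lambda>i. \<omega> (i + k))"
  \<comment> \<open>At most one of u and v is a prefix of the tail, so one of them differs from its
    prefix.\<close>
  obtain w where w: "w \<in> words S n" "w \<noteq> map \<sigma> [0..<n]" "coding F K \<sigma> \<in> cell F K w"
    using uv k(2) unfolding \<sigma>_def by (cases "u = map (\<lambda>i. \<omega> (i + k)) [0..<n]") auto
  have "length w = n" using w(1) by (simp add: words_def)
  then obtain i where i: "i < n" "w ! i \<noteq> \<sigma> i"
    using w(2) by (metis nth_equalityI length_map length_upt minus_nat.diff_0 nth_map nth_upt add_0)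
  obtain z where z: "z \<in> K" "coding F K \<sigma> = word_map F w z"
    using w(3) by (auto simp: cell_def)
  obtain \<eta> where \<eta>: "\<eta> \<in> space S.seqs" "coding F K \<eta> = z"
    using S.coding_surj[OF z(1)] .
  define w' where "w' j = (if j < n then w ! j else \<omega> j)" for j
  have w'S: "w' j \<in> S" for j
    using w(1) \<omega>S by (auto simp: w'_def words_def)
  have w'W: "w' j \<in> W" for j using w'S S_sub by blast
  have \<eta>S: "\<eta> j \<in> S" for j using \<eta>(1) by (simp add: S.space_seqs)
  then have \<eta>W: "\<eta> j \<in> W" for j using S_sub by blast
  have mw': "map w' [0..<n] = w"
    using \<open>length w = n\<close> by (intro nth_equalityI) (auto simp: w'_def)
  \<comment> \<open>The first k letters of \<omega>, then w, then a coding of the point that w sends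
    to the point of the tail. This codes the same point, differs from \<omega> inside w, and yet
    agrees with it before k \<ge> m.\<close>
  define \<omega>' where "\<omega>' = comb_seq k \<omega> (comb_seq n w' \<eta>)"
  have tail: "comb_seq n w' \<eta> j \<in> W" for j
    using w'W \<eta>W by (auto simp: comb_seq_def)
  have "coding F K \<omega>' = word_map F (map \<omega> [0..<k]) (coding F K (comb_seq n w' \<eta>))"
    unfolding \<omega>'_def by (rule coding_comb_seq[OF \<omega>W tail])
  also have "coding F K (comb_seq n w' \<eta>) = coding F K \<sigma>"
    using coding_comb_seq[OF w'W \<eta>W, of n] mw' \<eta>(2) z(2) by simp
  also have "word_map F (map \<omega> [0..<k]) (coding F K \<sigma>) = coding F K (comb_seq k \<omega> \<sigma>)"
    unfolding \<sigma>_def by (rule coding_comb_seq[symmetric]) (auto simp: \<omega>W)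
  also have "comb_seq k \<omega> \<sigma> = \<omega>"
    by (intro ext) (auto simp: comb_seq_def \<sigma>_def)
  finally have "coding F K \<omega>' = coding F K \<omega>" .
  moreover have "\<omega>' j \<in> S" for j
    using w'S \<eta>S \<omega>S by (auto simp: \<omega>'_def comb_seq_def)
  ultimately have Z: "\<omega>' \<in> ?Z" by simp
  have "\<omega>' (i + k) \<noteq> \<omega> (i + k)"
    using i by (simp add: \<omega>'_def comb_seq_add comb_seq_less w'_def \<sigma>_def)
  then have "\<omega>' \<noteq> \<omega>" by auto
  then have "\<omega>' (d \<omega>') \<noteq> \<omega> (d \<omega>')" by (rule d)
  moreover have "\<omega>' (d \<omega>') = \<omega> (d \<omega>')"
    using m[OF Z] k(1) by (simp add: \<omega>'_def comb_seq_less)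
  ultimately show False by simp
qed

text \<open>The shift preserves the Bernoulli measure, so the sequences whose tails fall into the
  overlap infinitely often are at least as probable as the overlap itself. By
  \<open>infinite_codings\<close> their points have infinitely many codings, and (A4) makes these
  null.\<close>

lemma overlap_null:
  assumes uv: "u \<in> words S n" "v \<in> words S n" "u \<noteq> v"
  shows "AE x in S.meas. x \<notin> cell F K u \<inter> cell F K v"
proof -
  note [measurable] = S.coding_measurable shift_measurable
  have C: "cell F K u \<inter> cell F K v \<in> sets (restrict_space borel K)"
    using compact_imp_closed[OF compact_cell[OF S.words_W[OF uv(1)]]] compact_imp_closed[OF compact_cell[OF S.words_W[OF uv(2)]]]
      cell_subset[OF S.words_W[OF uv(1)]] compact_imp_closed[OF K_compact]
    by (subst sets_restrict_space_iff) (auto intro: sets.Int)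
  define E where "E = coding F K -` (cell F K u \<inter> cell F K v) \<inter> space S.seqs"
  have E: "E \<in> sets S.seqs"
    unfolding E_def by (rule measurable_sets[OF S.coding_measurable C])
  define T where "T k = (\<lambda>\<omega> n. \<omega> (n + k)) -` E \<inter> space S.seqs" for k
  have T: "T k \<in> sets S.seqs" for k
    unfolding T_def by (rule measurable_sets[OF shift_measurable E])
  have "emeasure S.seqs (T k) = emeasure S.seqs E" for k
    unfolding T_def using emeasure_distr[OF shift_measurable E, of k] shift_preserving[of k] by simp
  then have prob_T: "S.Q.prob (T k) = S.Q.prob E" for k
    by (simp add: measure_def)
  define U where "U m = (\<Union>k\<in>{m..}. T k)" for m
  have U: "U m \<in> sets S.seqs" for m unfolding U_def using T by auto
  have "decseq U" unfolding U_def by (intro antimonoI UN_mono) auto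
  then have "(\<lambda>m. S.Q.prob (U m)) \<longlonglongrightarrow> S.Q.prob (\<Inter>m. U m)"
    using U by (intro S.Q.finite_Lim_measure_decseq) auto
  moreover have "S.Q.prob E \<le> S.Q.prob (U m)" for m
    unfolding prob_T[of m, symmetric] using T U by (intro S.Q.finite_measure_mono) (auto simp: U_def)
  ultimately have "S.Q.prob E \<le> S.Q.prob (\<Inter>m. U m)"
    by (intro tendsto_lowerbound[OF _ always_eventually]) auto
  also have "S.Q.prob (\<Inter>m. U m) = 0"
  proof -
    let ?B = "{x\<in>K. infinite {\<omega>. (\<forall>k. \<omega> k \<in> S) \<and> coding F K \<omega> = x}}"
    have B: "?B \<in> null_sets (distr S.seqs (restrict_space borel K) (coding F K))"
      using A4 by (simp add: S.meas_eq[symmetric] S.meas_def)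
    have "(\<Inter>m. U m) \<subseteq> coding F K -` ?B \<inter> space S.seqs"
    proof
      fix \<omega> assume \<omega>U: "\<omega> \<in> (\<Inter>m. U m)"
      then have \<omega>: "\<omega> \<in> space S.seqs" by (auto simp: U_def T_def)
      have "\<exists>k\<ge>m. coding F K (\<lambda>i. \<omega> (i + k)) \<in> cell F K u \<inter> cell F K v" for m
        using \<omega>U by (auto simp: U_def T_def E_def)
      then have "infinite {\<omega>'. (\<forall>k. \<omega>' k \<in> S) \<and> coding F K \<omega>' = coding F K \<omega>}"
        by (rule infinite_codings[OF uv \<omega>])
      then show "\<omega> \<in> coding F K -` ?B \<inter> space S.seqs"
        using \<omega> S.coding_in_P[OF \<omega>] by simp
    qed
    then have "emeasure S.seqs (\<Inter>m. U m) \<le> emeasure S.seqs (coding F K -` ?B \<inter> space S.seqs)"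
      using B by (intro emeasure_mono measurable_sets[OF S.coding_measurable]) auto
    also have "\<dots> = 0"
      using B by (subst emeasure_distr[OF S.coding_measurable, symmetric]) auto
    finally show ?thesis by (simp add: measure_def)
  qed
  finally have "S.Q.prob E = 0" by (simp add: measure_le_0_iff)
  then have "emeasure S.meas (cell F K u \<inter> cell F K v) = 0"
    unfolding S.meas_eq by (subst emeasure_distr[OF S.coding_measurable C]) (simp add: S.Q.emeasure_eq_measure E_def)
  then show ?thesis
    using C by (intro AE_I[of _ _ "cell F K u \<inter> cell F K v"]) (auto simp: S.sets_meas)
qed

text \<open>In effect \<mu> has full support: x lies in cells of arbitrarily small diameter, and by
  \<open>AE_word_map\<close> g vanishes somewhere in each of them.\<close>

lemma AE_eq_0_imp_eq_0:
  assumes g: "continuous_on K g" and ae: "AE x in S.meas. g x = (0::real)" and x: "x \<in> K"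
  shows "g x = 0"
proof (rule ccontr)
  assume "g x \<noteq> 0"
  have "g \<in> borel_measurable S.meas"
    using borel_measurable_continuous_on_restrict[OF g] unfolding measurable_cong_sets[OF S.sets_meas refl] .
  then have pred: "Measurable.pred S.meas (\<lambda>x. g x = 0)" by simp
  obtain \<delta> where \<delta>: "0 < \<delta>" "\<And>y. y \<in> K \<Longrightarrow> dist y x < \<delta> \<Longrightarrow> dist (g y) (g x) < \<bar>g x\<bar>"
    using g x \<open>g x \<noteq> 0\<close> unfolding continuous_on_iff by (metis zero_less_abs_iff)
  have "eventually (\<lambda>n. inverse \<alpha> ^ n * diam < \<delta>) sequentially"
    by (rule order_tendstoD(2)[OF alpha_power_tendsto \<delta>(1)])
  then obtain n where n: "inverse \<alpha> ^ n * diam < \<delta>" by (auto simp: eventually_sequentially)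
  obtain w where w: "w \<in> words S n" "x \<in> word_map F w ` K"
    using S.P_cells[of n] x by blast
  have "AE y in S.meas. g (word_map F w y) = 0"
    by (rule S.AE_word_map[OF pred ae w(1)])
  then have "AE y in S.meas. y \<in> K \<and> g (word_map F w y) = 0"
    using S.space_meas AE_space[of S.meas] by (auto elim: eventually_elim2)
  then obtain y where y: "y \<in> K" "g (word_map F w y) = 0"
    using S.m.AE_contr[of "\<lambda>y. y \<in> K \<and> g (word_map F w y) = 0"] by blast
  have "dist (word_map F w y) x \<le> inverse \<alpha> ^ length w * diam"
    using S.words_W[OF w(1)] w(2) y(1) by (intro dist_cell_le) (auto simp: cell_def)
  then have "dist (word_map F w y) x < \<delta>" using n w(1) by (simp add: words_def)
  then have "dist (g (word_map F w y)) (g x) < \<bar>g x\<bar>"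
    by (intro \<delta>(2) word_map_K S.words_W[OF w(1)] y(1))
  then show False using y(2) by (simp add: dist_real_def)
qed

end

section \<open>Metric properties of the Whitney decomposition\<close>

context trace_geometry
begin

lemma nbhd_words: "A \<subseteq> words W n \<Longrightarrow> nbhd W F K k A \<subseteq> words W n"
proof (induction k)
  case (Suc k)
  then show ?case by (auto simp: adjacent_def words_def subset_eq)
qed simp

lemma nbhd_Suc_superset: "A \<subseteq> words W n \<Longrightarrow> nbhd W F K k A \<subseteq> nbhd W F K (Suc k) A"
  using nbhd_words[of A n k] cell_ne by (auto simp: adjacent_def words_def)

lemma nbhd_mono: "k \<le> l \<Longrightarrow> A \<subseteq> words W n \<Longrightarrow> nbhd W F K k A \<subseteq> nbhd W F K l A"
  by (induction l rule: dec_induct) (use nbhd_Suc_superset in blast)+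

lemma nbhd_member: "v \<in> nbhd W F K k A \<Longrightarrow> \<exists>w\<in>A. v \<in> nbhd W F K k {w}"
proof (induction k arbitrary: v)
  case (Suc k)
  then obtain u where "set v \<subseteq> W" "u \<in> nbhd W F K k A" "adjacent F K v u" by auto
  moreover then obtain w where "w \<in> A" "u \<in> nbhd W F K k {w}" using Suc.IH by blast
  ultimately show ?case by auto
qed simp

text \<open>A chain of k + 1 cells of diameter at most \<open>diam\<close> \<alpha>^-n, each meeting
  the next.\<close>

lemma nbhd_dist:
  assumes w: "w \<in> words W n" and v: "v \<in> nbhd W F K k {w}"
    and x: "x \<in> cell F K v" and y: "y \<in> cell F K w"
  shows "dist x y \<le> real (Suc k) * (inverse \<alpha> ^ n * diam)"
  using v x
proof (induction k arbitrary: v x)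
  case 0
  then show ?case using dist_cell_le[of w x y] w y by (auto simp: words_def)
next
  case (Suc k)
  then obtain u where u: "set v \<subseteq> W" "u \<in> nbhd W F K k {w}" "adjacent F K v u" by auto
  then obtain z where z: "z \<in> cell F K v" "z \<in> cell F K u" by (auto simp: adjacent_def)
  have "u \<in> words W n" using nbhd_words[of "{w}" n k] w u(2) by auto
  then have "length v = n" using u(3) by (auto simp: adjacent_def words_def)
  then have "dist x z \<le> inverse \<alpha> ^ n * diam"
    using dist_cell_le[OF u(1) Suc.prems(2) z(1)] by simp
  moreover have "dist z y \<le> real (Suc k) * (inverse \<alpha> ^ n * diam)"
    by (rule Suc.IH[OF u(2) z(2)])
  ultimately show ?case
    using dist_triangle[of x y z] by (simp add: algebra_simps)
qed

abbreviation Om :: "nat \<Rightarrow> 'i list set" where "Om n \<equiv> words_upto I n"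
abbreviation Aw :: "nat \<Rightarrow> 'i list \<Rightarrow> 'i list set" where "Aw n w \<equiv> whitney_A W F K I n w"
abbreviation Bw :: "nat \<Rightarrow> 'i list \<Rightarrow> 'i list set" where "Bw n w \<equiv> whitney_B W F K I n w"
abbreviation Rw :: "nat \<Rightarrow> 'i list \<Rightarrow> 'i list set" where "Rw n w \<equiv> whitney_R W F K I n w"

lemma Om_iff: "w \<in> Om n \<longleftrightarrow> length w \<le> n \<and> w \<in> words I (length w)"
  by (auto simp: words_upto_def words_def)

lemma Om_words: "w \<in> Om n \<Longrightarrow> w \<in> words I (length w)"
  by (simp add: Om_iff)

lemma finite_Om: "finite (Om n)"
  unfolding words_upto_def using I.finite_J by (auto intro: finite_words)

lemma conc_words_1: "A \<subseteq> words W n \<Longrightarrow> v \<in> conc A (words W 1) \<longleftrightarrow> v \<in> words W (Suc n) \<and> take n v \<in> A"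
proof (intro iffI)
  assume A: "A \<subseteq> words W n" and "v \<in> conc A (words W 1)"
  then obtain a b where "v = a @ b" "a \<in> A" "b \<in> words W 1" by (auto simp: conc_def)
  then show "v \<in> words W (Suc n) \<and> take n v \<in> A"
    using A by (auto simp: words_def)
next
  assume "A \<subseteq> words W n" and v: "v \<in> words W (Suc n) \<and> take n v \<in> A"
  then have "drop n v \<in> words W 1" using drop_words[of v W "Suc n" n] by simp
  then show "v \<in> conc A (words W 1)"
    using v append_take_drop_id[of n v, symmetric] unfolding conc_def by blast
qed

lemma whitney_hat_iff:
  assumes "w \<in> words W n"
  shows "v \<in> whitney_hat W F K k w \<longleftrightarrow> v \<in> words W (Suc n) \<and> take n v \<in> nbhd W F K k {w}"
  unfolding whitney_hat_def using nbhd_words[of "{w}" n k] assms by (intro conc_words_1) auto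

lemma whitney_sub:
  assumes "w \<in> Om n"
  shows "Aw n w \<subseteq> words W (Suc (length w))" "Bw n w \<subseteq> words W (Suc (length w))"
  using whitney_hat_iff[OF I_words_W[OF Om_words[OF assms]]]
  by (auto simp: whitney_A_def whitney_B_def whitney_def)

text \<open>For words shorter than n the sets do not depend on n, and |w| + 1 is the first level for
  which w is shorter.\<close>

lemma whitney_level:
  assumes "w \<in> Om n"
  shows "Bw (min n (Suc (length w))) w = Bw n w" "Aw (min n (Suc (length w))) w = Aw n w"
  using assms by (auto simp: whitney_A_def whitney_B_def Om_iff min_def)

lemma A_sub_B:
  assumes "w \<in> Om n"
  shows "Aw n w \<subseteq> Bw n w"
proof -
  have w: "w \<in> words W (length w)" using I_words_W[OF Om_words[OF assms]] .
  have I: "words I k \<subseteq> words W k" for k using I_sub by (rule words_mono)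
  have hat: "whitney_hat W F K 2 w \<subseteq> whitney_hat W F K 3 w"
    using whitney_hat_iff[OF w] nbhd_mono[of 2 3 "{w}" "length w"] w by auto
  have "nbhd W F K 1 (words I k) \<subseteq> nbhd W F K 2 (words I k)" for k
    using I by (intro nbhd_mono) auto
  then show ?thesis
    using hat unfolding whitney_A_def whitney_B_def whitney_def by (auto split: if_splits)
qed

lemma cells_A_sub_B: "w \<in> Om n \<Longrightarrow> cells F K (Aw n w) \<subseteq> cells F K (Bw n w)"
  using A_sub_B by (auto simp: cells_def)

text \<open>The parent of a word in B_w lies in N_3(w), so a chain of four cells leads to the cell
  of w. For the empty word everything lies in K.\<close>

lemma cells_B_dist:
  assumes w: "w \<in> Om n" and x: "x \<in> cells F K (Bw n w)" and y: "y \<in> cell F K w"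
  shows "dist x y \<le> 4 * diam * inverse \<alpha> ^ length w"
proof -
  have wW: "w \<in> words W (length w)" using I_words_W[OF Om_words[OF w]] .
  obtain b where b: "b \<in> Bw n w" "x \<in> cell F K b" using x by (auto simp: cells_def)
  have bW: "b \<in> words W (Suc (length w))" using whitney_sub[OF w] b by blast
  show ?thesis
  proof (cases "w = []")
    case True
    have "x \<in> K" using cell_subset[of b] b bW by (auto simp: words_def)
    moreover have "y \<in> K" using y True by (simp add: cell_def)
    ultimately show ?thesis using dist_le_diam[of x y] diam_nonneg True by simp
  next
    case False
    then have "b \<in> whitney_hat W F K 3 w"
      using b(1) unfolding whitney_B_def whitney_def by (auto split: if_splits)
    then have nb: "take (length w) b \<in> nbhd W F K 3 {w}"
      using whitney_hat_iff[OF wW] by simp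
    have "x \<in> cell F K (take (length w) b)"
      using cell_take_subset[of b "length w"] bW b(2) by (auto simp: words_def)
    then show ?thesis using nbhd_dist[OF wW nb _ y] by (simp add: mult_ac)
  qed
qed

text \<open>(A3) is stated for words over S; a word over W has the cell of its
  \<open>rep\<close>.\<close>

lemma adjacency_constant:
  obtains k1 where "0 < k1"
    "\<And>n v w x y. v \<in> words W n \<Longrightarrow> w \<in> words W n \<Longrightarrow> x \<in> cell F K v \<Longrightarrow> y \<in> cell F K w \<Longrightarrow>
      dist x y < k1 * inverse \<alpha> ^ n \<Longrightarrow> adjacent F K v w"
proof -
  obtain k1 where k1: "0 < k1" and adj: "\<forall>x\<in>K. \<forall>y\<in>K. \<forall>n. \<forall>v\<in>words S n. \<forall>w\<in>words S n.
        x \<in> cell F K v \<and> y \<in> cell F K w \<and> dist x y < k1 * inverse \<alpha> ^ n \<longrightarrow> adjacent F K v w"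
    using A3 by blast
  have "adjacent F K v w"
    if v: "v \<in> words W n" and w: "w \<in> words W n" and xy: "x \<in> cell F K v" "y \<in> cell F K w"
      and d: "dist x y < k1 * inverse \<alpha> ^ n" for n v w x y
  proof -
    have "x \<in> K" "y \<in> K"
      using xy cell_subset[of v] cell_subset[of w] v w by (auto simp: words_def)
    then have "adjacent F K (rep v) (rep w)"
      using adj rep(1)[OF v] rep(1)[OF w] xy d by (simp add: cell_rep[OF v] cell_rep[OF w])
    then show ?thesis using v w by (auto simp: adjacent_def cell_rep words_def)
  qed
  with k1 show ?thesis using that by blast
qed

text \<open>Below the top level B_w omits the neighbours of I^(|w|+1), so by (A3) it keeps a
  distance of order \<alpha>^-|w| from the cells of these words, hence from L and from the cells of
  all longer words over I. But B_w' stays within 4 \<open>diam\<close> \<alpha>^-|w'| of the cell of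
  w', so w' cannot be much longer than w if the two meet.\<close>

lemma cells_B_level:
  obtains gap where "\<And>n w w'. w \<in> Om n \<Longrightarrow> w' \<in> Om n \<Longrightarrow> cells F K (Bw n w) \<inter> cells F K (Bw n w') \<noteq> {}
    \<Longrightarrow> length w' \<le> length w + gap"
    and "\<And>n w. w \<in> Om n \<Longrightarrow> L \<inter> cells F K (Bw n w) \<noteq> {} \<Longrightarrow> length w = n"
proof -
  obtain k1 where k1: "0 < k1" and adj: "\<And>n v w x y. v \<in> words W n \<Longrightarrow> w \<in> words W n \<Longrightarrow>
      x \<in> cell F K v \<Longrightarrow> y \<in> cell F K w \<Longrightarrow> dist x y < k1 * inverse \<alpha> ^ n \<Longrightarrow> adjacent F K v w"
    by (rule adjacency_constant) blast
  have far: "k1 * inverse \<alpha> ^ Suc (length w) \<le> dist x y"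
    if w: "w \<in> Om n" "length w < n" and x: "x \<in> cells F K (Bw n w)"
      and i: "i \<in> words I (Suc (length w))" and y: "y \<in> cell F K i" for n w x y i
  proof (rule ccontr)
    assume *: "\<not> k1 * inverse \<alpha> ^ Suc (length w) \<le> dist x y"
    obtain b where b: "b \<in> Bw n w" "x \<in> cell F K b" using x by (auto simp: cells_def)
    have bW: "b \<in> words W (Suc (length w))" using whitney_sub[OF w(1)] b by blast
    have "adjacent F K b i"
      using * by (intro adj[OF bW I_words_W[OF i] b(2) y]) simp
    then have "b \<in> nbhd W F K 1 (words I (Suc (length w)))"
      using bW i by (auto simp: words_def)
    then show False
      using b(1) w(2) unfolding whitney_B_def whitney_def by (auto split: if_splits)
  qed
  \<comment> \<open>\<open>gap\<close> counts the levels after which the upper bound, with 4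
    \<open>diam\<close>, falls below the lower bound, with k1 / \<alpha>.\<close>
  have "eventually (\<lambda>gap. inverse \<alpha> ^ gap * (4 * diam) < k1 * inverse \<alpha>) sequentially"
    using k1 inverse_alpha by (intro order_tendstoD(2)[OF alpha_power_tendsto]) auto
  then obtain gap where gap: "inverse \<alpha> ^ gap * (4 * diam) < k1 * inverse \<alpha>"
    by (auto simp: eventually_sequentially)
  have "length w' \<le> length w + gap"
    if w: "w \<in> Om n" and w': "w' \<in> Om n" and ne: "cells F K (Bw n w) \<inter> cells F K (Bw n w') \<noteq> {}" for n w w'
  proof (rule ccontr)
    assume *: "\<not> length w' \<le> length w + gap"
    obtain x where x: "x \<in> cells F K (Bw n w)" "x \<in> cells F K (Bw n w')" using ne by blast
    obtain y where y: "y \<in> cell F K w'" using cell_ne by blast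
    \<comment> \<open>The ancestor of w' in I^(|w|+1); its cell contains y, which is therefore far
      from x.\<close>
    define i where "i = take (Suc (length w)) w'"
    have i: "i \<in> words I (Suc (length w))"
      unfolding i_def using Om_words[OF w'] * by (intro take_words) auto
    have yi: "y \<in> cell F K i"
      unfolding i_def using y cell_take_subset[of w'] I_words_W[OF Om_words[OF w']] by (auto simp: words_def)
    have "length w < n" using * w' by (simp add: Om_iff)
    then have "k1 * inverse \<alpha> ^ Suc (length w) \<le> dist x y"
      by (rule far[OF w _ x(1) i yi])
    also have "\<dots> \<le> 4 * diam * inverse \<alpha> ^ length w'"
      by (rule cells_B_dist[OF w' x(2) y])
    also have "\<dots> \<le> 4 * diam * inverse \<alpha> ^ (length w + gap)"
      using * inverse_alpha diam_nonneg by (intro mult_left_mono power_decreasing) auto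
    also have "\<dots> = inverse \<alpha> ^ length w * (inverse \<alpha> ^ gap * (4 * diam))"
      by (simp add: power_add)
    also have "\<dots> < inverse \<alpha> ^ length w * (k1 * inverse \<alpha>)"
      using gap inverse_alpha by (intro mult_strict_left_mono) auto
    finally show False by (simp add: mult_ac)
  qed
  moreover have "length w = n" if w: "w \<in> Om n" and ne: "L \<inter> cells F K (Bw n w) \<noteq> {}" for n w
  proof (rule ccontr)
    assume "length w \<noteq> n"
    then have "length w < n" using w by (simp add: Om_iff)
    obtain x where x: "x \<in> L" "x \<in> cells F K (Bw n w)" using ne by blast
    obtain i where i: "i \<in> words I (Suc (length w))" "x \<in> word_map F i ` L"
      using I.P_cells[of "Suc (length w)"] x(1) by blast
    then have "x \<in> cell F K i" using L_K by (auto simp: cell_def)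
    then have "k1 * inverse \<alpha> ^ Suc (length w) \<le> dist x x"
      by (rule far[OF w \<open>length w < n\<close> x(2) i(1)])
    moreover have "0 < k1 * inverse \<alpha> ^ Suc (length w)"
      using k1 inverse_alpha by (intro mult_pos_pos zero_less_power)
    ultimately show False by simp
  qed
  ultimately show ?thesis using that by blast
qed

text \<open>On the cell of \<open>u\<close> only the bumps of the words in \<open>near n u\<close> are visible (see \<open>bump_zero\<close> below).\<close>

definition near :: "nat \<Rightarrow> 'i list \<Rightarrow> 'i list set" where
  "near n u = {w \<in> Om n. take (Suc (length w)) u \<in> rep ` Bw n w}"

lemma near_sub: "near n u \<subseteq> Om n"
  by (auto simp: near_def)

lemma finite_near: "finite (near n u)"
  using near_sub finite_Om finite_subset by blast

lemma cell_near:
  assumes u: "u \<in> words S k" and "n < k" and w: "w \<in> near n u"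
  shows "cell F K u \<subseteq> cells F K (Bw n w)"
proof -
  have wn: "w \<in> Om n" using w by (simp add: near_def)
  obtain b where b: "b \<in> Bw n w" "take (Suc (length w)) u = rep b"
    using w by (auto simp: near_def)
  have "b \<in> words W (Suc (length w))" using whitney_sub[OF wn] b by blast
  then have "cell F K (take (Suc (length w)) u) = cell F K b"
    using b(2) cell_rep by simp
  moreover have "cell F K u \<subseteq> cell F K (take (Suc (length w)) u)"
    using S.words_W[OF u] by (rule cell_take_subset)
  ultimately show ?thesis using b(1) by (auto simp: cells_def)
qed

lemma near_pair:
  assumes "u \<in> words S k" "n < k" "w \<in> near n u" "w' \<in> near n u"
  shows "w' \<in> Rw n w"
proof -
  have "cell F K u \<subseteq> cells F K (Bw n w) \<inter> cells F K (Bw n w')"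
    using cell_near[OF assms(1,2)] assms(3,4) by blast
  then show ?thesis
    using cell_ne[of u] assms(4) by (auto simp: whitney_R_def near_def)
qed

text \<open>Follow the prefixes of u to the last level j \<le> n at which they are in N_2(I^j). The
  next prefix has left N_2(I^(j+1)), unless j = n, where nothing is removed; so it belongs to A_w
  for some w in I^j whose N_2 contains the prefix of length j.\<close>

lemma A_cover:
  assumes n: "1 \<le> n" and u: "u \<in> words S k" and k: "n < k"
  shows "\<exists>w\<in>Om n. take (Suc (length w)) u \<in> Aw n w"
proof -
  let ?t = "\<lambda>j. take j u"
  have tW: "?t j \<in> words W j" if "j \<le> k" for j
    using take_words[OF S_words_W[OF u] that] .
  have IW: "words I j \<subseteq> words W j" for j using I_sub by (rule words_mono)
  let ?P = "\<lambda>j. ?t j \<in> nbhd W F K 2 (words I j)"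
  show ?thesis
  proof (cases "?P 1")
    case False
    then have "?t 1 \<in> Aw n []" using tW[of 1] n k by (simp add: whitney_A_def whitney_def)
    then show ?thesis by (intro bexI[of _ "[]"]) (auto simp: Om_iff)
  next
    case True
    define j where "j = (GREATEST j. 1 \<le> j \<and> j \<le> n \<and> ?P j)"
    have j: "1 \<le> j \<and> j \<le> n \<and> ?P j"
      unfolding j_def by (rule GreatestI_nat[of _ 1 n]) (use True n in auto)
    have max: "\<not> ?P (Suc j)" if "j < n"
    proof
      assume "?P (Suc j)"
      then have "Suc j \<le> j"
        unfolding j_def by (intro Greatest_le_nat[of _ _ n]) (use that j_def in auto)
      then show False by simp
    qed
    obtain w where w: "w \<in> words I j" "?t j \<in> nbhd W F K 2 {w}"
      using nbhd_member j by blast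
    then have lw: "length w = j" by (simp add: words_def)
    have wn: "w \<in> Om n" using w(1) j lw by (simp add: Om_iff)
    have "?t (Suc j) \<in> whitney_hat W F K 2 w"
      using whitney_hat_iff[OF I_words_W[OF w(1)]] tW[of "Suc j"] j k w(2)
      by (simp add: min_def)
    moreover have "w \<noteq> []" using lw j by auto
    ultimately have "?t (Suc (length w)) \<in> Aw n w"
      using max lw unfolding whitney_A_def whitney_def by auto
    then show ?thesis using wn by blast
  qed
qed

text \<open>Fixed by \<open>SOME\<close> so that later constants can refer to it.\<close>

definition gap :: nat where
  "gap = (SOME gap. (\<forall>n w w'. w \<in> Om n \<longrightarrow> w' \<in> Om n \<longrightarrow> cells F K (Bw n w) \<inter> cells F K (Bw n w') \<noteq> {} \<longrightarrow>
    length w' \<le> length w + gap))"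

lemma length_le_gap:
  assumes "w \<in> Om n" "w' \<in> Om n" "cells F K (Bw n w) \<inter> cells F K (Bw n w') \<noteq> {}"
  shows "length w' \<le> length w + gap"
proof -
  obtain j where "\<And>n w w'. w \<in> Om n \<Longrightarrow> w' \<in> Om n \<Longrightarrow> cells F K (Bw n w) \<inter> cells F K (Bw n w') \<noteq> {}
    \<Longrightarrow> length w' \<le> length w + j"
    using cells_B_level by metis
  then have "\<exists>gap. \<forall>n w w'. w \<in> Om n \<longrightarrow> w' \<in> Om n \<longrightarrow> cells F K (Bw n w) \<inter> cells F K (Bw n w') \<noteq> {} \<longrightarrow>
    length w' \<le> length w + gap"
    by blast
  from someI_ex[OF this] show ?thesis unfolding gap_def[symmetric] using assms by blast
qed

text \<open>A common point z of the two unions of cells is close to both cells. The lengths differ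
  by at most \<open>gap\<close>, which costs the power of \<alpha>.\<close>

lemma Rw_dist:
  assumes w: "w \<in> Om n" and w': "w' \<in> Rw n w" and x: "x \<in> cell F K w" and y: "y \<in> cell F K w'"
  shows "length w' \<le> length w + gap" "length w \<le> length w' + gap"
    "dist x y \<le> 4 * diam * (1 + \<alpha> ^ gap) * inverse \<alpha> ^ length w"
proof -
  have w'n: "w' \<in> Om n" using w' by (simp add: whitney_R_def)
  obtain z where z: "z \<in> cells F K (Bw n w)" "z \<in> cells F K (Bw n w')"
    using w' by (auto simp: whitney_R_def)
  show 1: "length w' \<le> length w + gap" and 2: "length w \<le> length w' + gap"
    using length_le_gap[OF w w'n] length_le_gap[OF w'n w] z by auto
  have "dist x y \<le> dist z x + dist z y" using dist_triangle2[of x y z] by (simp add: dist_commute)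
  also have "\<dots> \<le> 4 * diam * inverse \<alpha> ^ length w + 4 * diam * inverse \<alpha> ^ length w'"
    by (intro add_mono cells_B_dist[OF w z(1) x] cells_B_dist[OF w'n z(2) y])
  finally have d: "dist x y \<le> 4 * diam * inverse \<alpha> ^ length w + 4 * diam * inverse \<alpha> ^ length w'" .
  have "inverse \<alpha> ^ length w' = \<alpha> ^ gap * inverse \<alpha> ^ (length w' + gap)"
    using alpha by (simp add: power_add power_inverse)
  also have "\<dots> \<le> \<alpha> ^ gap * inverse \<alpha> ^ length w"
    using 2 inverse_alpha alpha by (intro mult_left_mono power_decreasing) auto
  finally have "4 * diam * inverse \<alpha> ^ length w' \<le> 4 * diam * (\<alpha> ^ gap * inverse \<alpha> ^ length w)"
    using diam_nonneg by (intro mult_left_mono) auto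
  then show "dist x y \<le> 4 * diam * (1 + \<alpha> ^ gap) * inverse \<alpha> ^ length w"
    using d by (simp add: algebra_simps)
qed

end

section \<open>Energies of Whitney sums\<close>

locale trace_setting = trace_geometry F W S I \<alpha> K L \<GG>
  for F :: "'i \<Rightarrow> 'x::polish_space \<Rightarrow> 'x" and W S I :: "'i set" and \<alpha> :: real and K L :: "'x set"
    and \<GG> :: "('x \<Rightarrow> 'x) set" +
  fixes \<F> :: "('x \<Rightarrow> real) set" and \<E> :: "('x \<Rightarrow> real) \<Rightarrow> ('x \<Rightarrow> real) \<Rightarrow> real" and \<rho> :: real
    and FA :: "'i list set \<Rightarrow> ('x \<Rightarrow> real) set" and \<Gamma> :: "(nat \<times> 'i list) set"
    and \<tau> :: "nat \<Rightarrow> 'i list \<Rightarrow> nat \<times> 'i list" and \<iota> :: "nat \<Rightarrow> 'i list \<Rightarrow> 'i list \<Rightarrow> 'i list"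
    and \<Phi> :: "nat \<Rightarrow> 'i list \<Rightarrow> 'x \<Rightarrow> 'x" and \<phi>bar \<phi> :: "nat \<Rightarrow> 'i list \<Rightarrow> 'x \<Rightarrow> real"
  assumes G_isometry: "\<And>\<Psi> x y. \<Psi> \<in> \<GG> \<Longrightarrow> x \<in> K \<Longrightarrow> y \<in> K \<Longrightarrow> dist (\<Psi> x) (\<Psi> y) = dist x y"
    and dirichlet: "dirichlet_form (bernoulli_image F K S K) \<F> \<E>"
    and regular: "regular_form (bernoulli_image F K S K) K \<F> \<E>"
    and local: "strong_local (bernoulli_image F K S K) K \<F> \<E>"
    and A5_mem: "\<And>f i. f \<in> \<F> \<Longrightarrow> i \<in> S \<Longrightarrow> f \<circ> F i \<in> \<F>"
    and rho_pos: "0 < \<rho>"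
    and A5_E: "\<And>f. f \<in> \<F> \<Longrightarrow> \<E> f f = \<rho> * (\<Sum>i\<in>S. \<E> (f \<circ> F i) (f \<circ> F i))"
    and A6_pullback: "\<And>\<Psi>. \<Psi> \<in> \<GG> \<Longrightarrow> pullback (bernoulli_image F K S K) \<Psi> \<F> = \<F>"
    and A6_E: "\<And>\<Psi> f. \<Psi> \<in> \<GG> \<Longrightarrow> f \<in> \<F> \<Longrightarrow> \<E> (f \<circ> \<Psi>) (f \<circ> \<Psi>) = \<E> f f"
    and Gamma_fin: "finite \<Gamma>" and Gamma_sub: "\<Gamma> \<subseteq> {(n, w). 1 \<le> n \<and> w \<in> words_upto I n}"
    and C1_tau: "\<And>n w. 1 \<le> n \<Longrightarrow> w \<in> words_upto I n \<Longrightarrow> \<tau> n w \<in> \<Gamma>"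
    and C1_match: "\<And>n w. 1 \<le> n \<Longrightarrow> w \<in> words_upto I n \<Longrightarrow>
      whitney_match W F K I (bernoulli_image F K S K) FA n w (fst (\<tau> n w)) (snd (\<tau> n w)) (\<iota> n w) (\<Phi> n w)"
    and phibar: "\<And>m v. (m, v) \<in> \<Gamma> \<Longrightarrow> \<phi>bar m v \<in> \<F> \<and> (\<forall>x\<in>K. 0 \<le> \<phi>bar m v x \<and> \<phi>bar m v x \<le> 1) \<and>
      (\<forall>x\<in>cells F K (whitney_A W F K I m v). \<phi>bar m v x = 1)"
    and phi: "\<And>n w x. 1 \<le> n \<Longrightarrow> w \<in> words_upto I n \<Longrightarrow> \<phi> n w x =
      (if x \<in> cells F K (whitney_B W F K I n w) then \<phi>bar (fst (\<tau> n w)) (snd (\<tau> n w)) (\<Phi> n w x) else 0)"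
    and C2: "\<And>n w. 1 \<le> n \<Longrightarrow> w \<in> words_upto I n \<Longrightarrow> \<phi> n w \<in> \<F> \<and> continuous_on K (\<phi> n w)"
begin

abbreviation Ecell :: "'i list \<Rightarrow> ('x \<Rightarrow> real) \<Rightarrow> real" where
  "Ecell u f \<equiv> \<E> (\<lambda>x. f (word_map F u x)) (\<lambda>x. f (word_map F u x))"

sublocale D: dirichlet S.meas K \<F> \<E>
  by (rule dirichlet.intro[OF S.m.finite_measure_axioms S.sets_meas compact_K dirichlet[folded S.meas_def]])

text \<open>By regularity some g in the domain is within 1 of the constant 2 on K; its unit
  contraction is 1 there.\<close>

lemma one_mem: "(\<lambda>x. 1) \<in> \<F>"
proof -
  obtain g where g: "g \<in> \<F>" "\<And>x. x \<in> K \<Longrightarrow> \<bar>2 - g x\<bar> < 1"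
    using regular[unfolded regular_form_def, THEN conjunct2, rule_format, of "\<lambda>x. 2" 1] by auto
  show ?thesis
  proof (rule D.D_cong(1)[OF D.unit_contraction(1)[OF g(1)]])
    show "min (max (g x) 0) 1 = 1" if "x \<in> K" for x using g(2)[OF that] by auto
  qed
qed

text \<open>1 is constant on a neighbourhood of every support, namely the whole space. Through
  \<open>add_const\<close> this makes energies blind to additive constants.\<close>

lemma E_one: "f \<in> \<F> \<Longrightarrow> \<E> f (\<lambda>x. 1) = 0"
  using local[unfolded strong_local_def, rule_format, of f "\<lambda>x. 1"] one_mem open_UNIV subset_UNIV by blast

lemma add_const:
  assumes "f \<in> \<F>"
  shows "(\<lambda>x. c + f x) \<in> \<F>" "\<E> (\<lambda>x. c + f x) (\<lambda>x. c + f x) = \<E> f f"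
proof -
  have "(\<lambda>x. 1 * f x + c * 1) \<in> \<F>" by (rule D.D_lincomb[OF assms one_mem])
  then show "(\<lambda>x. c + f x) \<in> \<F>" by (simp add: add.commute)
  show "\<E> (\<lambda>x. c + f x) (\<lambda>x. c + f x) = \<E> f f"
    using D.E_lincomb2[OF assms one_mem, of 1 c] E_one[OF assms] E_one[OF one_mem] by (simp add: add.commute)
qed

lemma word_map_mem_F:
  assumes "f \<in> \<F>" "w \<in> words S n"
  shows "(\<lambda>x. f (word_map F w x)) \<in> \<F>"
  using assms
proof (induction n arbitrary: f w)
  case (Suc n)
  then obtain i v where w: "w = i # v" "i \<in> S" "v \<in> words S n"
    by (auto simp: words_Suc)
  show ?case using Suc.IH[OF A5_mem[OF Suc.prems(1) w(2)] w(3)] w(1) by simp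
qed simp

lemma E_words:
  assumes "f \<in> \<F>"
  shows "\<E> f f = \<rho> ^ n * (\<Sum>w\<in>words S n. Ecell w f)"
  using assms
proof (induction n arbitrary: f)
  case (Suc n)
  have "\<E> f f = \<rho> * (\<Sum>i\<in>S. \<E> (f \<circ> F i) (f \<circ> F i))"
    by (rule A5_E[OF Suc.prems])
  also have "\<dots> = \<rho> * (\<Sum>i\<in>S. \<rho> ^ n * (\<Sum>w\<in>words S n.
      Ecell w (f \<circ> F i)))"
    by (intro arg_cong2[where f = "(*)"] refl sum.cong Suc.IH A5_mem Suc.prems)
  finally show ?case by (simp add: sum_words_Suc sum_distrib_left mult.assoc)
qed simp

lemma G_measurable:
  assumes "\<Psi> \<in> \<GG>"
  shows "\<Psi> \<in> measurable S.meas S.meas"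
proof -
  have "continuous_on K \<Psi>"
    unfolding continuous_on_iff using G_isometry[OF assms] by metis
  then have "\<Psi> \<in> measurable (restrict_space borel K) (restrict_space borel K)"
    using G_image[OF assms]
    by (intro measurable_restrict_space2 borel_measurable_continuous_on_restrict)
      (auto simp: space_restrict_space)
  then show ?thesis unfolding measurable_cong_sets[OF S.sets_meas S.sets_meas] .
qed

text \<open>On K the two word maps differ by a symmetry, which (A6) removes.\<close>

lemma E_rep:
  assumes f: "f \<in> \<F>" and u: "u \<in> words W n"
  shows "(\<lambda>x. f (word_map F u x)) \<in> \<F>"
    "Ecell u f
      = Ecell (rep u) f"
proof -
  obtain \<Psi> where \<Psi>: "\<Psi> \<in> \<GG>" "\<forall>x\<in>K. word_map F u x = word_map F (rep u) (\<Psi> x)"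
    using rep(2)[OF u] by blast
  let ?g = "\<lambda>x. f (word_map F (rep u) x)"
  have g: "?g \<in> \<F>" by (rule word_map_mem_F[OF f rep(1)[OF u]])
  have "?g \<circ> \<Psi> \<in> borel_measurable S.meas"
    by (rule measurable_comp[OF G_measurable[OF \<Psi>(1)] D.D_meas[OF g]])
  then have "?g \<circ> \<Psi> \<in> pullback S.meas \<Psi> \<F>"
    unfolding pullback_def using g by auto
  then have gF: "?g \<circ> \<Psi> \<in> \<F>"
    using A6_pullback[OF \<Psi>(1)] by (simp add: S.meas_def)
  have eq: "(?g \<circ> \<Psi>) x = f (word_map F u x)" if "x \<in> K" for x
    using \<Psi>(2) that by simp
  show "(\<lambda>x. f (word_map F u x)) \<in> \<F>"
    by (rule D.D_cong(1)[OF gF eq])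
  show "Ecell u f = \<E> ?g ?g"
    by (rule trans[OF D.D_cong(2)[OF gF eq] A6_E[OF \<Psi>(1) g]])
qed

section \<open>Uniform bounds for the bumps\<close>

text \<open>Below the top level \<open>n\<close> the bump of \<open>w\<close> is taken from the decomposition of level \<open>length w + 1\<close>,
  which makes it independent of \<open>n\<close>.\<close>

definition bump :: "nat \<Rightarrow> 'i list \<Rightarrow> 'x \<Rightarrow> real" where
  "bump n w = \<phi> (min n (Suc (length w))) w"

text \<open>Finiteness of \<Gamma> is what yields uniform constants. The inserted 0 keeps the
  maximum meaningful for an empty set and nonnegative in any case.\<close>

definition energy_bound :: real where
  "energy_bound = Max (insert 0 ((\<lambda>((m, v), u). Ecell u (\<phi>bar m v))
    ` (SIGMA p:\<Gamma>. words W (Suc (length (snd p))))))"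

definition B_bound :: nat where
  "B_bound = Max (insert 0 ((\<lambda>(m, v). card (Bw m v)) ` \<Gamma>))"

definition R_bound :: nat where
  "R_bound = Max (insert 0 ((\<lambda>(m, v). card (Rw m v)) ` \<Gamma>))"

lemma energy_bound:
  "0 \<le> energy_bound"
  "(m, v) \<in> \<Gamma> \<Longrightarrow> u \<in> words W (Suc (length v)) \<Longrightarrow>
    Ecell u (\<phi>bar m v) \<le> energy_bound"
proof -
  have fin: "finite (SIGMA p:\<Gamma>. words W (Suc (length (snd p))))"
    using Gamma_fin W_fin by (intro finite_SigmaI finite_words)
  show "0 \<le> energy_bound" unfolding energy_bound_def using fin by (intro Max_ge) auto
  assume "(m, v) \<in> \<Gamma>" "u \<in> words W (Suc (length v))"
  then show "Ecell u (\<phi>bar m v) \<le> energy_bound"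
    unfolding energy_bound_def using fin
    by (intro Max_ge finite.insertI finite_imageI insertI2 image_eqI[of _ _ "((m, v), u)"]) auto
qed

lemma card_bounds:
  assumes "(m, v) \<in> \<Gamma>"
  shows "card (Bw m v) \<le> B_bound" "card (Rw m v) \<le> R_bound"
  unfolding B_bound_def R_bound_def using assms Gamma_fin by (force intro!: Max_ge)+

lemma level:
  assumes "1 \<le> n" "w \<in> Om n"
  shows "1 \<le> min n (Suc (length w))" "w \<in> Om (min n (Suc (length w)))"
  using assms by (auto simp: Om_iff)

lemma finite_Bw: "w \<in> Om n \<Longrightarrow> finite (Bw n w)"
  using whitney_sub(2) finite_words[OF W_fin] finite_subset by blast

lemma card_Rw:
  assumes "1 \<le> n" "w \<in> Om n"
  shows "card (Rw n w) \<le> R_bound"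
proof -
  have "card (Rw n w) = card (Rw (fst (\<tau> n w)) (snd (\<tau> n w)))"
    using C1_match[OF assms] unfolding whitney_match_def by (auto intro: bij_betw_same_card)
  then show ?thesis using card_bounds(2)[of "fst (\<tau> n w)" "snd (\<tau> n w)"] C1_tau[OF assms] by simp
qed

text \<open>Unfolds (C1) at w itself, which belongs to its own R_w because B_w is nonempty. Bump,
  cells and cardinality are thereby copied from a configuration in \<Gamma>.\<close>

lemma bump_match:
  assumes n: "1 \<le> n" and w: "w \<in> Om n" and ne: "Bw n w \<noteq> {}"
  shows "\<exists>m v \<Phi>'. (m, v) \<in> \<Gamma> \<and> card (Bw n w) \<le> B_bound \<and>
    (\<forall>x\<in>cells F K (Bw n w). bump n w x = \<phi>bar m v (\<Phi>' x)) \<and>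
    (\<forall>u\<in>Bw n w. \<exists>u'\<in>Bw m v. \<forall>x\<in>K. \<Phi>' (word_map F u x) = word_map F u' x) \<and>
    (\<forall>u\<in>Aw n w. \<exists>u'\<in>Aw m v. \<forall>x\<in>K. \<Phi>' (word_map F u x) = word_map F u' x)"
proof -
  define k where "k = min n (Suc (length w))"
  have k: "1 \<le> k" "w \<in> Om k" using level[OF n w] by (auto simp: k_def)
  have BA: "Bw k w = Bw n w" "Aw k w = Aw n w" using whitney_level[OF w] by (auto simp: k_def)
  define m v where "m = fst (\<tau> k w)" and "v = snd (\<tau> k w)"
  have \<Gamma>: "(m, v) \<in> \<Gamma>" using C1_tau[OF k] by (simp add: m_def v_def)
  have M: "whitney_match W F K I (bernoulli_image F K S K) FA k w m v (\<iota> k w) (\<Phi> k w)"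
    unfolding m_def v_def by (rule C1_match[OF k])
  have "w \<in> Rw k w"
    using k(2) ne BA cell_ne by (auto simp: whitney_R_def cells_def)
  then have same: "same_type_via F K (bernoulli_image F K S K) FA (\<Phi> k w) (Aw n w) (Aw m v)"
      "same_type_via F K (bernoulli_image F K S K) FA (\<Phi> k w) (Bw n w) (Bw m v)"
    using M BA unfolding whitney_match_def by auto
  obtain h where h: "bij_betw h (Bw n w) (Bw m v)"
      "\<forall>u\<in>Bw n w. \<forall>x\<in>K. \<Phi> k w (word_map F u x) = word_map F (h u) x"
    using same(2) unfolding same_type_via_def by blast
  obtain h' where h': "bij_betw h' (Aw n w) (Aw m v)"
      "\<forall>u\<in>Aw n w. \<forall>x\<in>K. \<Phi> k w (word_map F u x) = word_map F (h' u) x"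
    using same(1) unfolding same_type_via_def by blast
  have "card (Bw n w) \<le> B_bound"
    using bij_betw_same_card[OF h(1)] card_bounds(1)[OF \<Gamma>] by simp
  moreover have "bump n w x = \<phi>bar m v (\<Phi> k w x)" if "x \<in> cells F K (Bw n w)" for x
    using phi[OF k, of x] that BA by (simp add: bump_def k_def m_def v_def)
  ultimately show ?thesis
    using \<Gamma> h h' bij_betw_apply[OF h(1)] bij_betw_apply[OF h'(1)] by blast
qed

lemma card_Bw:
  assumes "1 \<le> n" "w \<in> Om n"
  shows "card (Bw n w) \<le> B_bound"
  using bump_match[OF assms] by (cases "Bw n w = {}") auto

lemma bump_mem: "1 \<le> n \<Longrightarrow> w \<in> Om n \<Longrightarrow> bump n w \<in> \<F>"
  and bump_cont: "1 \<le> n \<Longrightarrow> w \<in> Om n \<Longrightarrow> continuous_on K (bump n w)"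
  unfolding bump_def using C2 level by auto

lemma bump_outside:
  assumes "1 \<le> n" "w \<in> Om n" "x \<notin> cells F K (Bw n w)"
  shows "bump n w x = 0"
  using phi[OF level[OF assms(1,2)], of x] assms(3) whitney_level[OF assms(2)] by (simp add: bump_def)

lemma bump_bounds:
  assumes n: "1 \<le> n" and w: "w \<in> Om n"
  shows "0 \<le> bump n w x" "bump n w x \<le> 1"
proof -
  have "0 \<le> bump n w x \<and> bump n w x \<le> 1"
  proof (cases "x \<in> cells F K (Bw n w)")
    case True
    then obtain u y where u: "u \<in> Bw n w" "y \<in> K" "x = word_map F u y"
      by (auto simp: cells_def cell_def)
    then obtain m v \<Phi>' where m: "(m, v) \<in> \<Gamma>" "bump n w x = \<phi>bar m v (\<Phi>' x)"
      "\<exists>u'\<in>Bw m v. \<forall>x\<in>K. \<Phi>' (word_map F u x) = word_map F u' x"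
      using bump_match[OF n w] True by blast
    then obtain u' where u': "u' \<in> Bw m v" "\<Phi>' x = word_map F u' y" using u by auto
    have "v \<in> Om m" using Gamma_sub m(1) by auto
    then have "\<Phi>' x \<in> K"
      using whitney_sub(2)[of v m] u' u(2) by (auto simp: words_def intro!: word_map_K)
    then show ?thesis using phibar[OF m(1)] m(2) by auto
  qed (simp add: bump_outside[OF n w])
  then show "0 \<le> bump n w x" "bump n w x \<le> 1" by auto
qed

lemma bump_one:
  assumes n: "1 \<le> n" and w: "w \<in> Om n" and x: "x \<in> cells F K (Aw n w)"
  shows "bump n w x = 1"
proof -
  have xB: "x \<in> cells F K (Bw n w)" using cells_A_sub_B[OF w] x by blast
  obtain u y where u: "u \<in> Aw n w" "y \<in> K" "x = word_map F u y"
    using x by (auto simp: cells_def cell_def)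
  then have ne: "Bw n w \<noteq> {}" using A_sub_B[OF w] by blast
  obtain m v \<Phi>' where m: "(m, v) \<in> \<Gamma>" "bump n w x = \<phi>bar m v (\<Phi>' x)"
      "\<exists>u'\<in>Aw m v. \<forall>x\<in>K. \<Phi>' (word_map F u x) = word_map F u' x"
    using bump_match[OF n w ne] u(1) xB by blast
  then have "\<Phi>' x \<in> cells F K (Aw m v)" using u by (auto simp: cells_def cell_def)
  then show ?thesis using phibar[OF m(1)] m(2) by auto
qed

text \<open>As t differs from all representatives, its cell meets each cell of B_w in a null set. So
  the bump vanishes almost everywhere on the cell of t, and by continuity everywhere, including the
  contact points.\<close>

lemma bump_zero_first:
  assumes n: "1 \<le> n" and w: "w \<in> Om n" and t: "t \<in> words S (Suc (length w))" "t \<notin> rep ` Bw n w" and x: "x \<in> K"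
  shows "bump n w (word_map F t x) = 0"
proof -
  define Z where "Z = (\<Union>b\<in>Bw n w. cell F K t \<inter> cell F K b)"
  have bW: "b \<in> words W (Suc (length w))" if "b \<in> Bw n w" for b using whitney_sub(2)[OF w] that by blast
  have "closed (cell F K b)" if "b \<in> words W j" for b j
    using compact_cell[of b] that by (auto simp: words_def intro: compact_imp_closed)
  then have "closed Z"
    unfolding Z_def using finite_Bw[OF w] bW S_words_W[OF t(1)] by (intro closed_UN closed_Int) auto
  then have [measurable]: "Z \<in> sets borel" by (rule borel_closed)
  have "Measurable.pred (restrict_space borel K) (\<lambda>y. y \<notin> Z)"
    by (intro measurable_restrict_space1) measurable
  then have pred: "Measurable.pred S.meas (\<lambda>y. y \<notin> Z)"
    unfolding measurable_cong_sets[OF S.sets_meas refl] .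
  have "AE y in S.meas. y \<notin> cell F K t \<inter> cell F K b" if b: "b \<in> Bw n w" for b
    using overlap_null[OF t(1) rep(1)[OF bW[OF b]]] t(2) b cell_rep[OF bW[OF b]] by auto
  then have "AE y in S.meas. \<forall>b\<in>Bw n w. y \<notin> cell F K t \<inter> cell F K b"
    using finite_Bw[OF w] by (intro AE_finite_allI)
  then have "AE y in S.meas. y \<notin> Z"
    by eventually_elim (auto simp: Z_def)
  then have "AE y in S.meas. word_map F t y \<notin> Z"
    by (rule S.AE_word_map[OF pred _ t(1)])
  moreover have "AE y in S.meas. y \<in> K" using AE_space[of S.meas] by (simp add: S.space_meas)
  ultimately have "AE y in S.meas. bump n w (word_map F t y) = 0"
  proof eventually_elim
    case (elim y)
    then have "word_map F t y \<notin> cells F K (Bw n w)" by (auto simp: Z_def cells_def cell_def)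
    then show ?case by (rule bump_outside[OF n w])
  qed
  moreover have "continuous_on K (\<lambda>y. bump n w (word_map F t y))"
    using S.words_W[OF t(1)] word_map_K
    by (intro continuous_on_compose2[OF bump_cont[OF n w] continuous_word_map]) auto
  ultimately show ?thesis using AE_eq_0_imp_eq_0[of "\<lambda>y. bump n w (word_map F t y)"] x by blast
qed

lemma bump_zero:
  assumes n: "1 \<le> n" and w: "w \<in> Om n" and u: "u \<in> words S k" "n < k" "w \<notin> near n u" and x: "x \<in> K"
  shows "bump n w (word_map F u x) = 0"
proof -
  let ?j = "Suc (length w)"
  have le: "?j \<le> k" using w u(2) by (simp add: Om_iff)
  have t: "take ?j u \<in> words S ?j" using take_words[OF u(1) le] .
  have d: "word_map F (drop ?j u) x \<in> K"
    using drop_words[OF u(1), of ?j] S.words_W x word_map_K by blast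
  have "take ?j u \<notin> rep ` Bw n w" using u(3) w by (simp add: near_def)
  then have "bump n w (word_map F (take ?j u) (word_map F (drop ?j u) x)) = 0"
    by (intro bump_zero_first[OF n w t _ d])
  then show ?thesis by (simp flip: word_map_append)
qed

lemma E_zero: "f \<in> \<F> \<Longrightarrow> (\<And>x. x \<in> K \<Longrightarrow> f x = 0) \<Longrightarrow> \<E> f f = 0"
  using D.D_cong(2)[of f "\<lambda>x. 0 * f x"] D.E_scale[of f 0] by simp

text \<open>On the cell of \<open>rep b\<close> the bump is, up to a symmetry, one of the finitely
  many model bumps restricted to a cell u'.\<close>

lemma bump_energy_cell:
  assumes n: "1 \<le> n" and w: "w \<in> Om n" and t: "t \<in> words S (Suc (length w))"
  shows "Ecell t (bump n w)
    \<le> (if t \<in> rep ` Bw n w then energy_bound else 0)"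
proof (cases "t \<in> rep ` Bw n w")
  case False
  then show ?thesis
    using E_zero[OF word_map_mem_F[OF bump_mem[OF n w] t]] bump_zero_first[OF n w t False] by simp
next
  case True
  then obtain b where b: "b \<in> Bw n w" "t = rep b" by blast
  then have bW: "b \<in> words W (Suc (length w))" using whitney_sub(2)[OF w] by blast
  obtain m v \<Phi>' where m: "(m, v) \<in> \<Gamma>" "\<forall>x\<in>cells F K (Bw n w). bump n w x = \<phi>bar m v (\<Phi>' x)"
      "\<exists>u'\<in>Bw m v. \<forall>x\<in>K. \<Phi>' (word_map F b x) = word_map F u' x"
    using bump_match[OF n w] b(1) by blast
  then obtain u' where u': "u' \<in> Bw m v" "\<forall>x\<in>K. \<Phi>' (word_map F b x) = word_map F u' x" by blast
  have "v \<in> Om m" using Gamma_sub m(1) by auto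
  then have u'W: "u' \<in> words W (Suc (length v))" using whitney_sub(2) u'(1) by blast
  have \<phi>F: "(\<lambda>x. \<phi>bar m v (word_map F u' x)) \<in> \<F>"
    using phibar[OF m(1)] by (intro E_rep(1)[OF _ u'W]) blast
  have eq: "\<phi>bar m v (word_map F u' x) = bump n w (word_map F b x)" if "x \<in> K" for x
  proof -
    have "word_map F b x \<in> cells F K (Bw n w)" using b(1) that by (auto simp: cells_def cell_def)
    then show ?thesis using m(2) u'(2) that by simp
  qed
  have "Ecell t (bump n w)
      = Ecell b (bump n w)"
    unfolding b(2) using E_rep(2)[OF bump_mem[OF n w] bW] by simp
  also have "\<dots> = Ecell u' (\<phi>bar m v)"
    by (rule D.D_cong(2)[OF \<phi>F eq])
  also have "\<dots> \<le> energy_bound"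
    by (rule energy_bound(2)[OF m(1) u'W])
  finally show ?thesis using True by simp
qed

lemma card_rep_B:
  assumes "1 \<le> n" "w \<in> Om n"
  shows "card (words S j \<inter> rep ` Bw n w) \<le> B_bound"
proof -
  have "card (words S j \<inter> rep ` Bw n w) \<le> card (rep ` Bw n w)"
    using finite_Bw[OF assms(2)] by (intro card_mono) auto
  also have "\<dots> \<le> card (Bw n w)" by (rule card_image_le[OF finite_Bw[OF assms(2)]])
  finally show ?thesis using card_Bw[OF assms] by simp
qed

text \<open>(A5) at level |w| + 1, where at most \<open>B_bound\<close> cells contribute; the
  isolated factor \<rho> comes from this + 1.\<close>

lemma bump_energy:
  assumes n: "1 \<le> n" and w: "w \<in> Om n"
  shows "\<E> (bump n w) (bump n w) \<le> \<rho> * real B_bound * energy_bound * \<rho> ^ length w"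
proof -
  let ?j = "Suc (length w)"
  have "\<E> (bump n w) (bump n w) = \<rho> ^ ?j * (\<Sum>t\<in>words S ?j. Ecell t (bump n w))"
    by (rule E_words[OF bump_mem[OF n w]])
  also have "\<dots> \<le> \<rho> ^ ?j * (\<Sum>t\<in>words S ?j. if t \<in> rep ` Bw n w then energy_bound else 0)"
    using rho_pos by (intro mult_left_mono sum_mono bump_energy_cell[OF n w]) auto
  also have "(\<Sum>t\<in>words S ?j. if t \<in> rep ` Bw n w then energy_bound else 0)
      = real (card (words S ?j \<inter> rep ` Bw n w)) * energy_bound"
    using finite_words[OF S.finite_J] by (simp add: sum.inter_restrict[symmetric])
  also have "\<rho> ^ ?j * (real (card (words S ?j \<inter> rep ` Bw n w)) * energy_bound) \<le> \<rho> ^ ?j * (real B_bound * energy_bound)"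
    using rho_pos energy_bound(1) card_rep_B[OF n w, of ?j] by (intro mult_left_mono mult_right_mono) auto
  finally show ?thesis by (simp add: mult_ac)
qed

text \<open>The same count of cells, with mass N^-(|w|+1) each and a bump between 0 and 1.\<close>

lemma bump_L2:
  assumes n: "1 \<le> n" and w: "w \<in> Om n"
  shows "(\<integral>x. (bump n w x)\<^sup>2 \<partial>S.meas) \<le> real B_bound * (1 / S.N) ^ length w"
proof -
  let ?j = "Suc (length w)"
  have cell: "(\<integral>x. (bump n w (word_map F t x))\<^sup>2 \<partial>S.meas) \<le> (if t \<in> rep ` Bw n w then 1 else 0)"
    if t: "t \<in> words S ?j" for t
  proof (cases "t \<in> rep ` Bw n w")
    case True
    have "(\<integral>x. (bump n w (word_map F t x))\<^sup>2 \<partial>S.meas) \<le> (\<integral>x. 1 \<partial>S.meas)"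
      using L2_spaceD(2)[OF D.D_L2[OF word_map_mem_F[OF bump_mem[OF n w] t]]] bump_bounds[OF n w]
      by (intro integral_mono) (auto intro: power_le_one)
    then show ?thesis using True by (simp add: S.m.prob_space)
  next
    case False
    have "(\<integral>x. (bump n w (word_map F t x))\<^sup>2 \<partial>S.meas) = (\<integral>x. 0 \<partial>S.meas)"
      using bump_zero_first[OF n w t False] S.space_meas by (intro Bochner_Integration.integral_cong) auto
    then show ?thesis using False by simp
  qed
  have "(\<integral>x. (bump n w x)\<^sup>2 \<partial>S.meas) = (1 / S.N ^ ?j) * (\<Sum>t\<in>words S ?j. \<integral>x. (bump n w (word_map F t x))\<^sup>2 \<partial>S.meas)"
    by (rule S.L2_integral_words[OF D.D_L2[OF bump_mem[OF n w]]])
  also have "\<dots> \<le> (1 / S.N ^ ?j) * (\<Sum>t\<in>words S ?j. if t \<in> rep ` Bw n w then 1 else 0)"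
    by (intro mult_left_mono sum_mono cell) auto
  also have "(\<Sum>t\<in>words S ?j. if t \<in> rep ` Bw n w then 1 else 0) = real (card (words S ?j \<inter> rep ` Bw n w))"
    using finite_words[OF S.finite_J] by (simp add: sum.inter_restrict[symmetric])
  also have "(1 / S.N ^ ?j) * real (card (words S ?j \<inter> rep ` Bw n w)) \<le> (1 / S.N ^ length w) * real B_bound"
  proof (intro mult_mono)
    have "1 \<le> S.N" using S.N_pos by simp
    then show "1 / S.N ^ ?j \<le> 1 / S.N ^ length w"
      by (intro divide_left_mono power_increasing) auto
  qed (use card_rep_B[OF n w, of ?j] in auto)
  finally show ?thesis by (simp add: power_one_over mult.commute)
qed

end

section \<open>The partition of unity\<close>

text \<open>Listed by increasing code, the differences telescope; the induction removes the element
  of largest code.\<close>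

lemma sum_telescope_image:
  fixes e :: "'a \<Rightarrow> nat" and g :: "real \<Rightarrow> real" and b :: "'a \<Rightarrow> real"
  assumes "finite A" "inj_on e A"
  shows "(\<Sum>w\<in>A. g (\<Sum>v\<in>{v\<in>A. e v \<le> e w}. b v) - g (\<Sum>v\<in>{v\<in>A. e v < e w}. b v)) = g (\<Sum>v\<in>A. b v) - g 0"
  using assms
proof (induction "card A" arbitrary: A)
  case 0
  then show ?case by simp
next
  case (Suc k)
  then have "A \<noteq> {}" by auto
  then have "Max (e ` A) \<in> e ` A" using Suc.prems by (intro Max_in) auto
  then obtain z where z: "z \<in> A" "e z = Max (e ` A)" by force
  have max: "e v \<le> e z" if "v \<in> A" for v using Suc.prems z(2) that by simp
  have lt: "e v < e z" if "v \<in> A - {z}" for v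
    using max[of v] that z(1) Suc.prems(2) by (metis DiffE insertI1 inj_onD order_le_neq_trans)
  let ?A = "A - {z}"
  have sets: "{v\<in>A. e v \<le> e w} = {v\<in>?A. e v \<le> e w}" "{v\<in>A. e v < e w} = {v\<in>?A. e v < e w}"
    if "w \<in> ?A" for w using lt[OF that] max by auto
  have z_sets: "{v\<in>A. e v \<le> e z} = A" "{v\<in>A. e v < e z} = ?A"
    using max lt by auto
  have IH: "(\<Sum>w\<in>?A. g (\<Sum>v\<in>{v\<in>?A. e v \<le> e w}. b v) - g (\<Sum>v\<in>{v\<in>?A. e v < e w}. b v)) = g (\<Sum>v\<in>?A. b v) - g 0"
    using Suc.hyps(2) Suc.prems z(1) by (intro Suc.hyps(1)) (auto intro: inj_on_subset)
  have "(\<Sum>w\<in>?A. g (\<Sum>v\<in>{v\<in>A. e v \<le> e w}. b v) - g (\<Sum>v\<in>{v\<in>A. e v < e w}. b v)) = g (\<Sum>v\<in>?A. b v) - g 0"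
    unfolding IH[symmetric] by (intro sum.cong refl) (simp add: sets)
  then show ?case
    using Suc.prems(1) z(1) z_sets by (subst sum.remove[OF Suc.prems(1) z(1)]) simp
qed

context trace_setting
begin

text \<open>A numbering of all words over I at once, the same for every n: then the partitions of
  unity of two levels agree where the same bumps are seen (\<open>wsum_eq\<close>).\<close>

definition enc :: "'i list \<Rightarrow> nat" where
  "enc = to_nat_on (lists I)"

lemma inj_enc: "inj_on enc (Om n)"
proof -
  have "countable (lists I)" using I.finite_J by (intro countable_lists countable_finite)
  moreover have "Om n \<subseteq> lists I" by (auto simp: words_upto_def words_def)
  ultimately show ?thesis unfolding enc_def using inj_on_to_nat_on inj_on_subset by blast
qed

text \<open>A partition of unity subordinate to the bumps, with truncated partial sums in place of
  quotients, since for these the unit contraction suffices to bound the energy.\<close>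

definition psi :: "nat \<Rightarrow> 'i list \<Rightarrow> 'x \<Rightarrow> real" where
  "psi n w x = min 1 (\<Sum>v\<in>{v\<in>Om n. enc v \<le> enc w}. bump n v x) - min 1 (\<Sum>v\<in>{v\<in>Om n. enc v < enc w}. bump n v x)"

definition wsum :: "nat \<Rightarrow> ('i list \<Rightarrow> real) \<Rightarrow> 'x \<Rightarrow> real" where
  "wsum n a x = (\<Sum>w\<in>Om n. a w * psi n w x)"

lemma cells_cover: "\<exists>u\<in>words S k. \<exists>y\<in>K. x = word_map F u y" if "x \<in> K"
  using S.P_cells[of k] that by blast

text \<open>The sum telescopes to the truncation at 1 of the sum of all bumps, and
  \<open>A_cover\<close> provides a bump equal to 1 at x.\<close>

lemma psi_sum:
  assumes n: "1 \<le> n" and x: "x \<in> K"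
  shows "(\<Sum>w\<in>Om n. psi n w x) = 1"
proof -
  obtain u y where u: "u \<in> words S (Suc n)" "y \<in> K" "x = word_map F u y"
    using cells_cover[OF x] by blast
  obtain w where w: "w \<in> Om n" "take (Suc (length w)) u \<in> Aw n w"
    using A_cover[OF n u(1)] by blast
  have "x \<in> cell F K (take (Suc (length w)) u)"
    using cell_take_subset[OF S.words_W[OF u(1)]] u by (auto simp: cell_def)
  then have "bump n w x = 1" using w by (intro bump_one[OF n w(1)]) (auto simp: cells_def)
  then have "1 \<le> (\<Sum>v\<in>Om n. bump n v x)"
    using member_le_sum[of w "Om n" "\<lambda>v. bump n v x"] w(1) finite_Om bump_bounds[OF n] by auto
  then show ?thesis
    using sum_telescope_image[OF finite_Om inj_enc, of "min 1" "\<lambda>v. bump n v x"] by (simp add: psi_def)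
qed

text \<open>Truncation at 1 is monotone and does not increase distances, and the two partial sums
  differ by the bump of w.\<close>

lemma psi_bounds:
  assumes n: "1 \<le> n" and w: "w \<in> Om n"
  shows "0 \<le> psi n w x" "psi n w x \<le> bump n w x"
proof -
  have "{v\<in>Om n. enc v \<le> enc w} = insert w {v\<in>Om n. enc v < enc w}"
    using inj_onD[OF inj_enc, of _ w n] w by (auto simp: le_less)
  then have "(\<Sum>v\<in>{v\<in>Om n. enc v \<le> enc w}. bump n v x) = bump n w x + (\<Sum>v\<in>{v\<in>Om n. enc v < enc w}. bump n v x)"
    using finite_Om by simp
  then show "0 \<le> psi n w x" "psi n w x \<le> bump n w x"
    using bump_bounds[OF n w, of x] by (auto simp: psi_def)
qed

lemma wsum_cont:
  assumes n: "1 \<le> n"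
  shows "continuous_on K (wsum n a)"
  unfolding wsum_def psi_def
  by (intro continuous_intros bump_cont[OF n]) auto

lemma trunc_sum_mem:
  assumes n: "1 \<le> n"
  shows "(\<lambda>x. min 1 (\<Sum>v\<in>{v\<in>Om n. Q v}. bump n v x)) \<in> \<F>"
proof (cases "{v\<in>Om n. Q v} = {}")
  case True
  then show ?thesis using D.D_scale[OF one_mem, of 0] by (simp del: Collect_empty_eq)
next
  case False
  then show ?thesis
    using n bump_bounds finite_Om bump_mem
    by (intro D.min_one_contraction(1) D.D_sum sum_nonneg) auto
qed

lemma Om_ne: "Om n \<noteq> {}"
proof -
  have "[] \<in> Om n" by (simp add: Om_iff)
  then show ?thesis by blast
qed

lemma wsum_mem:
  assumes n: "1 \<le> n"
  shows "wsum n a \<in> \<F>"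
  unfolding wsum_def psi_def
  by (intro D.D_sum finite_Om Om_ne D.D_scale D.D_diff trunc_sum_mem n)

text \<open>The condition Q moves into a factor 0 or 1, so that both partial sums in
  \<open>psi\<close> get the same index set, one of bounded size.\<close>

lemma trunc_sum_cell:
  assumes n: "1 \<le> n" and u: "u \<in> words S k" "n < k" and y: "y \<in> K"
  shows "(\<Sum>v\<in>{v\<in>Om n. Q v}. bump n v (word_map F u y)) = (\<Sum>v\<in>near n u. of_bool (Q v) * bump n v (word_map F u y))"
proof -
  have "(\<Sum>v\<in>{v\<in>Om n. Q v}. bump n v (word_map F u y)) = (\<Sum>v\<in>Om n. of_bool (Q v) * bump n v (word_map F u y))"
    unfolding sum.inter_filter[OF finite_Om] by (intro sum.cong) auto
  also have "\<dots> = (\<Sum>v\<in>near n u. of_bool (Q v) * bump n v (word_map F u y))"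
    using near_sub finite_Om bump_zero[OF n _ u _ y] by (intro sum.mono_neutral_right) auto
  finally show ?thesis .
qed

lemma psi_zero:
  assumes n: "1 \<le> n" and u: "u \<in> words S k" "n < k" and y: "y \<in> K" and w: "w \<in> Om n" "w \<notin> near n u"
  shows "psi n w (word_map F u y) = 0"
  using psi_bounds[OF n w(1), of "word_map F u y"] bump_zero[OF n w(1) u w(2) y] by simp

lemma psi_sum_near:
  assumes n: "1 \<le> n" and u: "u \<in> words S k" "n < k" and y: "y \<in> K"
  shows "(\<Sum>w\<in>near n u. c w * psi n w (word_map F u y)) = wsum n c (word_map F u y)"
  unfolding wsum_def using near_sub finite_Om psi_zero[OF n u y]
  by (intro sum.mono_neutral_left) auto

lemma near_Om: "w \<in> near n u \<Longrightarrow> w \<in> Om n"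
  using near_sub by blast

text \<open>Otherwise the partition of unity would sum to 0 on the cell of u.\<close>

lemma near_ne:
  assumes n: "1 \<le> n" and u: "u \<in> words S k" "n < k"
  shows "near n u \<noteq> {}"
proof
  assume e: "near n u = {}"
  obtain y where y: "y \<in> K" using K_ne by blast
  then have "word_map F u y \<in> K" using word_map_K[OF S.words_W[OF u(1)]] by blast
  then have "(\<Sum>w\<in>Om n. psi n w (word_map F u y)) = 1" by (rule psi_sum[OF n])
  then show False using psi_sum_near[OF n u y, of "\<lambda>_. 1"] e by (simp add: wsum_def)
qed

text \<open>The unions of cells of all visible words contain the cell of u, so these words lie in
  R_w for any one of them.\<close>

lemma card_near:
  assumes n: "1 \<le> n" and u: "u \<in> words S k" "n < k"
  shows "card (near n u) \<le> R_bound"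
proof -
  obtain w where w: "w \<in> near n u" using near_ne[OF assms] by blast
  then have wn: "w \<in> Om n" using near_sub by blast
  have "near n u \<subseteq> Rw n w" using near_pair[OF u w] by blast
  moreover have "finite (Rw n w)" using finite_Om by (simp add: whitney_R_def)
  ultimately show ?thesis using card_mono card_Rw[OF n wn] order_trans by blast
qed

lemma trunc_energy:
  assumes n: "1 \<le> n" and u: "u \<in> words S k" "n < k"
  shows "Ecell u (\<lambda>x. min 1 (\<Sum>v\<in>{v\<in>Om n. Q v}. bump n v x)) \<le> real (card (near n u)) * (\<Sum>v\<in>near n u. Ecell u (bump n v))"
proof -
  let ?s = "\<lambda>x. \<Sum>v\<in>near n u. of_bool (Q v) * bump n v (word_map F u x)"
  have bm: "(\<lambda>x. bump n v (word_map F u x)) \<in> \<F>" if "v \<in> near n u" for v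
    using that near_sub by (intro word_map_mem_F[OF bump_mem[OF n] u(1)]) auto
  then have bm': "(\<lambda>x. of_bool (Q v) * bump n v (word_map F u x)) \<in> \<F>" if "v \<in> near n u" for v
    using that by (intro D.D_scale)
  have s: "?s \<in> \<F>"
    by (intro D.D_sum finite_near near_ne[OF n u] bm')
  have pos: "0 \<le> ?s x" for x
    using bump_bounds(1)[OF n near_Om] by (intro sum_nonneg mult_nonneg_nonneg) auto
  have eq: "min 1 (?s x) = min 1 (\<Sum>v\<in>{v\<in>Om n. Q v}. bump n v (word_map F u x))" if "x \<in> K" for x
    using trunc_sum_cell[OF n u that] by simp
  have "Ecell u (\<lambda>x. min 1 (\<Sum>v\<in>{v\<in>Om n. Q v}. bump n v x)) = \<E> (\<lambda>x. min 1 (?s x)) (\<lambda>x. min 1 (?s x))"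
    by (rule D.D_cong(2)[OF D.min_one_contraction(1)[OF s pos] eq])
  also have "\<dots> \<le> \<E> ?s ?s"
    by (rule D.min_one_contraction(2)[OF s pos])
  also have "\<dots> \<le> real (card (near n u)) * (\<Sum>v\<in>near n u. \<E> (\<lambda>x. of_bool (Q v) * bump n v (word_map F u x)) (\<lambda>x. of_bool (Q v) * bump n v (word_map F u x)))"
    by (intro D.E_sum_le finite_near near_ne[OF n u] bm')
  also have "\<dots> \<le> real (card (near n u)) * (\<Sum>v\<in>near n u. Ecell u (bump n v))"
  proof (intro mult_left_mono sum_mono)
    fix v assume "v \<in> near n u"
    then show "\<E> (\<lambda>x. of_bool (Q v) * bump n v (word_map F u x)) (\<lambda>x. of_bool (Q v) * bump n v (word_map F u x)) \<le> Ecell u (bump n v)"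
      using D.E_scale[OF bm, of v "of_bool (Q v)"] D.E_nonneg[OF bm, of v] by simp
  qed simp
  finally show ?thesis .
qed

lemma psi_energy:
  assumes n: "1 \<le> n" and u: "u \<in> words S k" "n < k"
  shows "(\<lambda>x. psi n w (word_map F u x)) \<in> \<F>"
    "Ecell u (psi n w) \<le> 4 * (real (card (near n u)) * (\<Sum>v\<in>near n u. Ecell u (bump n v)))"
proof -
  have m: "(\<lambda>x. min 1 (\<Sum>v\<in>{v\<in>Om n. Q v}. bump n v (word_map F u x))) \<in> \<F>" for Q
    by (rule word_map_mem_F[OF trunc_sum_mem[OF n] u(1)])
  show "(\<lambda>x. psi n w (word_map F u x)) \<in> \<F>"
    unfolding psi_def by (intro D.D_diff m)
  show "Ecell u (psi n w) \<le> 4 * (real (card (near n u)) * (\<Sum>v\<in>near n u. Ecell u (bump n v)))"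
    unfolding psi_def
    by (rule order_trans[OF D.E_diff_le[OF m m]])
      (use trunc_energy[OF n u, of "\<lambda>v. enc v \<le> enc w"] trunc_energy[OF n u, of "\<lambda>v. enc v < enc w"] in simp)
qed

section \<open>Energy and L2 bounds for Whitney sums\<close>

definition osc :: "nat \<Rightarrow> ('i list \<Rightarrow> real) \<Rightarrow> 'i list \<Rightarrow> real" where
  "osc n a v = (\<Sum>w\<in>Rw n v. (a w - a v)\<^sup>2)"

lemma osc_nonneg: "0 \<le> osc n a v"
  unfolding osc_def by (intro sum_nonneg) auto

text \<open>This is 4 c^2 (2 + 2 c) with c replaced by \<open>R_bound\<close>: 4 from
  \<open>psi_energy\<close>, c^2 from two applications of \<open>E_sum_le\<close>, and 2 + 2 c from
  changing the reference word.\<close>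

definition C_cell :: real where
  "C_cell = 8 * (real R_bound)\<^sup>2 * (1 + real R_bound)"

text \<open>Since the \<open>psi\<close> sum to 1, a constant \<open>a w0\<close> can be subtracted
  at no cost in energy. The remaining differences are then referred to v, the word whose bump energy
  multiplies them, so that summation over u reassembles the energy of the whole bump.\<close>

lemma wsum_energy_cell:
  assumes n: "1 \<le> n" and u: "u \<in> words S k" "n < k"
  shows "Ecell u (wsum n a) \<le> C_cell * (\<Sum>v\<in>near n u. Ecell u (bump n v) * osc n a v)"
proof -
  let ?N = "near n u" and ?c = "real (card (near n u))"
  obtain w0 where w0: "w0 \<in> ?N" using near_ne[OF n u] by blast
  let ?g = "\<lambda>x. \<Sum>w\<in>?N. (a w - a w0) * psi n w (word_map F u x)"
  have gw: "(\<lambda>x. (a w - a w0) * psi n w (word_map F u x)) \<in> \<F>" for w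
    by (intro D.D_scale psi_energy(1)[OF n u])
  have g: "?g \<in> \<F>" by (intro D.D_sum finite_near near_ne[OF n u] gw)
  have eq: "a w0 + ?g x = wsum n a (word_map F u x)" if "x \<in> K" for x
  proof -
    have "(\<Sum>w\<in>?N. psi n w (word_map F u x)) = 1"
      using psi_sum_near[OF n u that, of "\<lambda>_. 1"] psi_sum[OF n word_map_K[OF S.words_W[OF u(1)] that]]
      by (simp add: wsum_def)
    then have "a w0 + ?g x = (\<Sum>w\<in>?N. a w * psi n w (word_map F u x))"
      by (simp add: left_diff_distrib sum_subtractf flip: sum_distrib_left)
    then show ?thesis using psi_sum_near[OF n u that] by simp
  qed
  have "Ecell u (wsum n a) = \<E> ?g ?g"
    using D.D_cong(2)[OF add_const(1)[OF g] eq] add_const(2)[OF g, of "a w0"] by simp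
  also have "\<dots> \<le> ?c * (\<Sum>w\<in>?N. \<E> (\<lambda>x. (a w - a w0) * psi n w (word_map F u x)) (\<lambda>x. (a w - a w0) * psi n w (word_map F u x)))"
    by (intro D.E_sum_le finite_near near_ne[OF n u] gw)
  also have "\<dots> = ?c * (\<Sum>w\<in>?N. (a w - a w0)\<^sup>2 * Ecell u (psi n w))"
    using D.E_scale[OF psi_energy(1)[OF n u]] by simp
  also have "\<dots> \<le> ?c * (\<Sum>w\<in>?N. (a w - a w0)\<^sup>2 * (4 * (?c * (\<Sum>v\<in>?N. Ecell u (bump n v)))))"
    by (intro mult_left_mono sum_mono psi_energy(2)[OF n u]) auto
  also have "\<dots> = 4 * ?c\<^sup>2 * (\<Sum>v\<in>?N. Ecell u (bump n v) * (\<Sum>w\<in>?N. (a w - a w0)\<^sup>2))"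
    unfolding sum_distrib_right[symmetric] by (simp add: power2_eq_square mult_ac)
  also have "\<dots> \<le> 4 * ?c\<^sup>2 * (\<Sum>v\<in>?N. Ecell u (bump n v) * ((2 + 2 * ?c) * osc n a v))"
  proof (intro mult_left_mono sum_mono)
    fix v assume v: "v \<in> ?N"
    have sub: "?N \<subseteq> Rw n v" using near_pair[OF u v] by blast
    have fin: "finite (Rw n v)" using finite_Om by (simp add: whitney_R_def)
    have le: "(\<Sum>w\<in>?N. (a w - a v)\<^sup>2) \<le> osc n a v"
      unfolding osc_def by (rule sum_mono2[OF fin sub]) auto
    have "(a w0 - a v)\<^sup>2 \<le> (\<Sum>w\<in>?N. (a w - a v)\<^sup>2)"
      using w0 finite_near by (intro member_le_sum) auto
    then have le0: "(a w0 - a v)\<^sup>2 \<le> osc n a v" using le by simp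
    \<comment> \<open>The reference word changes from w0 to v; both kinds of differences occur in
      \<open>osc n a v\<close>, because visible words are pairwise related by R.\<close>
    have "(\<Sum>w\<in>?N. (a w - a w0)\<^sup>2) \<le> (\<Sum>w\<in>?N. 2 * (a w - a v)\<^sup>2 + 2 * (a w0 - a v)\<^sup>2)"
    proof (intro sum_mono)
      fix w
      show "(a w - a w0)\<^sup>2 \<le> 2 * (a w - a v)\<^sup>2 + 2 * (a w0 - a v)\<^sup>2"
        using square_add_le[of "a w - a v" "a v - a w0"] by (simp add: power2_commute)
    qed
    also have "\<dots> = 2 * (\<Sum>w\<in>?N. (a w - a v)\<^sup>2) + ?c * (2 * (a w0 - a v)\<^sup>2)"
      by (simp add: sum.distrib sum_distrib_left)
    also have "\<dots> \<le> 2 * osc n a v + ?c * (2 * osc n a v)"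
      using le le0 by (intro add_mono mult_left_mono) auto
    finally show "(\<Sum>w\<in>?N. (a w - a w0)\<^sup>2) \<le> (2 + 2 * ?c) * osc n a v"
      by (simp add: algebra_simps)
    show "0 \<le> Ecell u (bump n v)"
      using v near_sub by (intro D.E_nonneg word_map_mem_F[OF bump_mem[OF n] u(1)]) auto
  qed simp
  also have "\<dots> = 8 * ?c\<^sup>2 * (1 + ?c) * (\<Sum>v\<in>?N. Ecell u (bump n v) * osc n a v)"
    by (simp add: sum_distrib_left mult_ac) (simp add: algebra_simps sum.distrib sum_distrib_left)
  also have "\<dots> \<le> C_cell * (\<Sum>v\<in>?N. Ecell u (bump n v) * osc n a v)"
  proof (rule mult_right_mono)
    have "?c \<le> real R_bound" using card_near[OF n u] by simp
    then show "8 * ?c\<^sup>2 * (1 + ?c) \<le> C_cell"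
      unfolding C_cell_def by (intro mult_mono power_mono) auto
    show "0 \<le> (\<Sum>v\<in>?N. Ecell u (bump n v) * osc n a v)"
      using near_sub by (intro sum_nonneg mult_nonneg_nonneg osc_nonneg D.E_nonneg word_map_mem_F[OF bump_mem[OF n] u(1)]) auto
  qed
  finally show ?thesis .
qed

lemma wsum_L2_cell:
  assumes n: "1 \<le> n" and u: "u \<in> words S k" "n < k"
  shows "(\<integral>x. (wsum n a (word_map F u x))\<^sup>2 \<partial>S.meas)
    \<le> real R_bound * (\<Sum>v\<in>near n u. (a v)\<^sup>2 * (\<integral>x. (bump n v (word_map F u x))\<^sup>2 \<partial>S.meas))"
proof -
  let ?N = "near n u" and ?c = "real (card (near n u))"
  have bm: "(\<lambda>x. bump n v (word_map F u x)) \<in> \<F>" if "v \<in> ?N" for v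
    using that near_sub by (intro word_map_mem_F[OF bump_mem[OF n] u(1)]) auto
  have int: "integrable S.meas (\<lambda>x. (a v)\<^sup>2 * (bump n v (word_map F u x))\<^sup>2)" if "v \<in> ?N" for v
    using L2_spaceD(2)[OF D.D_L2[OF bm[OF that]]] by simp
  have le: "(wsum n a (word_map F u x))\<^sup>2 \<le> real R_bound * (\<Sum>v\<in>?N. (a v)\<^sup>2 * (bump n v (word_map F u x))\<^sup>2)" if "x \<in> K" for x
  proof -
    have "(wsum n a (word_map F u x))\<^sup>2 = (\<Sum>w\<in>?N. a w * psi n w (word_map F u x))\<^sup>2"
      using psi_sum_near[OF n u that] by simp
    also have "\<dots> \<le> ?c * (\<Sum>w\<in>?N. (a w * psi n w (word_map F u x))\<^sup>2)"
      using Cauchy_Schwarz_ineq_sum[of "\<lambda>_. 1" "\<lambda>w. a w * psi n w (word_map F u x)" ?N] by simp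
    also have "\<dots> \<le> real R_bound * (\<Sum>v\<in>?N. (a v)\<^sup>2 * (bump n v (word_map F u x))\<^sup>2)"
    proof (intro mult_mono sum_mono)
      show "?c \<le> real R_bound" using card_near[OF n u] by simp
      fix w assume "w \<in> ?N"
      then show "(a w * psi n w (word_map F u x))\<^sup>2 \<le> (a w)\<^sup>2 * (bump n w (word_map F u x))\<^sup>2"
        unfolding power_mult_distrib using psi_bounds[OF n near_Om] by (intro mult_left_mono power_mono) auto
    qed (auto intro: sum_nonneg)
    finally show ?thesis .
  qed
  have "(\<integral>x. (wsum n a (word_map F u x))\<^sup>2 \<partial>S.meas) \<le> (\<integral>x. real R_bound * (\<Sum>v\<in>?N. (a v)\<^sup>2 * (bump n v (word_map F u x))\<^sup>2) \<partial>S.meas)"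
    using L2_spaceD(2)[OF D.D_L2[OF word_map_mem_F[OF wsum_mem[OF n] u(1)]]] int le S.space_meas
    by (intro integral_mono Bochner_Integration.integrable_sum integrable_mult_right) auto
  also have "\<dots> = real R_bound * (\<Sum>v\<in>?N. (a v)\<^sup>2 * (\<integral>x. (bump n v (word_map F u x))\<^sup>2 \<partial>S.meas))"
    using int by (subst integral_mult_right_zero, subst Bochner_Integration.integral_sum) auto
  finally show ?thesis .
qed

text \<open>The share of one cell in \<open>D.nrm\<close>, with the weight \<rho>^k of (A5) and the
  mass N^-k of the cell (\<open>nrm_words\<close>).\<close>

definition nrm_cell :: "nat \<Rightarrow> 'i list \<Rightarrow> ('x \<Rightarrow> real) \<Rightarrow> real" where
  "nrm_cell k u f = \<rho> ^ k * Ecell u f + (1 / S.N ^ k) * (\<integral>x. (f (word_map F u x))\<^sup>2 \<partial>S.meas)"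

lemma nrm_words:
  assumes "f \<in> \<F>"
  shows "D.nrm f = (\<Sum>u\<in>words S k. nrm_cell k u f)"
  unfolding D.nrm_def nrm_cell_def sum.distrib E_words[OF assms, of k] S.L2_integral_words[OF D.D_L2[OF assms], of k]
  by (simp add: sum_distrib_left)

lemma nrm_cell_diff_le:
  assumes f: "f \<in> \<F>" and g: "g \<in> \<F>" and u: "u \<in> words S k"
  shows "nrm_cell k u (\<lambda>x. f x - g x) \<le> 2 * nrm_cell k u f + 2 * nrm_cell k u g"
proof -
  note fu = word_map_mem_F[OF f u] and gu = word_map_mem_F[OF g u]
  have "\<rho> ^ k * Ecell u (\<lambda>x. f x - g x) \<le> \<rho> ^ k * (2 * Ecell u f + 2 * Ecell u g)"
    using rho_pos by (intro mult_left_mono D.E_diff_le fu gu) auto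
  moreover have "(1 / S.N ^ k) * (\<integral>x. (f (word_map F u x) - g (word_map F u x))\<^sup>2 \<partial>S.meas)
      \<le> (1 / S.N ^ k) * (2 * (\<integral>x. (f (word_map F u x))\<^sup>2 \<partial>S.meas) + 2 * (\<integral>x. (g (word_map F u x))\<^sup>2 \<partial>S.meas))"
    using L2_integral_add_le[OF D.D_L2[OF fu] D.D_L2[OF D.D_scale[OF gu, of "-1"]]]
    by (intro mult_left_mono) auto
  ultimately show ?thesis unfolding nrm_cell_def by (simp add: algebra_simps)
qed

text \<open>A discrete Besov energy of the coefficients on words of length at least l, with the
  orders \<rho>^|v| and N^-|v| of the energy and squared L2 norm of a bump as weights.\<close>

definition tail :: "nat \<Rightarrow> ('i list \<Rightarrow> real) \<Rightarrow> nat \<Rightarrow> real" where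
  "tail n a l = (\<Sum>v\<in>{v\<in>Om n. l \<le> length v}. \<rho> ^ length v * osc n a v + (1 / S.N) ^ length v * (a v)\<^sup>2)"

definition C_sum :: real where
  "C_sum = C_cell * (\<rho> * real B_bound * energy_bound) + real R_bound * real B_bound"

lemma C_sum_nonneg: "0 \<le> C_sum"
  unfolding C_sum_def C_cell_def using rho_pos energy_bound(1) by auto

text \<open>Double counting of nonnegative terms, after enlarging the visible words to all long ones
  and T to all words.\<close>

lemma near_swap:
  assumes T: "T \<subseteq> words S k" "\<And>u w. u \<in> T \<Longrightarrow> w \<in> near n u \<Longrightarrow> l \<le> length w"
    and g: "\<And>u v. u \<in> words S k \<Longrightarrow> v \<in> Om n \<Longrightarrow> 0 \<le> g u v"
  shows "(\<Sum>u\<in>T. \<Sum>v\<in>near n u. g u v) \<le> (\<Sum>v\<in>{v\<in>Om n. l \<le> length v}. \<Sum>u\<in>words S k. (g u v :: real))"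
proof -
  have fin: "finite (words S k)" using S.finite_J by (rule finite_words)
  have "(\<Sum>u\<in>T. \<Sum>v\<in>near n u. g u v) \<le> (\<Sum>u\<in>T. \<Sum>v\<in>{v\<in>Om n. l \<le> length v}. g u v)"
    using T g finite_Om by (intro sum_mono sum_mono2) (auto dest: near_Om)
  also have "\<dots> \<le> (\<Sum>u\<in>words S k. \<Sum>v\<in>{v\<in>Om n. l \<le> length v}. g u v)"
    using T fin g by (intro sum_mono2 sum_nonneg) auto
  also have "\<dots> = (\<Sum>v\<in>{v\<in>Om n. l \<le> length v}. \<Sum>u\<in>words S k. g u v)"
    by (rule sum.swap)
  finally show ?thesis .
qed

text \<open>After the exchange of sums the cell energies of one bump add up to its energy by (A5). A
  subset T of cells is allowed, so that differences of two levels can be estimated too.\<close>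

lemma wsum_nrm_cells:
  assumes n: "1 \<le> n" and k: "n < k"
    and T: "T \<subseteq> words S k" "\<And>u w. u \<in> T \<Longrightarrow> w \<in> near n u \<Longrightarrow> l \<le> length w"
  shows "(\<Sum>u\<in>T. nrm_cell k u (wsum n a)) \<le> C_sum * tail n a l"
proof -
  let ?O = "{v\<in>Om n. l \<le> length v}"
  let ?I = "\<lambda>u v. \<integral>x. (bump n v (word_map F u x))\<^sup>2 \<partial>S.meas"
  have Epos: "0 \<le> Ecell u (bump n v)" if "u \<in> words S k" "v \<in> Om n" for u v
    by (rule D.E_nonneg[OF word_map_mem_F[OF bump_mem[OF n that(2)] that(1)]])
  have "(\<Sum>u\<in>T. \<rho> ^ k * Ecell u (wsum n a)) \<le> (\<Sum>u\<in>T. \<rho> ^ k * (C_cell * (\<Sum>v\<in>near n u. Ecell u (bump n v) * osc n a v)))"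
    using T(1) rho_pos by (intro sum_mono mult_left_mono wsum_energy_cell[OF n _ k]) auto
  also have "\<dots> = \<rho> ^ k * C_cell * (\<Sum>u\<in>T. \<Sum>v\<in>near n u. Ecell u (bump n v) * osc n a v)"
    by (simp add: sum_distrib_left mult.assoc)
  also have "\<dots> \<le> \<rho> ^ k * C_cell * (\<Sum>v\<in>?O. \<Sum>u\<in>words S k. Ecell u (bump n v) * osc n a v)"
    using rho_pos Epos osc_nonneg
    by (intro mult_left_mono near_swap[OF T] mult_nonneg_nonneg) (auto simp: C_cell_def)
  also have "\<dots> = C_cell * (\<Sum>v\<in>?O. \<E> (bump n v) (bump n v) * osc n a v)"
    using E_words[OF bump_mem[OF n], of _ k]
    by (simp add: sum_distrib_left sum_distrib_right mult_ac)
  also have "\<dots> \<le> C_cell * (\<Sum>v\<in>?O. \<rho> * real B_bound * energy_bound * \<rho> ^ length v * osc n a v)"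
    using bump_energy[OF n] osc_nonneg by (intro mult_left_mono sum_mono mult_right_mono) (auto simp: C_cell_def)
  also have "\<dots> = C_cell * (\<rho> * real B_bound * energy_bound) * (\<Sum>v\<in>?O. \<rho> ^ length v * osc n a v)"
    by (simp add: sum_distrib_left mult_ac)
  finally have 1: "(\<Sum>u\<in>T. \<rho> ^ k * Ecell u (wsum n a)) \<le> C_cell * (\<rho> * real B_bound * energy_bound) * (\<Sum>v\<in>?O. \<rho> ^ length v * osc n a v)" .
  have "(\<Sum>u\<in>T. (1 / S.N ^ k) * (\<integral>x. (wsum n a (word_map F u x))\<^sup>2 \<partial>S.meas))
      \<le> (\<Sum>u\<in>T. (1 / S.N ^ k) * (real R_bound * (\<Sum>v\<in>near n u. (a v)\<^sup>2 * ?I u v)))"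
    using T(1) by (intro sum_mono mult_left_mono wsum_L2_cell[OF n _ k]) auto
  also have "\<dots> = (1 / S.N ^ k) * real R_bound * (\<Sum>u\<in>T. \<Sum>v\<in>near n u. (a v)\<^sup>2 * ?I u v)"
    by (simp add: sum_distrib_left mult.assoc)
  also have "\<dots> \<le> (1 / S.N ^ k) * real R_bound * (\<Sum>v\<in>?O. \<Sum>u\<in>words S k. (a v)\<^sup>2 * ?I u v)"
    by (intro mult_left_mono near_swap[OF T]) auto
  also have "\<dots> = real R_bound * (\<Sum>v\<in>?O. (a v)\<^sup>2 * (\<integral>x. (bump n v x)\<^sup>2 \<partial>S.meas))"
    using S.L2_integral_words[OF D.D_L2[OF bump_mem[OF n]], of _ k]
    by (simp add: sum_distrib_left sum_distrib_right sum_divide_distrib mult_ac)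
  also have "\<dots> \<le> real R_bound * (\<Sum>v\<in>?O. (a v)\<^sup>2 * (real B_bound * (1 / S.N) ^ length v))"
    using bump_L2[OF n] by (intro mult_left_mono sum_mono) auto
  also have "\<dots> = real R_bound * real B_bound * (\<Sum>v\<in>?O. (1 / S.N) ^ length v * (a v)\<^sup>2)"
    by (simp add: sum_distrib_left mult_ac)
  finally have 2: "(\<Sum>u\<in>T. (1 / S.N ^ k) * (\<integral>x. (wsum n a (word_map F u x))\<^sup>2 \<partial>S.meas))
      \<le> real R_bound * real B_bound * (\<Sum>v\<in>?O. (1 / S.N) ^ length v * (a v)\<^sup>2)" .
  have pos: "0 \<le> (\<Sum>v\<in>?O. \<rho> ^ length v * osc n a v)" "0 \<le> (\<Sum>v\<in>?O. (1 / S.N) ^ length v * (a v)\<^sup>2)"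
    using rho_pos osc_nonneg by (auto intro!: sum_nonneg mult_nonneg_nonneg)
  have "0 \<le> C_cell * (\<rho> * real B_bound * energy_bound)" "0 \<le> real R_bound * real B_bound"
    using rho_pos energy_bound(1) by (auto simp: C_cell_def)
  then have "C_cell * (\<rho> * real B_bound * energy_bound) * (\<Sum>v\<in>?O. \<rho> ^ length v * osc n a v)
      + real R_bound * real B_bound * (\<Sum>v\<in>?O. (1 / S.N) ^ length v * (a v)\<^sup>2) \<le> C_sum * tail n a l"
    using pos unfolding C_sum_def tail_def sum.distrib
    by (simp add: distrib_left distrib_right mult_nonneg_nonneg)
  then show ?thesis
    using 1 2 unfolding nrm_cell_def sum.distrib by linarith
qed

lemma wsum_nrm:
  assumes n: "1 \<le> n"
  shows "D.nrm (wsum n a) \<le> C_sum * tail n a 0"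
  unfolding nrm_words[OF wsum_mem[OF n], of _ "Suc n"] by (rule wsum_nrm_cells[OF n]) auto

lemma near_level:
  assumes "m \<le> n" "length w < m"
  shows "w \<in> near n u \<longleftrightarrow> w \<in> near m u"
  using assms by (auto simp: near_def Om_iff whitney_B_def)

text \<open>If all visible words are shorter than m, the two levels see the same words with the same
  bumps, ordered by the same \<open>enc\<close>.\<close>

lemma wsum_eq:
  assumes m: "1 \<le> m" "m \<le> n" and u: "u \<in> words S k" "n < k" and y: "y \<in> K"
    and short: "\<And>w. w \<in> near n u \<union> near m u \<Longrightarrow> length w < m"
  shows "wsum n a (word_map F u y) = wsum m a (word_map F u y)"
proof -
  have n: "1 \<le> n" and k: "m < k" using m u by auto
  have near: "near n u = near m u" using short near_level[OF m(2)] by blast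
  have bump: "bump n v = bump m v" if "v \<in> near m u" for v
  proof -
    have "length v < m" using short that by blast
    then have "min n (Suc (length v)) = Suc (length v)" "min m (Suc (length v)) = Suc (length v)"
      using m by auto
    then show ?thesis by (simp add: bump_def)
  qed
  have psi: "psi n w (word_map F u y) = psi m w (word_map F u y)" for w
    unfolding psi_def trunc_sum_cell[OF n u y] trunc_sum_cell[OF m(1) u(1) k y] near
    by (intro arg_cong2[where f = "(-)"] arg_cong2[where f = min] refl sum.cong) (auto simp: bump)
  show ?thesis
    unfolding psi_sum_near[OF n u y, symmetric] psi_sum_near[OF m(1) u(1) k y, symmetric] near psi ..
qed

text \<open>A visible word shorter than m is visible at both levels. Were it shorter than m - gap,
  no visible word of either level could have length m or more, as visible lengths differ by at most
  \<open>gap\<close>.\<close>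

lemma near_levels:
  assumes m: "1 \<le> m" "m \<le> n" and u: "u \<in> words S k" "n < k"
    and w: "w \<in> near n u \<union> near m u" "m \<le> length w" and v: "v \<in> near n u \<union> near m u"
  shows "m - gap \<le> length v"
proof (rule ccontr)
  assume *: "\<not> m - gap \<le> length v"
  then have lt: "length v < m" by simp
  then have vn: "v \<in> near n u" and vm: "v \<in> near m u" using v near_level[OF m(2) lt] by blast+
  have k: "m < k" using m u by simp
  have le: "length w' \<le> length v + gap" if "v \<in> near j u" "w' \<in> near j u" "j < k" for j w'
  proof -
    have "w' \<in> Rw j v" by (rule near_pair[OF u(1) that(3,1,2)])
    then show ?thesis using that near_sub length_le_gap[of v j w'] by (auto simp: whitney_R_def)
  qed
  show False using w le[OF vn _ u(2)] le[OF vm _ k] * by fastforce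
qed

text \<open>By \<open>wsum_eq\<close> only cells that see a word of length at least m contribute,
  and by \<open>near_levels\<close> these see only words of length at least m - gap.\<close>

lemma wsum_diff_nrm:
  assumes m: "1 \<le> m" "m \<le> n"
  shows "D.nrm (\<lambda>x. wsum n a x - wsum m a x) \<le> 2 * C_sum * (tail n a (m - gap) + tail m a (m - gap))"
proof -
  have n: "1 \<le> n" using m by simp
  let ?k = "Suc n"
  have k: "n < ?k" "m < ?k" using m by auto
  let ?h = "\<lambda>x. wsum n a x - wsum m a x"
  have h: "?h \<in> \<F>" by (intro D.D_diff wsum_mem n m)
  define T where "T = {u\<in>words S ?k. \<exists>w\<in>near n u \<union> near m u. m \<le> length w}"
  have T: "T \<subseteq> words S ?k" by (auto simp: T_def)
  have T_level: "m - gap \<le> length w" if "u \<in> T" "w \<in> near n u \<union> near m u" for u w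
    using near_levels[OF m _ k(1)] that unfolding T_def by fastforce
  have zero: "nrm_cell ?k u ?h = 0" if "u \<in> words S ?k - T" for u
  proof -
    have u: "u \<in> words S ?k" using that by simp
    have eq: "?h (word_map F u y) = 0" if "y \<in> K" for y
      using wsum_eq[OF m u k(1) that] \<open>u \<in> words S ?k - T\<close> by (auto simp: T_def not_le)
    have "Ecell u ?h = 0" by (rule E_zero[OF word_map_mem_F[OF h u] eq])
    moreover have "(\<integral>x. (?h (word_map F u x))\<^sup>2 \<partial>S.meas) = (\<integral>x. 0 \<partial>S.meas)"
      using eq S.space_meas by (intro Bochner_Integration.integral_cong) auto
    ultimately show ?thesis by (simp add: nrm_cell_def)
  qed
  have "D.nrm ?h = (\<Sum>u\<in>words S ?k. nrm_cell ?k u ?h)" by (rule nrm_words[OF h])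
  also have "\<dots> = (\<Sum>u\<in>T. nrm_cell ?k u ?h)"
    using T zero finite_words[OF S.finite_J] by (intro sum.mono_neutral_right) auto
  also have "\<dots> \<le> (\<Sum>u\<in>T. 2 * nrm_cell ?k u (wsum n a) + 2 * nrm_cell ?k u (wsum m a))"
    using T by (intro sum_mono nrm_cell_diff_le wsum_mem n m) auto
  also have "\<dots> = 2 * (\<Sum>u\<in>T. nrm_cell ?k u (wsum n a)) + 2 * (\<Sum>u\<in>T. nrm_cell ?k u (wsum m a))"
    by (simp add: sum.distrib sum_distrib_left)
  also have "\<dots> \<le> 2 * (C_sum * tail n a (m - gap)) + 2 * (C_sum * tail m a (m - gap))"
    using T_level by (intro add_mono mult_left_mono wsum_nrm_cells n m k T) auto
  finally show ?thesis by (simp add: algebra_simps)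
qed

end

section \<open>Besov seminorms and cell averages\<close>

lemma (in prob_space) expectation_square_le:
  assumes "f \<in> L2_space M"
  shows "(expectation f)\<^sup>2 \<le> expectation (\<lambda>x. (f x)\<^sup>2)"
  using variance_eq[of f] variance_positive[of f] L2_space_integrable[OF assms] L2_spaceD(2)[OF assms] by simp

locale besov_setting = trace_setting F W S I \<alpha> K L \<GG> \<F> \<E> \<rho> FA \<Gamma> \<tau> \<iota> \<Phi> \<phi>bar \<phi>
  for F :: "'i \<Rightarrow> 'x::polish_space \<Rightarrow> 'x" and W S I \<alpha> K L \<GG> \<F> \<E> \<rho> FA \<Gamma> \<tau> \<iota> \<Phi> \<phi>bar \<phi> +
  fixes d \<beta> c :: real
  assumes d_eq: "d = ln (real (card I)) / ln \<alpha>"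
    and beta_eq: "\<beta> = ln (\<rho> * real (card S)) / ln \<alpha> / 2 - (ln (real (card S)) / ln \<alpha> - d) / 2"
    and c_pos: "0 < c"
begin

abbreviation \<nu> :: "'x measure" where "\<nu> \<equiv> I.meas"

definition avg :: "('x \<Rightarrow> real) \<Rightarrow> 'i list \<Rightarrow> real" where
  "avg f w = (\<integral>y. f (word_map F w y) \<partial>\<nu>)"

lemma avg_lincomb:
  assumes f: "f \<in> L2_space \<nu>" and g: "g \<in> L2_space \<nu>" and w: "w \<in> words I n"
  shows "avg (\<lambda>x. a * f x + b * g x) w = a * avg f w + b * avg g w"
  using I.m.L2_space_integrable[OF I.L2_word_map[OF f w]] I.m.L2_space_integrable[OF I.L2_word_map[OF g w]]
  by (simp add: avg_def)

lemma avg_sum_square: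
  assumes f: "f \<in> L2_space \<nu>"
  shows "(\<Sum>w\<in>words I j. (avg f w)\<^sup>2) \<le> I.N ^ j * (\<integral>x. (f x)\<^sup>2 \<partial>\<nu>)"
proof -
  have "(\<Sum>w\<in>words I j. (avg f w)\<^sup>2) \<le> (\<Sum>w\<in>words I j. \<integral>x. (f (word_map F w x))\<^sup>2 \<partial>\<nu>)"
    unfolding avg_def by (intro sum_mono I.m.expectation_square_le I.L2_word_map[OF f])
  also have "\<dots> = I.N ^ j * (\<integral>x. (f x)\<^sup>2 \<partial>\<nu>)"
    using I.L2_integral_words[OF f, of j] I.N_pos by simp
  finally show ?thesis .
qed

sublocale PP: pair_prob_space \<nu> \<nu> ..

lemma dist_measurable [measurable]: "(\<lambda>z. dist (fst z) (snd z)) \<in> borel_measurable (\<nu> \<Otimes>\<^sub>M \<nu>)"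
proof -
  have "(\<lambda>x. x) \<in> measurable (restrict_space borel L) borel"
    by (intro measurable_restrict_space1) simp
  then have id: "(\<lambda>x. x) \<in> borel_measurable \<nu>"
    unfolding measurable_cong_sets[OF I.sets_meas refl] .
  have "(\<lambda>z. fst z) \<in> borel_measurable (\<nu> \<Otimes>\<^sub>M \<nu>)" "(\<lambda>z. snd z) \<in> borel_measurable (\<nu> \<Otimes>\<^sub>M \<nu>)"
    using measurable_compose[OF measurable_fst id] measurable_compose[OF measurable_snd id] by auto
  then show ?thesis by (rule borel_measurable_dist)
qed

text \<open>With the cut-off inside the integrand, \<open>near_osc\<close> becomes the double
  integral of the Besov coefficient at an arbitrary scale \<delta>.\<close>

definition diff2 :: "('x \<Rightarrow> real) \<Rightarrow> real \<Rightarrow> 'x \<times> 'x \<Rightarrow> real" where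
  "diff2 f \<delta> z = (if dist (fst z) (snd z) < \<delta> then (f (fst z) - f (snd z))\<^sup>2 else 0)"

definition near_osc :: "('x \<Rightarrow> real) \<Rightarrow> real \<Rightarrow> real" where
  "near_osc f \<delta> = (\<integral>z. diff2 f \<delta> z \<partial>(\<nu> \<Otimes>\<^sub>M \<nu>))"

lemma L2_fst_snd:
  assumes f: "f \<in> L2_space \<nu>"
  shows "(\<lambda>z. f (fst z)) \<in> L2_space (\<nu> \<Otimes>\<^sub>M \<nu>)" "(\<lambda>z. f (snd z)) \<in> L2_space (\<nu> \<Otimes>\<^sub>M \<nu>)"
    "(\<integral>z. (f (fst z))\<^sup>2 \<partial>(\<nu> \<Otimes>\<^sub>M \<nu>)) = (\<integral>x. (f x)\<^sup>2 \<partial>\<nu>)" "(\<integral>z. (f (snd z))\<^sup>2 \<partial>(\<nu> \<Otimes>\<^sub>M \<nu>)) = (\<integral>x. (f x)\<^sup>2 \<partial>\<nu>)"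
proof -
  note [measurable] = L2_spaceD(1)[OF f]
  have d1: "distr (\<nu> \<Otimes>\<^sub>M \<nu>) \<nu> fst = \<nu>"
    by (rule I.m.distr_pair_fst)
  have d2: "distr (\<nu> \<Otimes>\<^sub>M \<nu>) \<nu> snd = \<nu>"
  proof -
    \<comment> \<open>The second marginal reduces to the first by the measure-preserving
      swap.\<close>
    have "distr (\<nu> \<Otimes>\<^sub>M \<nu>) \<nu> snd = distr (distr (\<nu> \<Otimes>\<^sub>M \<nu>) (\<nu> \<Otimes>\<^sub>M \<nu>) (\<lambda>(x, y). (y, x))) \<nu> snd"
      using PP.distr_pair_swap by simp
    also have "\<dots> = distr (\<nu> \<Otimes>\<^sub>M \<nu>) \<nu> fst"
      by (subst distr_distr) (auto simp: o_def case_prod_unfold)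
    finally show ?thesis using d1 by simp
  qed
  have "integrable (distr (\<nu> \<Otimes>\<^sub>M \<nu>) \<nu> fst) (\<lambda>x. (f x)\<^sup>2)" "integrable (distr (\<nu> \<Otimes>\<^sub>M \<nu>) \<nu> snd) (\<lambda>x. (f x)\<^sup>2)"
    unfolding d1 d2 using L2_spaceD(2)[OF f] by auto
  then show "(\<lambda>z. f (fst z)) \<in> L2_space (\<nu> \<Otimes>\<^sub>M \<nu>)" "(\<lambda>z. f (snd z)) \<in> L2_space (\<nu> \<Otimes>\<^sub>M \<nu>)"
    unfolding L2_space_def by (auto dest!: integrable_distr[rotated])
  have "(\<integral>x. (f x)\<^sup>2 \<partial>distr (\<nu> \<Otimes>\<^sub>M \<nu>) \<nu> fst) = (\<integral>z. (f (fst z))\<^sup>2 \<partial>(\<nu> \<Otimes>\<^sub>M \<nu>))"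
    "(\<integral>x. (f x)\<^sup>2 \<partial>distr (\<nu> \<Otimes>\<^sub>M \<nu>) \<nu> snd) = (\<integral>z. (f (snd z))\<^sup>2 \<partial>(\<nu> \<Otimes>\<^sub>M \<nu>))"
    by (intro integral_distr; measurable)+
  then show "(\<integral>z. (f (fst z))\<^sup>2 \<partial>(\<nu> \<Otimes>\<^sub>M \<nu>)) = (\<integral>x. (f x)\<^sup>2 \<partial>\<nu>)"
    "(\<integral>z. (f (snd z))\<^sup>2 \<partial>(\<nu> \<Otimes>\<^sub>M \<nu>)) = (\<integral>x. (f x)\<^sup>2 \<partial>\<nu>)"
    unfolding d1 d2 by auto
qed

lemma diff2_measurable:
  assumes "f \<in> L2_space \<nu>"
  shows "diff2 f \<delta> \<in> borel_measurable (\<nu> \<Otimes>\<^sub>M \<nu>)"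
proof -
  note [measurable] = L2_spaceD(1)[OF assms]
  show ?thesis unfolding diff2_def by measurable
qed

text \<open>The crude second bound takes care of finitely many initial levels in
  \<open>level_sum_bound\<close>.\<close>

lemma diff2_integrable:
  assumes f: "f \<in> L2_space \<nu>"
  shows "integrable (\<nu> \<Otimes>\<^sub>M \<nu>) (diff2 f \<delta>)" "near_osc f \<delta> \<le> 4 * (\<integral>x. (f x)\<^sup>2 \<partial>\<nu>)"
proof -
  have le: "diff2 f \<delta> z \<le> 2 * (f (fst z))\<^sup>2 + 2 * (f (snd z))\<^sup>2" for z
    using square_add_le[of "f (fst z)" "- f (snd z)"] by (auto simp: diff2_def)
  have int: "integrable (\<nu> \<Otimes>\<^sub>M \<nu>) (\<lambda>z. 2 * (f (fst z))\<^sup>2 + 2 * (f (snd z))\<^sup>2)"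
    using L2_spaceD(2)[OF L2_fst_snd(1)[OF f]] L2_spaceD(2)[OF L2_fst_snd(2)[OF f]] by auto
  show 1: "integrable (\<nu> \<Otimes>\<^sub>M \<nu>) (diff2 f \<delta>)"
    by (rule Bochner_Integration.integrable_bound[OF int diff2_measurable[OF f]])
      (use le in \<open>auto simp: diff2_def intro!: AE_I2\<close>)
  have "near_osc f \<delta> \<le> (\<integral>z. 2 * (f (fst z))\<^sup>2 + 2 * (f (snd z))\<^sup>2 \<partial>(\<nu> \<Otimes>\<^sub>M \<nu>))"
    unfolding near_osc_def by (rule integral_mono[OF 1 int le])
  also have "\<dots> = 4 * (\<integral>x. (f x)\<^sup>2 \<partial>\<nu>)"
    using L2_spaceD(2)[OF L2_fst_snd(1)[OF f]] L2_spaceD(2)[OF L2_fst_snd(2)[OF f]]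
    by (simp add: L2_fst_snd(3,4)[OF f])
  finally show "near_osc f \<delta> \<le> 4 * (\<integral>x. (f x)\<^sup>2 \<partial>\<nu>)" .
qed

lemma near_osc_nonneg: "0 \<le> near_osc f \<delta>"
  unfolding near_osc_def diff2_def by (intro integral_nonneg_AE) auto

lemma near_osc_mono:
  assumes "f \<in> L2_space \<nu>" "\<delta> \<le> \<delta>'"
  shows "near_osc f \<delta> \<le> near_osc f \<delta>'"
  unfolding near_osc_def using assms
  by (intro integral_mono diff2_integrable) (auto simp: diff2_def)

lemma near_osc_diff_le:
  assumes f: "f \<in> L2_space \<nu>" and g: "g \<in> L2_space \<nu>"
  shows "near_osc (\<lambda>x. f x - g x) \<delta> \<le> 2 * near_osc f \<delta> + 2 * near_osc g \<delta>"
proof -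
  have "near_osc (\<lambda>x. f x - g x) \<delta> \<le> (\<integral>z. 2 * diff2 f \<delta> z + 2 * diff2 g \<delta> z \<partial>(\<nu> \<Otimes>\<^sub>M \<nu>))"
    unfolding near_osc_def
  proof (rule integral_mono[OF diff2_integrable(1)[OF L2_space_diff[OF f g]]])
    show "integrable (\<nu> \<Otimes>\<^sub>M \<nu>) (\<lambda>z. 2 * diff2 f \<delta> z + 2 * diff2 g \<delta> z)"
      using diff2_integrable(1)[OF f] diff2_integrable(1)[OF g] by auto
    show "diff2 (\<lambda>x. f x - g x) \<delta> z \<le> 2 * diff2 f \<delta> z + 2 * diff2 g \<delta> z" for z
      using square_add_le[of "f (fst z) - f (snd z)" "g (snd z) - g (fst z)"]
      by (auto simp: diff2_def algebra_simps power2_commute)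
  qed
  also have "\<dots> = 2 * near_osc f \<delta> + 2 * near_osc g \<delta>"
    using diff2_integrable(1)[OF f] diff2_integrable(1)[OF g] by (simp add: near_osc_def)
  finally show ?thesis .
qed

text \<open>Jensen's inequality on pairs of cells, summed by self-similarity of \<open>\<nu> \<Otimes> \<nu>\<close>.\<close>

lemma avg_diff_square_le:
  assumes f: "f \<in> L2_space \<nu>" and v: "v \<in> words I j" and w: "w \<in> words I l"
  shows "ennreal ((avg f v - avg f w)\<^sup>2)
    \<le> (\<integral>\<^sup>+x. \<integral>\<^sup>+y. ennreal ((f (word_map F v x) - f (word_map F w y))\<^sup>2) \<partial>\<nu> \<partial>\<nu>)"
proof -
  let ?g = "\<lambda>z. f (word_map F v (fst z)) - f (word_map F w (snd z))"
  have fv: "(\<lambda>z. f (word_map F v (fst z))) \<in> L2_space (\<nu> \<Otimes>\<^sub>M \<nu>)" and fw: "(\<lambda>z. f (word_map F w (snd z))) \<in> L2_space (\<nu> \<Otimes>\<^sub>M \<nu>)"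
    using L2_fst_snd(1)[OF I.L2_word_map[OF f v]] L2_fst_snd(2)[OF I.L2_word_map[OF f w]] by auto
  have g: "?g \<in> L2_space (\<nu> \<Otimes>\<^sub>M \<nu>)"
    by (rule L2_space_diff[OF fv fw])
  note iv = PP.L2_space_integrable[OF fv] and iw = PP.L2_space_integrable[OF fw]
  have "(\<integral>z. f (word_map F v (fst z)) \<partial>(\<nu> \<Otimes>\<^sub>M \<nu>)) = avg f v"
    using PP.integral_fst'[OF iv] by (simp add: avg_def I.m.prob_space)
  moreover have "(\<integral>z. f (word_map F w (snd z)) \<partial>(\<nu> \<Otimes>\<^sub>M \<nu>)) = avg f w"
    using PP.integral_fst'[OF iw] by (simp add: avg_def I.m.prob_space)
  ultimately have "(\<integral>z. ?g z \<partial>(\<nu> \<Otimes>\<^sub>M \<nu>)) = avg f v - avg f w"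
    using iv iw by simp
  then have "(avg f v - avg f w)\<^sup>2 \<le> (\<integral>z. (?g z)\<^sup>2 \<partial>(\<nu> \<Otimes>\<^sub>M \<nu>))"
    using PP.expectation_square_le[OF g] by simp
  then have "ennreal ((avg f v - avg f w)\<^sup>2) \<le> ennreal (\<integral>z. (?g z)\<^sup>2 \<partial>(\<nu> \<Otimes>\<^sub>M \<nu>))"
    by (rule ennreal_leI)
  also have "\<dots> = (\<integral>\<^sup>+z. ennreal ((?g z)\<^sup>2) \<partial>(\<nu> \<Otimes>\<^sub>M \<nu>))"
    using L2_spaceD(2)[OF g] by (simp add: nn_integral_eq_integral)
  also have "\<dots> = (\<integral>\<^sup>+x. \<integral>\<^sup>+y. ennreal ((f (word_map F v x) - f (word_map F w y))\<^sup>2) \<partial>\<nu> \<partial>\<nu>)"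
    using L2_spaceD(1)[OF g] by (subst I.m.nn_integral_fst[symmetric]) auto
  finally show ?thesis .
qed

text \<open>Closeness makes the cut-off of \<open>diff2\<close> inactive on the pairs in R.
  Extending the sum to all pairs of words then gives the integral over L \<times> L, with the factor
  N_I^(j+l), the inverse mass of a product of cells.\<close>

lemma avg_sum_pairs:
  assumes f: "f \<in> L2_space \<nu>"
    and R: "R \<subseteq> words I j \<times> words I l"
    and close: "\<And>v w x y. (v, w) \<in> R \<Longrightarrow> x \<in> cell F K v \<Longrightarrow> y \<in> cell F K w \<Longrightarrow> dist x y < \<delta>"
  shows "(\<Sum>(v, w)\<in>R. (avg f v - avg f w)\<^sup>2) \<le> I.N ^ (j + l) * near_osc f \<delta>"
proof -
  let ?h = "\<lambda>x y. ennreal (diff2 f \<delta> (x, y))"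
  have h: "(\<lambda>(x, y). ?h x y) \<in> borel_measurable (\<nu> \<Otimes>\<^sub>M \<nu>)"
    using diff2_measurable[OF f, of \<delta>] by (simp add: case_prod_unfold)
  have hy: "?h x \<in> borel_measurable \<nu>" if "x \<in> L" for x
    using measurable_Pair2[OF h, of x] that by (simp add: I.space_meas)
  have hx: "(\<lambda>x. \<integral>\<^sup>+y. ?h x y \<partial>\<nu>) \<in> borel_measurable \<nu>"
    using I.m.borel_measurable_nn_integral_fst[OF h] by simp
  have fin: "finite (words I j)" "finite (words I l)" using I.finite_J by (auto intro: finite_words)
  let ?H = "\<lambda>v w. \<integral>\<^sup>+x. \<integral>\<^sup>+y. ?h (word_map F v x) (word_map F w y) \<partial>\<nu> \<partial>\<nu>"
  have mL: "word_map F v x \<in> L" if "v \<in> words I i" "x \<in> L" for v i x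
    using I.word_map_P that .
  have inner: "(\<lambda>x. \<integral>\<^sup>+y. ?h (word_map F v x) (word_map F w y) \<partial>\<nu>) \<in> borel_measurable \<nu>"
    if "v \<in> words I j" "w \<in> words I l" for v w
  proof -
    note [measurable] = I.word_map_measurable[OF that(1)] I.word_map_measurable[OF that(2)]
    have "(\<lambda>(x, y). ?h (word_map F v x) (word_map F w y)) \<in> borel_measurable (\<nu> \<Otimes>\<^sub>M \<nu>)"
      using measurable_compose[of "\<lambda>z. (word_map F v (fst z), word_map F w (snd z))" "\<nu> \<Otimes>\<^sub>M \<nu>" "\<nu> \<Otimes>\<^sub>M \<nu>" "\<lambda>(x, y). ?h x y", OF _ h]
      by (simp add: case_prod_unfold)
    then show ?thesis using I.m.borel_measurable_nn_integral_fst by fastforce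
  qed
  have "(\<Sum>(v, w)\<in>R. ennreal ((avg f v - avg f w)\<^sup>2)) \<le> (\<Sum>(v, w)\<in>R. ?H v w)"
  proof (intro sum_mono, clarify)
    fix v w assume vw: "(v, w) \<in> R"
    then have v: "v \<in> words I j" and w: "w \<in> words I l" using R by auto
    have "ennreal ((avg f v - avg f w)\<^sup>2) \<le> (\<integral>\<^sup>+x. \<integral>\<^sup>+y. ennreal ((f (word_map F v x) - f (word_map F w y))\<^sup>2) \<partial>\<nu> \<partial>\<nu>)"
      by (rule avg_diff_square_le[OF f v w])
    also have "\<dots> = ?H v w"
    proof (intro nn_integral_cong)
      fix x y assume "x \<in> space \<nu>" "y \<in> space \<nu>"
      then have "dist (word_map F v x) (word_map F w y) < \<delta>"
        using L_K by (intro close[OF vw]) (auto simp: I.space_meas cell_def)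
      then show "ennreal ((f (word_map F v x) - f (word_map F w y))\<^sup>2) = ?h (word_map F v x) (word_map F w y)"
        by (simp add: diff2_def)
    qed
    finally show "ennreal ((avg f v - avg f w)\<^sup>2) \<le> ?H v w" .
  qed
  also have "\<dots> \<le> (\<Sum>(v, w)\<in>words I j \<times> words I l. ?H v w)"
    using R fin by (intro sum_mono2) auto
  also have "\<dots> = (\<Sum>v\<in>words I j. \<Sum>w\<in>words I l. ?H v w)"
    by (simp add: sum.cartesian_product)
  also have "\<dots> = (\<Sum>v\<in>words I j. ennreal (I.N ^ l) * (\<integral>\<^sup>+x. \<integral>\<^sup>+y. ?h (word_map F v x) y \<partial>\<nu> \<partial>\<nu>))"
  proof (intro sum.cong refl)
    fix v assume v: "v \<in> words I j"
    have "ennreal (I.N ^ l) * (\<integral>\<^sup>+x. \<integral>\<^sup>+y. ?h (word_map F v x) y \<partial>\<nu> \<partial>\<nu>)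
        = ennreal (I.N ^ l) * (\<integral>\<^sup>+x. ennreal (1 / I.N ^ l) * (\<Sum>w\<in>words I l. \<integral>\<^sup>+y. ?h (word_map F v x) (word_map F w y) \<partial>\<nu>) \<partial>\<nu>)"
      using mL[OF v] hy by (intro arg_cong2[where f = "(*)"] refl nn_integral_cong I.nn_integral_words) (auto simp: I.space_meas)
    also have "\<dots> = ennreal (I.N ^ l) * (ennreal (1 / I.N ^ l) * (\<Sum>w\<in>words I l. ?H v w))"
      using inner[OF v] by (subst nn_integral_cmult, simp, subst nn_integral_sum) auto
    also have "\<dots> = (\<Sum>w\<in>words I l. ?H v w)"
      using I.N_pos by (simp add: mult.assoc[symmetric] flip: ennreal_mult)
    finally show "(\<Sum>w\<in>words I l. ?H v w) = ennreal (I.N ^ l) * (\<integral>\<^sup>+x. \<integral>\<^sup>+y. ?h (word_map F v x) y \<partial>\<nu> \<partial>\<nu>)" ..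
  qed
  \<comment> \<open>1 = N_I^j N_I^-j is inserted to match the right-hand side of
    \<open>nn_integral_words\<close>.\<close>
  also have "\<dots> = ennreal (I.N ^ l) * (ennreal (I.N ^ j) * (ennreal (1 / I.N ^ j) * (\<Sum>v\<in>words I j. \<integral>\<^sup>+x. \<integral>\<^sup>+y. ?h (word_map F v x) y \<partial>\<nu> \<partial>\<nu>)))"
    using I.N_pos by (simp add: sum_distrib_left mult.assoc[symmetric, of "ennreal (I.N ^ j)"] flip: ennreal_mult)
  also have "\<dots> = ennreal (I.N ^ l) * (ennreal (I.N ^ j) * (\<integral>\<^sup>+x. \<integral>\<^sup>+y. ?h x y \<partial>\<nu> \<partial>\<nu>))"
    using I.nn_integral_words[OF hx, of j] by simp
  also have "(\<integral>\<^sup>+x. \<integral>\<^sup>+y. ?h x y \<partial>\<nu> \<partial>\<nu>) = (\<integral>\<^sup>+z. ennreal (diff2 f \<delta> z) \<partial>(\<nu> \<Otimes>\<^sub>M \<nu>))"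
    using I.m.nn_integral_fst[OF h] by (simp add: case_prod_unfold)
  also have "\<dots> = ennreal (near_osc f \<delta>)"
    unfolding near_osc_def by (intro nn_integral_eq_integral diff2_integrable(1)[OF f]) (auto simp: diff2_def)
  also have "ennreal (I.N ^ l) * (ennreal (I.N ^ j) * ennreal (near_osc f \<delta>)) = ennreal (I.N ^ (j + l) * near_osc f \<delta>)"
    using near_osc_nonneg by (simp add: power_add mult_ac flip: ennreal_mult)
  finally have "(\<Sum>p\<in>R. ennreal ((avg f (fst p) - avg f (snd p))\<^sup>2)) \<le> ennreal (I.N ^ (j + l) * near_osc f \<delta>)"
    by (simp add: case_prod_unfold)
  then have "ennreal (\<Sum>p\<in>R. (avg f (fst p) - avg f (snd p))\<^sup>2) \<le> ennreal (I.N ^ (j + l) * near_osc f \<delta>)"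
    by (subst (asm) sum_ennreal) auto
  then show ?thesis
    using near_osc_nonneg by (simp add: case_prod_unfold ennreal_le_iff)
qed

text \<open>The prefactor \<open>\<alpha> powr (2 m \<beta> + m d)\<close> of the squared Besov coefficient of index \<open>m\<close> is \<open>\<kappa> ^ m\<close>.\<close>

definition \<kappa> :: real where "\<kappa> = \<rho> * I.N\<^sup>2"

lemma kappa_pos: "0 < \<kappa>"
  unfolding \<kappa>_def using rho_pos I.N_pos by simp

lemma N_I_ge_1: "1 \<le> I.N"
  using I.N_pos by simp

text \<open>Here the value of \<beta> enters: \<alpha>^d = N_I and \<alpha>^(2 \<beta>) = (\<rho> N
  / N) N_I = \<rho> N_I, so the weight is \<rho>^m, as for the energy of a bump, times N_I^(2 m), as
  in \<open>avg_sum_pairs\<close> for equal lengths.\<close>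

lemma besov_coeff_square:
  assumes f: "f \<in> L2_space \<nu>"
  shows "(besov_coeff \<nu> L \<alpha> d c \<beta> m f)\<^sup>2 = \<kappa> ^ m * near_osc f (c * inverse \<alpha> ^ m)"
proof -
  have pw: "\<alpha> powr (ln x / ln \<alpha>) = x" if "0 < x" for x
    using that alpha by (simp add: powr_def)
  have pm: "\<alpha> powr (real m * x) = (\<alpha> powr x) ^ m" for x
    using alpha by (simp add: powr_power mult.commute)
  have neg: "\<alpha> powr (- real m) = inverse \<alpha> ^ m"
    using alpha by (simp add: powr_minus powr_realpow power_inverse)
  have LINT: "(LINT z:{z \<in> L \<times> L. dist (fst z) (snd z) < c * \<alpha> powr (- real m)}|(\<nu> \<Otimes>\<^sub>M \<nu>). \<bar>f (fst z) - f (snd z)\<bar>\<^sup>2)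
      = near_osc f (c * inverse \<alpha> ^ m)"
    unfolding set_lebesgue_integral_def near_osc_def neg
    by (intro Bochner_Integration.integral_cong refl) (auto simp: diff2_def space_pair_measure I.space_meas indicator_def)
  have "\<alpha> powr (real m * \<beta>) * \<alpha> powr (real m * \<beta>) = \<alpha> powr (real m * (2 * \<beta>))"
    by (simp add: powr_add[symmetric] algebra_simps)
  also have "2 * \<beta> = (ln (\<rho> * S.N) / ln \<alpha> - ln S.N / ln \<alpha>) + d"
    unfolding beta_eq by (simp add: field_simps)
  also have "\<alpha> powr (real m * \<dots>) = (\<alpha> powr \<dots>) ^ m"
    by (rule pm)
  also have "\<alpha> powr ((ln (\<rho> * S.N) / ln \<alpha> - ln S.N / ln \<alpha>) + d) = \<rho> * I.N"
    unfolding powr_add powr_diff d_eq using pw[of "\<rho> * S.N"] pw[of S.N] pw[of I.N] rho_pos S.N_pos I.N_pos by simp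
  finally have 1: "(\<alpha> powr (real m * \<beta>))\<^sup>2 = (\<rho> * I.N) ^ m"
    by (simp add: power2_eq_square)
  have 2: "\<alpha> powr (real m * d) = I.N ^ m"
    unfolding pm d_eq using pw[of I.N] I.N_pos by simp
  have "(besov_coeff \<nu> L \<alpha> d c \<beta> m f)\<^sup>2 = (\<rho> * I.N) ^ m * (I.N ^ m * near_osc f (c * inverse \<alpha> ^ m))"
    unfolding besov_coeff_def LINT 1[symmetric] 2[symmetric]
    using near_osc_nonneg[of f] by (simp only: power_mult_distrib real_sqrt_pow2 mult_nonneg_nonneg powr_ge_zero)
  then show ?thesis
    by (simp add: \<kappa>_def power_mult_distrib power2_eq_square mult_ac)
qed

text \<open>The constant of \<open>Rw_dist\<close>; the added 1 makes the inequality strict.\<close>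

definition C_dist :: real where
  "C_dist = 4 * diam * (1 + \<alpha> ^ gap) + 1"

text \<open>Up to constants, what words of length j contribute to \<open>tail\<close>: \<kappa>^j
  from the energies, and (N_I / N)^j from squared averages of sum at most N_I^j times the squared
  norm, each weighted by N^-j.\<close>

definition level_sum :: "('x \<Rightarrow> real) \<Rightarrow> nat \<Rightarrow> real" where
  "level_sum f j = \<kappa> ^ j * near_osc f (C_dist * inverse \<alpha> ^ j) + (I.N / S.N) ^ j * (\<integral>x. (f x)\<^sup>2 \<partial>\<nu>)"

lemma level_sum_nonneg: "0 \<le> level_sum f j"
  unfolding level_sum_def using kappa_pos near_osc_nonneg by (intro add_nonneg_nonneg mult_nonneg_nonneg) auto

text \<open>The pairs are sorted by the length l of the second word, which has at most 2 gap + 1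
  values; \<open>avg_sum_pairs\<close> applies to each class.\<close>

lemma osc_level_le:
  assumes f: "f \<in> L2_space \<nu>"
  shows "(\<Sum>v\<in>Om n \<inter> words I j. osc n (avg f) v) \<le> real (2 * gap + 1) * I.N ^ (2 * j + gap) * near_osc f (C_dist * inverse \<alpha> ^ j)"
proof -
  let ?e = "near_osc f (C_dist * inverse \<alpha> ^ j)"
  define R where "R l = {(v, w). v \<in> Om n \<inter> words I j \<and> w \<in> Rw n v \<and> w \<in> words I l}" for l
  let ?V = "Om n \<inter> words I j"
  have finR: "finite (Rw n v)" for v using finite_Om by (simp add: whitney_R_def)
  have R_sub: "R l \<subseteq> words I j \<times> words I l" for l by (auto simp: R_def)
  have finl: "finite (R l)" for l
    using finite_subset[OF R_sub] I.finite_J by (simp add: finite_words)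
  have le: "(\<Sum>(v, w)\<in>R l. (avg f v - avg f w)\<^sup>2) \<le> I.N ^ (j + l) * ?e" for l
  proof (rule avg_sum_pairs[OF f R_sub])
    fix v w x y assume vw: "(v, w) \<in> R l" and xy: "x \<in> cell F K v" "y \<in> cell F K w"
    have "length v = j" using vw by (auto simp: R_def words_def)
    then have "dist x y \<le> 4 * diam * (1 + \<alpha> ^ gap) * inverse \<alpha> ^ j"
      using Rw_dist(3)[of v n w x y] vw xy by (auto simp: R_def)
    also have "\<dots> < C_dist * inverse \<alpha> ^ j"
      unfolding C_dist_def using inverse_alpha by (intro mult_strict_right_mono) auto
    finally show "dist x y < C_dist * inverse \<alpha> ^ j" .
  qed
  have "(\<Sum>v\<in>?V. osc n (avg f) v) = (\<Sum>p\<in>(SIGMA v:?V. Rw n v). (avg f (fst p) - avg f (snd p))\<^sup>2)"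
    unfolding osc_def using finR finite_Om
    by (subst sum.Sigma) (auto simp: case_prod_unfold power2_commute)
  also have "\<dots> \<le> (\<Sum>p\<in>(\<Union>l\<in>{j - gap..j + gap}. R l). (avg f (fst p) - avg f (snd p))\<^sup>2)"
  proof (rule sum_mono2)
    show "finite (\<Union>l\<in>{j - gap..j + gap}. R l)" using finl by auto
    show "(SIGMA v:?V. Rw n v) \<subseteq> (\<Union>l\<in>{j - gap..j + gap}. R l)"
    proof
      fix p assume "p \<in> (SIGMA v:?V. Rw n v)"
      then obtain v w where p: "p = (v, w)" "v \<in> ?V" "w \<in> Rw n v" by auto
      have "length v = j" using p by (auto simp: words_def)
      moreover have "length w \<le> length v + gap" "length v \<le> length w + gap"
        using Rw_dist(1,2)[of v n w] p cell_ne by blast+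
      moreover have "w \<in> words I (length w)" using p Om_words by (auto simp: whitney_R_def)
      ultimately have "p \<in> R (length w)" "length w \<in> {j - gap..j + gap}" using p by (auto simp: R_def)
      then show "p \<in> (\<Union>l\<in>{j - gap..j + gap}. R l)" by blast
    qed
  qed simp
  also have "\<dots> \<le> (\<Sum>l\<in>{j - gap..j + gap}. \<Sum>p\<in>R l. (avg f (fst p) - avg f (snd p))\<^sup>2)"
    using finl by (subst sum.UNION_disjoint) (auto simp: R_def words_def)
  also have "\<dots> \<le> (\<Sum>l\<in>{j - gap..j + gap}. I.N ^ (2 * j + gap) * ?e)"
  proof (intro sum_mono)
    fix l assume l: "l \<in> {j - gap..j + gap}"
    have "(\<Sum>p\<in>R l. (avg f (fst p) - avg f (snd p))\<^sup>2) \<le> I.N ^ (j + l) * ?e"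
      using le[of l] by (simp add: case_prod_unfold)
    also have "\<dots> \<le> I.N ^ (2 * j + gap) * ?e"
      using l N_I_ge_1 near_osc_nonneg by (intro mult_right_mono power_increasing) auto
    finally show "(\<Sum>p\<in>R l. (avg f (fst p) - avg f (snd p))\<^sup>2) \<le> I.N ^ (2 * j + gap) * ?e" .
  qed
  also have "\<dots> = real (card {j - gap..j + gap}) * (I.N ^ (2 * j + gap) * ?e)" by simp
  also have "\<dots> \<le> real (2 * gap + 1) * (I.N ^ (2 * j + gap) * ?e)"
    using near_osc_nonneg by (intro mult_right_mono) auto
  finally show ?thesis by (simp add: mult.assoc)
qed

text \<open>The added 1 lets the same constant dominate the coefficient 1 of the L2 term.\<close>

definition C_tail :: real where
  "C_tail = real (2 * gap + 1) * I.N ^ gap + 1"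

lemma C_tail_nonneg: "0 \<le> C_tail"
  unfolding C_tail_def by (intro add_nonneg_nonneg mult_nonneg_nonneg) auto

lemma tail_le:
  assumes f: "f \<in> L2_space \<nu>"
  shows "tail n (avg f) l \<le> C_tail * (\<Sum>j\<in>{l..n}. level_sum f j)"
proof -
  let ?t = "\<lambda>v. \<rho> ^ length v * osc n (avg f) v + (1 / S.N) ^ length v * (avg f v)\<^sup>2"
  have eq: "{v\<in>Om n. l \<le> length v} = (\<Union>j\<in>{l..n}. Om n \<inter> words I j)"
    by (auto simp: Om_iff words_def)
  have disj: "\<forall>i\<in>{l..n}. \<forall>j\<in>{l..n}. i \<noteq> j \<longrightarrow> (Om n \<inter> words I i) \<inter> (Om n \<inter> words I j) = {}"
    by (auto simp: words_def)
  have "tail n (avg f) l = (\<Sum>j\<in>{l..n}. \<Sum>v\<in>Om n \<inter> words I j. ?t v)"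
    unfolding tail_def eq using finite_Om disj by (intro sum.UNION_disjoint) auto
  also have "\<dots> \<le> (\<Sum>j\<in>{l..n}. C_tail * level_sum f j)"
  proof (intro sum_mono)
    fix j
    have "(\<Sum>v\<in>Om n \<inter> words I j. ?t v)
        = \<rho> ^ j * (\<Sum>v\<in>Om n \<inter> words I j. osc n (avg f) v) + (1 / S.N) ^ j * (\<Sum>v\<in>Om n \<inter> words I j. (avg f v)\<^sup>2)"
      unfolding sum_distrib_left sum.distrib[symmetric] by (intro sum.cong) (auto simp: words_def)
    also have "\<dots> \<le> \<rho> ^ j * (real (2 * gap + 1) * I.N ^ (2 * j + gap) * near_osc f (C_dist * inverse \<alpha> ^ j))
        + (1 / S.N) ^ j * (I.N ^ j * (\<integral>x. (f x)\<^sup>2 \<partial>\<nu>))"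
    proof (intro add_mono mult_left_mono osc_level_le[OF f])
      have "(\<Sum>v\<in>Om n \<inter> words I j. (avg f v)\<^sup>2) \<le> (\<Sum>v\<in>words I j. (avg f v)\<^sup>2)"
        using finite_words[OF I.finite_J] by (intro sum_mono2) auto
      then show "(\<Sum>v\<in>Om n \<inter> words I j. (avg f v)\<^sup>2) \<le> I.N ^ j * (\<integral>x. (f x)\<^sup>2 \<partial>\<nu>)"
        using avg_sum_square[OF f, of j] by simp
    qed (use rho_pos in auto)
    also have "\<dots> = real (2 * gap + 1) * I.N ^ gap * (\<kappa> ^ j * near_osc f (C_dist * inverse \<alpha> ^ j)) + (I.N / S.N) ^ j * (\<integral>x. (f x)\<^sup>2 \<partial>\<nu>)"
    proof -
      have "I.N ^ (2 * j + gap) = I.N ^ gap * (I.N\<^sup>2) ^ j" by (simp add: power_add power_mult)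
      then show ?thesis by (simp add: \<kappa>_def power_mult_distrib power_divide mult_ac)
    qed
    also have "\<dots> \<le> C_tail * (\<kappa> ^ j * near_osc f (C_dist * inverse \<alpha> ^ j)) + C_tail * ((I.N / S.N) ^ j * (\<integral>x. (f x)\<^sup>2 \<partial>\<nu>))"
    proof (rule add_mono)
      show "real (2 * gap + 1) * I.N ^ gap * (\<kappa> ^ j * near_osc f (C_dist * inverse \<alpha> ^ j)) \<le> C_tail * (\<kappa> ^ j * near_osc f (C_dist * inverse \<alpha> ^ j))"
        using kappa_pos near_osc_nonneg by (intro mult_right_mono mult_nonneg_nonneg) (auto simp: C_tail_def)
      have "0 \<le> (I.N / S.N) ^ j * (\<integral>x. (f x)\<^sup>2 \<partial>\<nu>)" by (intro mult_nonneg_nonneg) auto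
      then show "(I.N / S.N) ^ j * (\<integral>x. (f x)\<^sup>2 \<partial>\<nu>) \<le> C_tail * ((I.N / S.N) ^ j * (\<integral>x. (f x)\<^sup>2 \<partial>\<nu>))"
        using mult_right_mono[of 1 C_tail] by (simp add: C_tail_def)
    qed
    finally show "(\<Sum>v\<in>Om n \<inter> words I j. ?t v) \<le> C_tail * level_sum f j"
      by (simp add: level_sum_def distrib_left)
  qed
  finally show ?thesis by (simp add: sum_distrib_left)
qed

section \<open>Comparison with the Besov norm\<close>

abbreviation B2 :: "('x \<Rightarrow> real) set" where "B2 \<equiv> besov_space \<nu> L \<alpha> d c \<beta>"
abbreviation bnorm :: "('x \<Rightarrow> real) \<Rightarrow> real" where "bnorm \<equiv> besov_norm \<nu> L \<alpha> d c \<beta>"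

lemma B2_L2: "f \<in> B2 \<Longrightarrow> f \<in> L2_space \<nu>"
  by (simp add: besov_space_def)

lemma B2_iff: "f \<in> L2_space \<nu> \<Longrightarrow> f \<in> B2 \<longleftrightarrow> summable (\<lambda>m. \<kappa> ^ m * near_osc f (c * inverse \<alpha> ^ m))"
  by (simp add: besov_space_def besov_coeff_square)

lemma B2_diff:
  assumes f: "f \<in> B2" and g: "g \<in> B2"
  shows "(\<lambda>x. f x - g x) \<in> B2"
proof -
  note fL = B2_L2[OF f] and gL = B2_L2[OF g]
  have "summable (\<lambda>m. 2 * (\<kappa> ^ m * near_osc f (c * inverse \<alpha> ^ m)) + 2 * (\<kappa> ^ m * near_osc g (c * inverse \<alpha> ^ m)))"
    using f g by (intro summable_add summable_mult) (auto simp: B2_iff[OF fL] B2_iff[OF gL])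
  then have "summable (\<lambda>m. \<kappa> ^ m * near_osc (\<lambda>x. f x - g x) (c * inverse \<alpha> ^ m))"
  proof (rule summable_comparison_test'[where N = 0])
    fix m
    have "\<kappa> ^ m * near_osc (\<lambda>x. f x - g x) (c * inverse \<alpha> ^ m) \<le> \<kappa> ^ m * (2 * near_osc f (c * inverse \<alpha> ^ m) + 2 * near_osc g (c * inverse \<alpha> ^ m))"
      using kappa_pos by (intro mult_left_mono near_osc_diff_le fL gL) auto
    then show "norm (\<kappa> ^ m * near_osc (\<lambda>x. f x - g x) (c * inverse \<alpha> ^ m))
        \<le> 2 * (\<kappa> ^ m * near_osc f (c * inverse \<alpha> ^ m)) + 2 * (\<kappa> ^ m * near_osc g (c * inverse \<alpha> ^ m))"
      using kappa_pos near_osc_nonneg by (simp add: algebra_simps)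
  qed
  then show ?thesis using B2_iff[OF L2_space_diff[OF fL gL]] by simp
qed

lemma bnorm_bounds:
  assumes f: "f \<in> B2"
  shows "(\<integral>x. (f x)\<^sup>2 \<partial>\<nu>) \<le> (bnorm f)\<^sup>2"
    "(\<Sum>m. \<kappa> ^ m * near_osc f (c * inverse \<alpha> ^ m)) \<le> (bnorm f)\<^sup>2" "0 \<le> bnorm f"
proof -
  note fL = B2_L2[OF f]
  have sum: "summable (\<lambda>m. \<kappa> ^ m * near_osc f (c * inverse \<alpha> ^ m))" using f B2_iff[OF fL] by simp
  let ?s = "\<Sum>m. \<kappa> ^ m * near_osc f (c * inverse \<alpha> ^ m)"
  have s: "0 \<le> ?s" using kappa_pos near_osc_nonneg by (intro suminf_nonneg sum mult_nonneg_nonneg) auto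
  have eq: "bnorm f = L2_norm \<nu> f + sqrt ?s"
    by (simp add: besov_norm_def besov_coeff_square[OF fL])
  have "L2_norm \<nu> f \<le> bnorm f" "sqrt ?s \<le> bnorm f" "0 \<le> bnorm f"
    unfolding eq using L2_norm_nonneg[of \<nu> f] s by auto
  then show "(\<integral>x. (f x)\<^sup>2 \<partial>\<nu>) \<le> (bnorm f)\<^sup>2" "?s \<le> (bnorm f)\<^sup>2" "0 \<le> bnorm f"
    using L2_norm_nonneg[of \<nu> f] power_mono[of "L2_norm \<nu> f" "bnorm f" 2] power_mono[of "sqrt ?s" "bnorm f" 2] s
    by (simp_all add: L2_norm_power2)
qed

text \<open>Shifting the index by s brings the scale \<open>C_dist\<close> \<alpha>^-(j+s) below c
  \<alpha>^-j, at the price \<kappa>^s. The first s levels are bounded by the L2 norm, and the L2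
  terms form a geometric series because N_I < N.\<close>

lemma level_sum_bound:
  obtains C where "0 \<le> C" "\<And>f. f \<in> B2 \<Longrightarrow> summable (level_sum f) \<and> suminf (level_sum f) \<le> C * (bnorm f)\<^sup>2"
proof -
  have "eventually (\<lambda>s. inverse \<alpha> ^ s * C_dist < c) sequentially"
    by (rule order_tendstoD(2)[OF alpha_power_tendsto c_pos])
  then obtain s where s: "inverse \<alpha> ^ s * C_dist < c" by (auto simp: eventually_sequentially)
  define q where "q = I.N / S.N"
  have q: "0 \<le> q" "q < 1" unfolding q_def using I_card S.N_pos by (auto simp: field_simps)
  define C where "C = (\<Sum>j<s. \<kappa> ^ j * 4) + \<kappa> ^ s + 1 / (1 - q)"
  have "0 \<le> C" unfolding C_def using kappa_pos q by (intro add_nonneg_nonneg sum_nonneg) auto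
  moreover have "summable (level_sum f) \<and> suminf (level_sum f) \<le> C * (bnorm f)\<^sup>2" if f: "f \<in> B2" for f
  proof -
    note fL = B2_L2[OF f]
    define A where "A m = \<kappa> ^ m * near_osc f (c * inverse \<alpha> ^ m)" for m
    define E where "E j = \<kappa> ^ j * near_osc f (C_dist * inverse \<alpha> ^ j)" for j
    let ?n = "\<integral>x. (f x)\<^sup>2 \<partial>\<nu>"
    have n0: "0 \<le> ?n" by simp
    have sA: "summable A" using f B2_iff[OF fL] by (simp add: A_def[abs_def])
    have E0: "0 \<le> E j" for j unfolding E_def using kappa_pos near_osc_nonneg by (intro mult_nonneg_nonneg) auto
    have Ele: "E (j + s) \<le> \<kappa> ^ s * A j" for j
    proof -
      have "C_dist * inverse \<alpha> ^ (j + s) = inverse \<alpha> ^ s * C_dist * inverse \<alpha> ^ j"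
        by (simp add: power_add)
      also have "\<dots> \<le> c * inverse \<alpha> ^ j"
        using s inverse_alpha by (intro mult_right_mono) auto
      finally have "near_osc f (C_dist * inverse \<alpha> ^ (j + s)) \<le> near_osc f (c * inverse \<alpha> ^ j)"
        by (rule near_osc_mono[OF fL])
      then show ?thesis unfolding E_def A_def using kappa_pos by (simp add: power_add)
    qed
    have sE': "summable (\<lambda>j. E (j + s))"
      using summable_mult[OF sA, of "\<kappa> ^ s"] by (rule summable_comparison_test'[where N = 0]) (use Ele E0 in auto)
    then have sE: "summable E" by (simp add: summable_iff_shift)
    have "suminf E = (\<Sum>j. E (j + s)) + (\<Sum>j<s. E j)"
      by (rule suminf_split_initial_segment[OF sE])
    also have "\<dots> \<le> (\<Sum>j. \<kappa> ^ s * A j) + (\<Sum>j<s. \<kappa> ^ j * (4 * ?n))"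
    proof (rule add_mono)
      show "(\<Sum>j. E (j + s)) \<le> (\<Sum>j. \<kappa> ^ s * A j)"
        by (rule suminf_le[OF Ele sE' summable_mult[OF sA]])
      show "(\<Sum>j<s. E j) \<le> (\<Sum>j<s. \<kappa> ^ j * (4 * ?n))"
        unfolding E_def using kappa_pos diff2_integrable(2)[OF fL] by (intro sum_mono mult_left_mono) auto
    qed
    also have "\<dots> = \<kappa> ^ s * suminf A + (\<Sum>j<s. \<kappa> ^ j * 4) * ?n"
      using suminf_mult[OF sA] by (simp add: sum_distrib_right mult.assoc)
    also have "\<dots> \<le> \<kappa> ^ s * (bnorm f)\<^sup>2 + (\<Sum>j<s. \<kappa> ^ j * 4) * (bnorm f)\<^sup>2"
      using bnorm_bounds(1,2)[OF f] kappa_pos by (intro add_mono mult_left_mono sum_nonneg) (auto simp: A_def[abs_def])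
    finally have E: "suminf E \<le> \<kappa> ^ s * (bnorm f)\<^sup>2 + (\<Sum>j<s. \<kappa> ^ j * 4) * (bnorm f)\<^sup>2" .
    have sq: "summable (\<lambda>j. q ^ j * ?n)" using q by (intro summable_mult2 summable_geometric) auto
    have eq: "level_sum f = (\<lambda>j. E j + q ^ j * ?n)"
      by (rule ext) (simp add: level_sum_def E_def q_def)
    have "suminf (\<lambda>j. q ^ j * ?n) = 1 / (1 - q) * ?n"
      using q suminf_mult2[OF summable_geometric, of q ?n] suminf_geometric[of q] by simp
    also have "\<dots> \<le> 1 / (1 - q) * (bnorm f)\<^sup>2"
      using bnorm_bounds(1)[OF f] q by (intro mult_left_mono) auto
    finally have "suminf (level_sum f) \<le> C * (bnorm f)\<^sup>2"
      unfolding eq suminf_add[OF sE sq, symmetric] C_def using E by (simp add: algebra_simps)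
    then show ?thesis unfolding eq using summable_add[OF sE sq] by simp
  qed
  ultimately show ?thesis using that by blast
qed

end

section \<open>The extension operator\<close>

context besov_setting
begin

text \<open>\<open>Suc n\<close>, because bumps are given for levels at least 1.\<close>

definition approx :: "('x \<Rightarrow> real) \<Rightarrow> nat \<Rightarrow> 'x \<Rightarrow> real" where
  "approx f n = wsum (Suc n) (avg f)"

lemma approx_mem: "approx f n \<in> \<F>"
  unfolding approx_def by (rule wsum_mem) simp

lemma approx_lincomb:
  assumes "f \<in> L2_space \<nu>" "g \<in> L2_space \<nu>"
  shows "approx (\<lambda>x. a * f x + b * g x) n x = a * approx f n x + b * approx g n x"
proof -
  have "avg (\<lambda>x. a * f x + b * g x) w = a * avg f w + b * avg g w" if "w \<in> Om (Suc n)" for w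
    using avg_lincomb[OF assms Om_words[OF that]] .
  then show ?thesis
    unfolding approx_def wsum_def by (simp add: sum_distrib_left distrib_right sum.distrib mult.assoc)
qed

lemma level_sum_interval_le:
  assumes "summable (level_sum f)"
  shows "(\<Sum>j\<in>{l..n}. level_sum f j) \<le> (\<Sum>j. level_sum f (j + l))"
proof -
  have "(\<Sum>j\<in>{l..n}. level_sum f j) \<le> (\<Sum>j\<in>{0 + l..<Suc n + l}. level_sum f j)"
    by (intro sum_mono2) (auto intro: level_sum_nonneg)
  also have "\<dots> = (\<Sum>j<Suc n. level_sum f (j + l))"
    unfolding sum.shift_bounds_nat_ivl by (simp add: atLeast0LessThan)
  also have "\<dots> \<le> (\<Sum>j. level_sum f (j + l))"
    using assms level_sum_nonneg by (intro sum_le_suminf) (auto simp: summable_iff_shift)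
  finally show ?thesis .
qed

lemma approx_tail_le:
  assumes f: "f \<in> L2_space \<nu>" and s: "summable (level_sum f)"
  shows "tail n (avg f) l \<le> C_tail * (\<Sum>j. level_sum f (j + l))"
  using tail_le[OF f, of n l] mult_left_mono[OF level_sum_interval_le[OF s] C_tail_nonneg, of l n] by simp

lemma approx_nrm_le:
  assumes f: "f \<in> L2_space \<nu>" and s: "summable (level_sum f)"
  shows "D.nrm (approx f n) \<le> C_sum * C_tail * suminf (level_sum f)"
proof -
  have "D.nrm (approx f n) \<le> C_sum * tail (Suc n) (avg f) 0"
    unfolding approx_def by (rule wsum_nrm) simp
  also have "\<dots> \<le> C_sum * (C_tail * (\<Sum>j. level_sum f (j + 0)))"
    by (intro mult_left_mono approx_tail_le[OF f s] C_sum_nonneg)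
  finally show ?thesis by (simp add: mult.assoc)
qed

lemma approx_converges:
  assumes f: "f \<in> L2_space \<nu>" and s: "summable (level_sum f)"
  shows "\<exists>g\<in>\<F>. (\<lambda>n. D.nrm (\<lambda>x. approx f n x - g x)) \<longlonglongrightarrow> 0"
proof (rule D.nrm_complete[OF approx_mem])
  fix e :: real assume e: "0 < e"
  define r where "r l = (\<Sum>j. level_sum f (j + l))" for l
  have r: "r \<longlonglongrightarrow> 0"
    unfolding r_def[abs_def] by (rule suminf_exist_split2[OF s])
  \<comment> \<open>The tails for level m + 1 start at m + 1 - gap; the truncation of this
    subtraction does not affect the limit.\<close>
  have "filterlim (\<lambda>m. Suc m - gap) at_top sequentially"
    by (rule filterlim_at_top_mono[OF filterlim_minus_const_nat_at_top[of gap]]) (auto intro!: always_eventually)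
  then have "(\<lambda>m. r (Suc m - gap)) \<longlonglongrightarrow> 0"
    by (rule filterlim_compose[OF r])
  then have "(\<lambda>m. 4 * C_sum * C_tail * r (Suc m - gap)) \<longlonglongrightarrow> 4 * C_sum * C_tail * 0"
    by (intro tendsto_intros)
  then have "eventually (\<lambda>m. 4 * C_sum * C_tail * r (Suc m - gap) < e) sequentially"
    using e by (intro order_tendstoD(2)[of _ 0]) auto
  then obtain n0 where n0: "\<And>m. m \<ge> n0 \<Longrightarrow> 4 * C_sum * C_tail * r (Suc m - gap) < e"
    by (auto simp: eventually_sequentially)
  have "D.nrm (\<lambda>x. approx f n x - approx f m x) < e" if "n0 \<le> m" "m \<le> n" for m n
  proof -
    have "D.nrm (\<lambda>x. approx f n x - approx f m x)
        \<le> 2 * C_sum * (tail (Suc n) (avg f) (Suc m - gap) + tail (Suc m) (avg f) (Suc m - gap))"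
      unfolding approx_def using that by (intro wsum_diff_nrm) auto
    also have "\<dots> \<le> 2 * C_sum * (C_tail * r (Suc m - gap) + C_tail * r (Suc m - gap))"
      unfolding r_def using C_sum_nonneg by (intro mult_left_mono add_mono approx_tail_le f s) auto
    also have "\<dots> < e" using n0[OF that(1)] by (simp add: algebra_simps)
    finally show ?thesis .
  qed
  then show "\<exists>n0. \<forall>m\<ge>n0. \<forall>n\<ge>m. D.nrm (\<lambda>x. approx f n x - approx f m x) < e" by blast
qed

text \<open>A relation, since a limit in the form norm is determined only almost everywhere;
  linearity and boundedness are shown for it and hold for any later choice.\<close>

definition is_ext :: "('x \<Rightarrow> real) \<Rightarrow> ('x \<Rightarrow> real) \<Rightarrow> bool" where
  "is_ext f g \<longleftrightarrow> g \<in> \<F> \<and> (\<lambda>n. D.nrm (\<lambda>x. approx f n x - g x)) \<longlonglongrightarrow> 0"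

lemma is_ext_unique:
  assumes "is_ext f g" "is_ext f h"
  shows "AE x in S.meas. g x = h x"
  using assms D.nrm_tendsto_L2[OF approx_mem] unfolding is_ext_def
  by (intro L2_limit_unique[of "approx f"] D.D_L2 approx_mem) auto

lemma is_ext_lincomb:
  assumes f: "f \<in> L2_space \<nu>" "is_ext f f'" and g: "g \<in> L2_space \<nu>" "is_ext g g'"
  shows "is_ext (\<lambda>x. a * f x + b * g x) (\<lambda>x. a * f' x + b * g' x)"
proof -
  have mem: "f' \<in> \<F>" "g' \<in> \<F>" using f g by (auto simp: is_ext_def)
  let ?d = "\<lambda>n x. approx (\<lambda>x. a * f x + b * g x) n x - (a * f' x + b * g' x)"
  have eq: "?d n = (\<lambda>x. a * (approx f n x - f' x) + b * (approx g n x - g' x))" for n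
    by (rule ext) (simp add: approx_lincomb[OF f(1) g(1)] algebra_simps)
  have fd: "(\<lambda>x. approx f n x - f' x) \<in> \<F>" and gd: "(\<lambda>x. approx g n x - g' x) \<in> \<F>" for n
    by (intro D.D_diff approx_mem mem)+
  have dF: "?d n \<in> \<F>" for n unfolding eq by (intro D.D_lincomb fd gd)
  have le: "D.nrm (?d n) \<le> 2 * (a\<^sup>2 * D.nrm (\<lambda>x. approx f n x - f' x)) + 2 * (b\<^sup>2 * D.nrm (\<lambda>x. approx g n x - g' x))" for n
    using D.nrm_add_le[OF D.D_scale[OF fd] D.D_scale[OF gd], of a n b n] D.nrm_scale[OF fd] D.nrm_scale[OF gd]
    by (simp add: eq)
  have "(\<lambda>n. 2 * (a\<^sup>2 * D.nrm (\<lambda>x. approx f n x - f' x)) + 2 * (b\<^sup>2 * D.nrm (\<lambda>x. approx g n x - g' x))) \<longlonglongrightarrow> 2 * (a\<^sup>2 * 0) + 2 * (b\<^sup>2 * 0)"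
    using f(2) g(2) unfolding is_ext_def by (intro tendsto_intros) auto
  then have lim: "(\<lambda>n. 2 * (a\<^sup>2 * D.nrm (\<lambda>x. approx f n x - f' x)) + 2 * (b\<^sup>2 * D.nrm (\<lambda>x. approx g n x - g' x))) \<longlonglongrightarrow> 0"
    by simp
  have "(\<lambda>n. D.nrm (?d n)) \<longlonglongrightarrow> 0"
    by (rule tendsto_sandwich[OF always_eventually always_eventually tendsto_const lim]) (use D.nrm_nonneg[OF dF] le in auto)
  then show ?thesis using mem by (simp add: is_ext_def D.D_lincomb)
qed

text \<open>g is \<open>approx f n\<close> minus a function of vanishing norm, so the uniform bound
  on the approximations survives up to the factor 2.\<close>

lemma is_ext_bound:
  obtains C where "0 \<le> C" "\<And>f g. f \<in> B2 \<Longrightarrow> is_ext f g \<Longrightarrow> D.nrm g \<le> C * (bnorm f)\<^sup>2"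
    "\<And>f. f \<in> B2 \<Longrightarrow> \<exists>g. is_ext f g"
proof -
  obtain C where C: "0 \<le> C" "\<And>f. f \<in> B2 \<Longrightarrow> summable (level_sum f) \<and> suminf (level_sum f) \<le> C * (bnorm f)\<^sup>2"
    by (rule level_sum_bound) blast
  define A where "A = 2 * (C_sum * C_tail * C)"
  have "0 \<le> A" unfolding A_def using C C_sum_nonneg C_tail_nonneg by auto
  moreover have "D.nrm g \<le> A * (bnorm f)\<^sup>2" if f: "f \<in> B2" and g: "is_ext f g" for f g
  proof (rule LIMSEQ_le_const)
    have gF: "g \<in> \<F>" and lim: "(\<lambda>n. D.nrm (\<lambda>x. approx f n x - g x)) \<longlonglongrightarrow> 0" using g by (auto simp: is_ext_def)
    have "(\<lambda>n. A * (bnorm f)\<^sup>2 + 2 * D.nrm (\<lambda>x. approx f n x - g x)) \<longlonglongrightarrow> A * (bnorm f)\<^sup>2 + 2 * 0"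
      by (intro tendsto_intros lim)
    then show "(\<lambda>n. A * (bnorm f)\<^sup>2 + 2 * D.nrm (\<lambda>x. approx f n x - g x)) \<longlonglongrightarrow> A * (bnorm f)\<^sup>2" by simp
    have "D.nrm g \<le> A * (bnorm f)\<^sup>2 + 2 * D.nrm (\<lambda>x. approx f n x - g x)" for n
    proof -
      have "D.nrm (\<lambda>x. approx f n x - (approx f n x - g x)) \<le> 2 * D.nrm (approx f n) + 2 * D.nrm (\<lambda>x. approx f n x - g x)"
        by (intro D.nrm_diff_le approx_mem D.D_diff gF)
      moreover have "D.nrm (approx f n) \<le> C_sum * C_tail * (C * (bnorm f)\<^sup>2)"
        using approx_nrm_le[OF B2_L2[OF f], of n] C(2)[OF f] C_sum_nonneg C_tail_nonneg
        by (meson mult_left_mono mult_nonneg_nonneg order_trans)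
      ultimately show ?thesis by (simp add: A_def mult.assoc)
    qed
    then show "\<exists>N. \<forall>n\<ge>N. D.nrm g \<le> A * (bnorm f)\<^sup>2 + 2 * D.nrm (\<lambda>x. approx f n x - g x)" by blast
  qed
  moreover have "\<exists>g. is_ext f g" if "f \<in> B2" for f
    using approx_converges[OF B2_L2[OF that]] C(2)[OF that] unfolding is_ext_def by blast
  ultimately show ?thesis using that by blast
qed

section \<open>Continuous data on L\<close>

text \<open>On a cell the Whitney sum is a convex combination of the coefficients of the visible
  words.\<close>

lemma wsum_close:
  assumes n: "1 \<le> n" and u: "u \<in> words S k" "n < k" and y: "y \<in> K"
    and close: "\<And>w. w \<in> near n u \<Longrightarrow> \<bar>a w - t\<bar> \<le> e"
  shows "\<bar>wsum n a (word_map F u y) - t\<bar> \<le> e"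
proof -
  let ?p = "\<lambda>w. psi n w (word_map F u y)"
  have one: "(\<Sum>w\<in>near n u. ?p w) = 1"
    using psi_sum_near[OF n u y, of "\<lambda>_. 1"] psi_sum[OF n word_map_K[OF S.words_W[OF u(1)] y]]
    by (simp add: wsum_def)
  have "wsum n a (word_map F u y) - t = (\<Sum>w\<in>near n u. a w * ?p w) - t * (\<Sum>w\<in>near n u. ?p w)"
    using psi_sum_near[OF n u y, of a] one by simp
  also have "\<dots> = (\<Sum>w\<in>near n u. (a w - t) * ?p w)"
    by (simp add: left_diff_distrib sum_subtractf sum_distrib_left)
  finally have "\<bar>wsum n a (word_map F u y) - t\<bar> \<le> (\<Sum>w\<in>near n u. \<bar>(a w - t) * ?p w\<bar>)"
    using sum_abs[of "\<lambda>w. (a w - t) * ?p w" "near n u"] by simp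
  also have "\<dots> \<le> (\<Sum>w\<in>near n u. e * ?p w)"
    unfolding abs_mult using close psi_bounds(1)[OF n near_Om]
    by (intro sum_mono mult_mono) (auto intro: order_trans[OF abs_ge_zero])
  also have "\<dots> = e" using one by (simp flip: sum_distrib_left)
  finally show ?thesis .
qed

lemma avg_close:
  assumes f: "f \<in> L2_space \<nu>" and w: "w \<in> words I j" and z: "z \<in> L"
    and mod: "\<And>x y. x \<in> L \<Longrightarrow> y \<in> L \<Longrightarrow> dist x y < \<delta> \<Longrightarrow> \<bar>f x - f y\<bar> \<le> e"
    and close: "\<And>x. x \<in> cell F K w \<Longrightarrow> dist x z < \<delta>"
  shows "\<bar>avg f w - f z\<bar> \<le> e"
proof -
  have int: "integrable \<nu> (\<lambda>y. f (word_map F w y))"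
    by (rule I.m.L2_space_integrable[OF I.L2_word_map[OF f w]])
  have le: "\<bar>f (word_map F w y) - f z\<bar> \<le> e" if "y \<in> L" for y
    using L_K that z by (intro mod close I.word_map_P[OF w]) (auto simp: cell_def)
  have "avg f w - f z = (\<integral>y. f (word_map F w y) - f z \<partial>\<nu>)"
    using int by (simp add: avg_def I.m.prob_space)
  also have "\<bar>\<dots>\<bar> \<le> (\<integral>y. \<bar>f (word_map F w y) - f z\<bar> \<partial>\<nu>)"
    by (rule integral_abs_bound)
  also have "\<dots> \<le> (\<integral>y. e \<partial>\<nu>)"
    using int le I.space_meas by (intro integral_mono) auto
  finally show ?thesis by (simp add: I.m.prob_space)
qed

lemma cell_near_dist:
  assumes u: "u \<in> words S k" "n < k" and w: "w \<in> near n u" and x: "x \<in> cell F K u" and y: "y \<in> cell F K w"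
    and l: "l \<le> length w"
  shows "dist x y \<le> 4 * diam * inverse \<alpha> ^ l"
proof -
  have "dist x y \<le> 4 * diam * inverse \<alpha> ^ length w"
    using cell_near[OF u w] x by (intro cells_B_dist[OF near_Om[OF w] _ y]) auto
  also have "\<dots> \<le> 4 * diam * inverse \<alpha> ^ l"
    using l inverse_alpha diam_nonneg by (intro mult_left_mono power_decreasing) auto
  finally show ?thesis .
qed

lemma continuous_modulus:
  assumes "continuous_on L f" "0 < e"
  shows "\<exists>\<delta>>0. \<forall>x\<in>L. \<forall>y\<in>L. dist x y < \<delta> \<longrightarrow> \<bar>f x - f y\<bar> \<le> (e :: real)"
  using compact_uniformly_continuous[OF assms(1) L_compact] assms(2)
  unfolding uniformly_continuous_on_def dist_real_def by (metis abs_minus_commute less_imp_le)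

text \<open>8 = 4 + 4: two points are compared through a third, each within 4 \<open>diam\<close>
  \<alpha>^-(m-gap) of it.\<close>

lemma small_scale:
  assumes "0 < \<delta>"
  shows "\<exists>m0. \<forall>m\<ge>m0. 8 * diam * inverse \<alpha> ^ (m - gap) < \<delta>"
proof -
  have "eventually (\<lambda>m. inverse \<alpha> ^ m * (8 * diam) < \<delta>) sequentially"
    by (rule order_tendstoD(2)[OF alpha_power_tendsto assms])
  then obtain m0 where m0: "\<And>m. m \<ge> m0 \<Longrightarrow> inverse \<alpha> ^ m * (8 * diam) < \<delta>"
    by (auto simp: eventually_sequentially)
  have "8 * diam * inverse \<alpha> ^ (m - gap) < \<delta>" if "m0 + gap \<le> m" for m
    using m0[of "m - gap"] that by (simp add: mult_ac)
  then show ?thesis by blast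
qed

text \<open>On a cell that sees only words shorter than m the two approximations coincide. Otherwise
  all visible words of both levels are long, their cells lie close together, and all averages are
  within e of one value of f.\<close>

lemma approx_uniformly_Cauchy:
  assumes f: "f \<in> L2_space \<nu>" and cont: "continuous_on L f" and e: "0 < e"
  shows "\<exists>m0. \<forall>m\<ge>m0. \<forall>n\<ge>m. \<forall>x\<in>K. \<bar>approx f n x - approx f m x\<bar> \<le> 2 * e"
proof -
  obtain \<delta> where \<delta>: "0 < \<delta>" "\<And>x y. x \<in> L \<Longrightarrow> y \<in> L \<Longrightarrow> dist x y < \<delta> \<Longrightarrow> \<bar>f x - f y\<bar> \<le> e"
    using continuous_modulus[OF cont e] by blast
  obtain m0 where m0: "\<And>m. m0 \<le> m \<Longrightarrow> 8 * diam * inverse \<alpha> ^ (m - gap) < \<delta>"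
    using small_scale[OF \<delta>(1)] by blast
  have "\<bar>wsum n (avg f) x - wsum m (avg f) x\<bar> \<le> 2 * e" if m: "m0 \<le> m" "1 \<le> m" "m \<le> n" and x: "x \<in> K" for m n x
  proof -
    have n: "1 \<le> n" using m by simp
    obtain u y where u: "u \<in> words S (Suc n)" "y \<in> K" "x = word_map F u y"
      using cells_cover[OF x] by blast
    have k: "n < Suc n" "m < Suc n" using m by auto
    have xu: "x \<in> cell F K u" using u by (auto simp: cell_def)
    show ?thesis
    proof (cases "\<exists>w\<in>near n u \<union> near m u. m \<le> length w")
      case False
      then have "wsum n (avg f) x = wsum m (avg f) x"
        unfolding u(3) by (intro wsum_eq[OF m(2,3) u(1) k(1) u(2)]) (auto simp: not_le)
      then show ?thesis using e by simp
    next
      case True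
      then obtain w0 where w0: "w0 \<in> near n u \<union> near m u" "m \<le> length w0" by blast
      have level: "m - gap \<le> length w" if "w \<in> near n u \<union> near m u" for w
        using near_levels[OF m(2,3) u(1) k(1) w0 that] .
      obtain w1 where w1: "w1 \<in> near n u" using near_ne[OF n u(1) k(1)] by blast
      obtain p where p: "p \<in> L" using L_nonempty by blast
      \<comment> \<open>The modulus of continuity of f is available on L only, so the comparison
        point is taken in L, inside the cell of a visible word.\<close>
      define z where "z = word_map F w1 p"
      have z: "z \<in> L" "z \<in> cell F K w1"
        unfolding z_def using I.word_map_P[OF Om_words[OF near_Om[OF w1]] p] p L_K by (auto simp: cell_def)
      have xz: "dist x z \<le> 4 * diam * inverse \<alpha> ^ (m - gap)"
        using w1 level by (intro cell_near_dist[OF u(1) k(1) w1 xu z(2)]) auto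
      have close: "\<bar>avg f w - f z\<bar> \<le> e" if w: "w \<in> near n u \<union> near m u" for w
      proof (rule avg_close[OF f _ z(1) \<delta>(2)])
        show "w \<in> words I (length w)" using w near_Om Om_words by blast
        fix v assume v: "v \<in> cell F K w"
        have "dist x v \<le> 4 * diam * inverse \<alpha> ^ (m - gap)"
          using w cell_near_dist[OF u(1) k(1) _ xu v level[OF w]] cell_near_dist[OF u(1) k(2) _ xu v level[OF w]] by blast
        then have "dist v z \<le> 8 * diam * inverse \<alpha> ^ (m - gap)"
          using xz dist_triangle3[of v z x] by simp
        then show "dist v z < \<delta>" using m0[OF m(1)] by simp
      qed
      have "\<bar>wsum n (avg f) x - f z\<bar> \<le> e" "\<bar>wsum m (avg f) x - f z\<bar> \<le> e"
        unfolding u(3) using close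
        by (auto intro!: wsum_close[OF n u(1) k(1) u(2)] wsum_close[OF m(2) u(1) k(2) u(2)])
      then show ?thesis by linarith
    qed
  qed
  then show ?thesis unfolding approx_def by (intro exI[of _ m0]) simp
qed

text \<open>At a point of L only words of the top level are visible (\<open>cells_B_level\<close>),
  and their cells shrink to the point.\<close>

lemma approx_on_L:
  assumes f: "f \<in> L2_space \<nu>" and cont: "continuous_on L f" and x: "x \<in> L"
  shows "(\<lambda>n. approx f n x) \<longlonglongrightarrow> f x"
proof (rule LIMSEQ_I)
  fix r :: real assume r: "0 < r"
  define e where "e = r / 2"
  have e: "0 < e" using r by (simp add: e_def)
  obtain \<delta> where \<delta>: "0 < \<delta>" "\<And>x y. x \<in> L \<Longrightarrow> y \<in> L \<Longrightarrow> dist x y < \<delta> \<Longrightarrow> \<bar>f x - f y\<bar> \<le> e"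
    using continuous_modulus[OF cont e] by blast
  obtain m0 where m0: "\<And>m. m0 \<le> m \<Longrightarrow> 8 * diam * inverse \<alpha> ^ (m - gap) < \<delta>"
    using small_scale[OF \<delta>(1)] by blast
  have xK: "x \<in> K" using x L_K by blast
  have "\<bar>wsum n (avg f) x - f x\<bar> \<le> e" if n: "m0 \<le> n" "1 \<le> n" for n
  proof -
    obtain u y where u: "u \<in> words S (Suc n)" "y \<in> K" "x = word_map F u y"
      using cells_cover[OF xK] by blast
    have k: "n < Suc n" by simp
    have xu: "x \<in> cell F K u" using u by (auto simp: cell_def)
    have close: "\<bar>avg f w - f x\<bar> \<le> e" if w: "w \<in> near n u" for w
    proof (rule avg_close[OF f Om_words[OF near_Om[OF w]] x \<delta>(2)])
      have "x \<in> L \<inter> cells F K (Bw n w)" using cell_near[OF u(1) k w] xu x by blast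
      then have "length w = n" using cells_B_level near_Om[OF w] by (metis empty_iff)
      fix v assume v: "v \<in> cell F K w"
      have "dist x v \<le> 4 * diam * inverse \<alpha> ^ (n - gap)"
        using \<open>length w = n\<close> by (intro cell_near_dist[OF u(1) k w xu v]) simp
      also have "\<dots> \<le> 8 * diam * inverse \<alpha> ^ (n - gap)"
        using diam_nonneg inverse_alpha by (intro mult_right_mono) auto
      finally show "dist v x < \<delta>" using m0[OF n(1)] by (simp add: dist_commute)
    qed
    show ?thesis unfolding u(3) using close u(3) by (intro wsum_close[OF n(2) u(1) k u(2)]) simp
  qed
  then have "\<bar>approx f n x - f x\<bar> \<le> e" if "m0 \<le> n" for n
    using that unfolding approx_def by simp
  then show "\<exists>no. \<forall>n\<ge>no. norm (approx f n x - f x) < r"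
    using r by (intro exI[of _ m0]) (fastforce simp: e_def)
qed

text \<open>The uniform limit and the limit in the form norm agree almost everywhere, by a
  subsequence. As the domain is saturated, the continuous one may serve as the extension.\<close>

lemma is_ext_continuous:
  assumes f: "f \<in> B2" and cont: "continuous_on L f"
  shows "\<exists>g. is_ext f g \<and> continuous_on K g \<and> (\<forall>x\<in>L. g x = f x)"
proof -
  note fL = B2_L2[OF f]
  obtain h where h: "is_ext f h"
    by (rule is_ext_bound) (use f in blast)
  have "uniformly_Cauchy_on K (approx f)"
    unfolding uniformly_Cauchy_on_def
  proof (intro allI impI)
    fix e :: real assume e: "0 < e"
    then have "0 < e / 3" by simp
    from approx_uniformly_Cauchy[OF fL cont this] obtain m0
      where m0: "\<And>m n x. m0 \<le> m \<Longrightarrow> m \<le> n \<Longrightarrow> x \<in> K \<Longrightarrow> \<bar>approx f n x - approx f m x\<bar> \<le> 2 * (e / 3)" by blast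
    have "dist (approx f m x) (approx f n x) < e" if "x \<in> K" "m0 \<le> m" "m0 \<le> n" for x m n
    proof (cases "m \<le> n")
      case True
      then show ?thesis
        using m0[of m n x] that e abs_minus_commute[of "approx f m x" "approx f n x"] by (simp add: dist_real_def)
    next
      case False
      then show ?thesis using m0[of n m x] that e by (simp add: dist_real_def)
    qed
    then show "\<exists>M. \<forall>x\<in>K. \<forall>m\<ge>M. \<forall>n\<ge>M. dist (approx f m x) (approx f n x) < e" by blast
  qed
  then obtain g where g: "uniform_limit K (approx f) g sequentially"
    unfolding uniformly_convergent_eq_Cauchy[symmetric] uniformly_convergent_on_def by blast
  have contg: "continuous_on K g"
    by (rule uniform_limit_theorem[OF _ g]) (simp_all add: approx_def wsum_cont)
  have pw: "(\<lambda>n. approx f n x) \<longlonglongrightarrow> g x" if "x \<in> K" for x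
    by (rule tendsto_uniform_limitI[OF g that])
  have "g x = f x" if "x \<in> L" for x
    using LIMSEQ_unique[OF pw approx_on_L[OF fL cont that]] that L_K by blast
  moreover have "AE x in S.meas. h x = g x"
  proof -
    have hF: "h \<in> \<F>" using h by (simp add: is_ext_def)
    have "(\<lambda>n. \<integral>x. (approx f n x - h x)\<^sup>2 \<partial>S.meas) \<longlonglongrightarrow> 0"
      using h by (intro D.nrm_tendsto_L2[of "approx f"] approx_mem hF) (simp add: is_ext_def)
    then obtain r :: "nat \<Rightarrow> nat" where r: "strict_mono r" and ae: "AE x in S.meas. (\<lambda>n. approx f (r n) x) \<longlonglongrightarrow> h x"
      using L2_tendsto_AE_subseq[of "approx f" S.meas h] D.D_L2[OF approx_mem] D.D_L2[OF hF] by blast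
    have "AE x in S.meas. x \<in> K" using AE_space[of S.meas] by (simp add: S.space_meas)
    with ae show ?thesis
    proof eventually_elim
      case (elim x)
      show ?case using LIMSEQ_unique[OF elim(1)] LIMSEQ_subseq_LIMSEQ[OF pw[OF elim(2)] r] by (simp add: o_def)
    qed
  qed
  moreover have "is_ext f g"
  proof -
    have hF: "h \<in> \<F>" and lim: "(\<lambda>n. D.nrm (\<lambda>x. approx f n x - h x)) \<longlonglongrightarrow> 0" using h by (auto simp: is_ext_def)
    have gm: "g \<in> borel_measurable S.meas" by (rule D.continuous_meas[OF contg])
    have gF: "g \<in> \<F>" by (rule D.D_AE(1)[OF hF gm \<open>AE x in S.meas. h x = g x\<close>])
    have "D.nrm (\<lambda>x. approx f n x - g x) = D.nrm (\<lambda>x. approx f n x - h x)" for n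
    proof (rule D.nrm_AE[OF D.D_diff[OF approx_mem hF] D.D_meas[OF D.D_diff[OF approx_mem gF]]])
      show "AE x in S.meas. approx f n x - h x = approx f n x - g x"
        using \<open>AE x in S.meas. h x = g x\<close> by eventually_elim simp
    qed
    then show ?thesis using gF lim by (simp add: is_ext_def)
  qed
  ultimately show ?thesis using contg by blast
qed

section \<open>The operator and its traces\<close>

text \<open>Values are functions, not classes, so the choice prefers a continuous limit that equals
  f on L at every point and takes an arbitrary limit otherwise.\<close>

definition extend :: "('x \<Rightarrow> real) \<Rightarrow> 'x \<Rightarrow> real" where
  "extend f = (if \<exists>g. is_ext f g \<and> continuous_on K g \<and> (\<forall>x\<in>L. g x = f x)
    then SOME g. is_ext f g \<and> continuous_on K g \<and> (\<forall>x\<in>L. g x = f x) else SOME g. is_ext f g)"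

lemma extend_continuous:
  assumes "f \<in> B2" "continuous_on L f"
  shows "continuous_on K (extend f)" "\<And>x. x \<in> L \<Longrightarrow> extend f x = f x"
  using someI_ex[OF is_ext_continuous[OF assms]] is_ext_continuous[OF assms] unfolding extend_def by auto

lemma extend_is_ext:
  assumes "is_ext f g"
  shows "is_ext f (extend f)"
proof (cases "\<exists>g. is_ext f g \<and> continuous_on K g \<and> (\<forall>x\<in>L. g x = f x)")
  case True
  then show ?thesis using someI_ex[OF True] unfolding extend_def by simp
next
  case False
  then show ?thesis unfolding extend_def if_not_P[OF False] using someI[of "is_ext f", OF assms] by blast
qed

text \<open>For the trace, f is approximated in the Besov norm by continuous \<open>G k\<close>.
  Their extensions \<open>H k\<close> are continuous and equal \<open>G k\<close> on L, so they tend
  to \<open>extend f\<close> in the form norm and to f in \<open>L\<^sup>2\<close> of \<nu>, as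
  \<open>quasi_continuous_trace\<close> requires.\<close>

theorem trace_extension:
  assumes C: "0 \<le> C" and cap: "\<And>A. compact A \<Longrightarrow> A \<subseteq> K \<Longrightarrow> emeasure \<nu> (A \<inter> L) \<le> ennreal C * capacity S.meas K \<F> \<E> A"
  shows "\<exists>\<xi>. (\<forall>f\<in>besov_closure \<nu> L \<alpha> d c \<beta>. \<xi> f \<in> \<F>) \<and>
    (\<forall>f\<in>besov_closure \<nu> L \<alpha> d c \<beta>. \<forall>g\<in>besov_closure \<nu> L \<alpha> d c \<beta>. \<forall>a b.
      AE x in S.meas. \<xi> (\<lambda>y. a * f y + b * g y) x = a * \<xi> f x + b * \<xi> g x) \<and>
    (\<exists>C. \<forall>f\<in>besov_closure \<nu> L \<alpha> d c \<beta>. form_norm S.meas \<E> (\<xi> f) \<le> C * besov_norm \<nu> L \<alpha> d c \<beta> f) \<and>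
    (\<forall>f\<in>besov_space \<nu> L \<alpha> d c \<beta>. continuous_on L f \<longrightarrow> \<xi> f \<in> \<F> \<and> continuous_on K (\<xi> f)) \<and>
    (\<forall>f\<in>besov_closure \<nu> L \<alpha> d c \<beta>. (\<exists>g. quasi_cont_modification S.meas K \<F> \<E> (\<xi> f) g) \<and>
      (\<forall>g. quasi_cont_modification S.meas K \<F> \<E> (\<xi> f) g \<longrightarrow> (AE x in \<nu>. g x = f x)))"
proof -
  obtain A where A: "0 \<le> A" and bound: "\<And>f g. f \<in> B2 \<Longrightarrow> is_ext f g \<Longrightarrow> D.nrm g \<le> A * (bnorm f)\<^sup>2"
    and ex: "\<And>f. f \<in> B2 \<Longrightarrow> \<exists>g. is_ext f g"
    by (rule is_ext_bound) blast
  have ext: "is_ext f (extend f)" if "f \<in> B2" for f using ex[OF that] extend_is_ext by blast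
  then have mem: "extend f \<in> \<F>" if "f \<in> B2" for f using that by (simp add: is_ext_def)
  have sub: "f \<in> B2" if "f \<in> besov_closure \<nu> L \<alpha> d c \<beta>" for f using that by (simp add: besov_closure_def)
  have lin: "AE x in S.meas. extend (\<lambda>y. a * f y + b * g y) x = a * extend f x + b * extend g x"
    if "f \<in> B2" "g \<in> B2" for f g a b
  proof -
    have "is_ext (\<lambda>y. a * f y + b * g y) (\<lambda>x. a * extend f x + b * extend g x)"
      by (intro is_ext_lincomb B2_L2 ext that)
    from is_ext_unique[OF extend_is_ext[OF this] this] show ?thesis .
  qed
  have norm: "form_norm S.meas \<E> (extend f) \<le> sqrt A * bnorm f" if "f \<in> B2" for f
    using bound[OF that ext[OF that]] bnorm_bounds(3)[OF that] real_sqrt_le_mono[of "D.nrm (extend f)" "A * (bnorm f)\<^sup>2"]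
    by (simp add: D.form_norm_eq real_sqrt_mult)
  have trace: "(\<exists>g. quasi_cont_modification S.meas K \<F> \<E> (extend f) g) \<and>
      (\<forall>g. quasi_cont_modification S.meas K \<F> \<E> (extend f) g \<longrightarrow> (AE x in \<nu>. g x = f x))"
    if f: "f \<in> besov_closure \<nu> L \<alpha> d c \<beta>" for f
  proof -
    note fB = sub[OF f]
    have "\<exists>g\<in>B2. continuous_on L g \<and> bnorm (\<lambda>x. f x - g x) < 1 / real (Suc k)" for k
      using f unfolding besov_closure_def by (auto simp del: of_nat_Suc)
    then obtain G where G: "\<And>k. G k \<in> B2" "\<And>k. continuous_on L (G k)" "\<And>k. bnorm (\<lambda>x. f x - G k x) < 1 / real (Suc k)"
      by metis
    define H where "H k = extend (G k)" for k
    have HF: "H k \<in> \<F>" and Hc: "continuous_on K (H k)" and HL: "\<And>x. x \<in> L \<Longrightarrow> H k x = G k x" for k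
      unfolding H_def using mem G(1) extend_continuous[OF G(1,2)] by auto
    have diff: "(\<lambda>x. f x - G k x) \<in> B2" for k by (intro B2_diff fB G)
    have b0: "(\<lambda>k. (bnorm (\<lambda>x. f x - G k x))\<^sup>2) \<longlonglongrightarrow> 0"
    proof -
      have "(\<lambda>k. bnorm (\<lambda>x. f x - G k x)) \<longlonglongrightarrow> 0"
        by (rule tendsto_sandwich[OF always_eventually always_eventually tendsto_const LIMSEQ_inverse_real_of_nat])
          (use bnorm_bounds(3)[OF diff] G(3) in \<open>auto simp: inverse_eq_divide less_imp_le\<close>)
      from tendsto_power[OF this, of 2] show ?thesis by simp
    qed
    have le: "D.nrm (\<lambda>x. H k x - extend f x) \<le> A * (bnorm (\<lambda>x. f x - G k x))\<^sup>2" for k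
    proof -
      \<comment> \<open>The difference of the two extensions extends f - G k, so the norm bound
        applies to it, although \<open>extend\<close> may choose another function for f - G
        k.\<close>
      have "is_ext (\<lambda>x. 1 * f x + (-1) * G k x) (\<lambda>x. 1 * extend f x + (-1) * H k x)"
        unfolding H_def by (intro is_ext_lincomb B2_L2 ext fB G)
      then have "D.nrm (\<lambda>x. extend f x - H k x) \<le> A * (bnorm (\<lambda>x. f x - G k x))\<^sup>2"
        by (intro bound[OF diff]) simp
      then show ?thesis using D.nrm_diff_commute[OF HF mem[OF fB]] by simp
    qed
    have "(\<lambda>k. A * (bnorm (\<lambda>x. f x - G k x))\<^sup>2) \<longlonglongrightarrow> A * 0"
      by (intro tendsto_intros b0)
    then have Ab0: "(\<lambda>k. A * (bnorm (\<lambda>x. f x - G k x))\<^sup>2) \<longlonglongrightarrow> 0" by simp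
    have lim: "(\<lambda>k. D.nrm (\<lambda>x. H k x - extend f x)) \<longlonglongrightarrow> 0"
      by (rule tendsto_sandwich[OF always_eventually always_eventually tendsto_const Ab0])
        (use D.nrm_nonneg[OF D.D_diff[OF HF mem[OF fB]]] le in auto)
    have HL2: "H k \<in> L2_space \<nu>" for k
    proof -
      have "G k \<in> L2_space \<nu>" by (rule B2_L2[OF G(1)])
      moreover have "G k \<in> borel_measurable \<nu> \<longleftrightarrow> H k \<in> borel_measurable \<nu>"
        by (rule measurable_cong) (simp add: I.space_meas HL)
      moreover have "integrable \<nu> (\<lambda>x. (G k x)\<^sup>2) \<longleftrightarrow> integrable \<nu> (\<lambda>x. (H k x)\<^sup>2)"
        by (rule Bochner_Integration.integrable_cong) (simp_all add: I.space_meas HL)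
      ultimately show ?thesis by (simp add: L2_space_def)
    qed
    have leL: "(\<integral>x. (H k x - f x)\<^sup>2 \<partial>\<nu>) \<le> (bnorm (\<lambda>x. f x - G k x))\<^sup>2" for k
    proof -
      have "(\<integral>x. (H k x - f x)\<^sup>2 \<partial>\<nu>) = (\<integral>x. (f x - G k x)\<^sup>2 \<partial>\<nu>)"
        by (intro Bochner_Integration.integral_cong) (simp_all add: I.space_meas HL power2_commute)
      then show ?thesis using bnorm_bounds(1)[OF diff] by simp
    qed
    have limL: "(\<lambda>k. \<integral>x. (H k x - f x)\<^sup>2 \<partial>\<nu>) \<longlonglongrightarrow> 0"
      by (rule tendsto_sandwich[OF always_eventually always_eventually tendsto_const b0]) (use leL in auto)
    note trace = D.quasi_continuous_trace[OF I.m.finite_measure_axioms I.sets_meas L_K compact_imp_closed[OF L_compact]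
        C cap mem[OF fB] HF Hc lim B2_L2[OF fB] HL2 limL]
    show ?thesis by (intro conjI allI impI) (rule trace; assumption)+
  qed
  show ?thesis
  proof (rule exI[of _ extend], intro conjI)
    show "\<forall>f\<in>besov_closure \<nu> L \<alpha> d c \<beta>. extend f \<in> \<F>"
      using mem sub by blast
    show "\<forall>f\<in>besov_closure \<nu> L \<alpha> d c \<beta>. \<forall>g\<in>besov_closure \<nu> L \<alpha> d c \<beta>. \<forall>a b.
        AE x in S.meas. extend (\<lambda>y. a * f y + b * g y) x = a * extend f x + b * extend g x"
      by (intro ballI allI lin sub)
    show "\<exists>C. \<forall>f\<in>besov_closure \<nu> L \<alpha> d c \<beta>. form_norm S.meas \<E> (extend f) \<le> C * bnorm f"
      by (intro exI[of _ "sqrt A"] ballI norm sub)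
    show "\<forall>f\<in>B2. continuous_on L f \<longrightarrow> extend f \<in> \<F> \<and> continuous_on K (extend f)"
      by (intro ballI impI conjI mem extend_continuous)
    show "\<forall>f\<in>besov_closure \<nu> L \<alpha> d c \<beta>. (\<exists>g. quasi_cont_modification S.meas K \<F> \<E> (extend f) g) \<and>
        (\<forall>g. quasi_cont_modification S.meas K \<F> \<E> (extend f) g \<longrightarrow> (AE x in \<nu>. g x = f x))"
      by (intro ballI trace)
  qed
qed

end

theorem theorem2p6:
  fixes F :: "'i \<Rightarrow> 'x::polish_space \<Rightarrow> 'x"
    and W S I :: "'i set"
    and \<alpha> \<rho> d d_f d_w \<beta> c :: real
    and K L :: "'x set"
    and \<GG> :: "('x \<Rightarrow> 'x) set"
    and M :: nat
    and \<mu> \<nu> :: "'x measure"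
    and \<F> :: "('x \<Rightarrow> real) set"
    and \<E> :: "('x \<Rightarrow> real) \<Rightarrow> ('x \<Rightarrow> real) \<Rightarrow> real"
    and FA :: "'i list set \<Rightarrow> ('x \<Rightarrow> real) set"
    and \<Gamma> :: "(nat \<times> 'i list) set"
    and \<tau> :: "nat \<Rightarrow> 'i list \<Rightarrow> nat \<times> 'i list"
    and \<iota> :: "nat \<Rightarrow> 'i list \<Rightarrow> 'i list \<Rightarrow> 'i list"
    and \<Phi> :: "nat \<Rightarrow> 'i list \<Rightarrow> 'x \<Rightarrow> 'x"
    and \<phi>bar :: "nat \<Rightarrow> 'i list \<Rightarrow> 'x \<Rightarrow> real"
    and \<phi> :: "nat \<Rightarrow> 'i list \<Rightarrow> 'x \<Rightarrow> real"
  \<comment> \<open>self-similar sets\<close>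
  assumes alpha: "1 < \<alpha>"
    and W_fin: "finite W"
    and similitude: "\<forall>i\<in>W. \<forall>x y. dist (F i x) (F i y) = inverse \<alpha> * dist x y"
    and S_sub: "S \<subseteq> W"
    and K: "compact K" "K \<noteq> {}" "K = (\<Union>i\<in>S. F i ` K)" "connected K"
    and G_group: "subgroup \<GG> (BijGroup K)"
    and G_isometry: "\<forall>\<Psi>\<in>\<GG>. \<forall>x\<in>K. \<forall>y\<in>K. dist (\<Psi> x) (\<Psi> y) = dist x y"
    and G_i: "\<forall>i\<in>W. \<exists>j\<in>S. \<exists>\<Psi>\<in>\<GG>. \<forall>x\<in>K. F i x = F j (\<Psi> x)"
    and G_ii: "\<forall>\<Psi>\<in>\<GG>. \<forall>i\<in>S. \<exists>\<Psi>'\<in>\<GG>. \<exists>i'\<in>S. \<forall>x\<in>K. \<Psi> (F i x) = F i' (\<Psi>' x)"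
    and I_sub: "I \<subseteq> W" and I_card: "card I < card S"
    and L: "compact L" "L \<noteq> {}" "L = (\<Union>i\<in>I. F i ` L)" "L \<subseteq> K"
    and M_pos: "1 \<le> M"
    and M_chain: "\<forall>i\<in>I. \<forall>j\<in>I. (i, j) \<in> {(a, b). a \<in> I \<and> b \<in> I \<and> [a] \<in> nbhd W F K M {[b]}}\<^sup>*"
    and mu: "\<mu> = bernoulli_image F K S K"
    and nu: "\<nu> = bernoulli_image F K I L"
    and d_f: "d_f = ln (real (card S)) / ln \<alpha>"
    and d: "d = ln (real (card I)) / ln \<alpha>"
    and A1: "\<exists>C::nat. \<forall>n. \<forall>w\<in>words S n. card (nbhd W F K 1 {w} \<inter> words S n) \<le> C"
            "\<exists>C::nat. \<forall>n. \<forall>w\<in>words I n. card (nbhd W F K M {w} \<inter> words I n) \<le> C"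
    and A2: "\<exists>k1>0. \<exists>k2>0. \<forall>x\<in>L. \<forall>y\<in>L. \<forall>n. \<forall>v\<in>words I n. \<forall>w\<in>words I n.
               x \<in> cell F K v \<and> y \<in> cell F K w \<longrightarrow>
               (dist x y < k1 * \<alpha> powr (- real n) \<longrightarrow> v \<in> nbhd W F K M {w}) \<and>
               (v \<in> nbhd W F K M {w} \<longrightarrow> dist x y < k2 * \<alpha> powr (- real n))"
    and A3: "\<exists>k1>0. \<exists>k2>0. \<forall>x\<in>K. \<forall>y\<in>K. \<forall>n. \<forall>v\<in>words S n. \<forall>w\<in>words S n.
               x \<in> cell F K v \<and> y \<in> cell F K w \<longrightarrow>
               (dist x y < k1 * \<alpha> powr (- real n) \<longrightarrow> adjacent F K v w) \<and>
               (adjacent F K v w \<longrightarrow> dist x y < k2 * \<alpha> powr (- real n))"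
    and A4: "{x\<in>K. infinite {\<omega>. (\<forall>k. \<omega> k \<in> S) \<and> coding F K \<omega> = x}} \<in> null_sets \<mu>"
            "{x\<in>L. infinite {\<omega>. (\<forall>k. \<omega> k \<in> I) \<and> coding F K \<omega> = x}} \<in> null_sets \<nu>"
  \<comment> \<open>Dirichlet form\<close>
    and form: "dirichlet_form \<mu> \<F> \<E>" "regular_form \<mu> K \<F> \<E>" "strong_local \<mu> K \<F> \<E>"
    and A5: "\<forall>f\<in>\<F>. \<forall>i\<in>S. f \<circ> F i \<in> \<F>"
            "0 < \<rho>" "\<forall>f\<in>\<F>. \<E> f f = \<rho> * (\<Sum>i\<in>S. \<E> (f \<circ> F i) (f \<circ> F i))"
    and A6: "\<forall>\<Psi>\<in>\<GG>. pullback \<mu> \<Psi> \<F> = \<F> \<and> (\<forall>f\<in>\<F>. \<E> (f \<circ> \<Psi>) (f \<circ> \<Psi>) = \<E> f f)"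
    and d_w: "d_w = ln (\<rho> * real (card S)) / ln \<alpha>"
    and A7: "d_w > d_f - d"
    and A8: "\<exists>C>0. \<forall>D. compact D \<and> D \<subseteq> K \<longrightarrow>
               emeasure \<nu> (D \<inter> L) \<le> ennreal C * capacity \<mu> K \<F> \<E> D"
  \<comment> \<open>forms on unions of cells\<close>
    and FA_sub: "\<forall>m. \<forall>A\<subseteq>words W m. \<F> \<subseteq> FA A \<and>
               FA A \<subseteq> {f \<in> L2_space (restrict_space \<mu> (cells F K A)). \<forall>w\<in>A. f \<circ> word_map F w \<in> \<F>}"
    and FA_refine: "\<forall>m. \<forall>A\<subseteq>words W m. \<forall>n\<ge>1. FA A = FA (conc A (words S n))"
    and FA_closed: "\<forall>m. \<forall>A\<subseteq>words W m.
               closed_form (restrict_space \<mu> (cells F K A)) (FA A) (cell_form F \<rho> \<E> A)"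
  \<comment> \<open>Whitney-type decomposition\<close>
    and Gamma: "finite \<Gamma>" "\<Gamma> \<subseteq> {(n, w). 1 \<le> n \<and> w \<in> words_upto I n}"
    and C1: "\<forall>n\<ge>1. \<forall>w\<in>words_upto I n. \<tau> n w \<in> \<Gamma> \<and>
               whitney_match W F K I \<mu> FA n w (fst (\<tau> n w)) (snd (\<tau> n w)) (\<iota> n w) (\<Phi> n w)"
    and phibar: "\<forall>(m, v)\<in>\<Gamma>. \<phi>bar m v \<in> \<F> \<and> continuous_on K (\<phi>bar m v) \<and>
               (\<forall>x\<in>K. 0 \<le> \<phi>bar m v x \<and> \<phi>bar m v x \<le> 1) \<and>
               (\<forall>x\<in>cells F K (whitney_A W F K I m v). \<phi>bar m v x = 1) \<and>
               (\<forall>x\<in>cells F K (words W (length v + 1) - whitney_B W F K I m v). \<phi>bar m v x = 0)"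
    and phi: "\<forall>n\<ge>1. \<forall>w\<in>words_upto I n. \<forall>x. \<phi> n w x =
               (if x \<in> cells F K (whitney_B W F K I n w)
                then \<phi>bar (fst (\<tau> n w)) (snd (\<tau> n w)) (\<Phi> n w x) else 0)"
    and C2: "\<forall>n\<ge>1. \<forall>w\<in>words_upto I n. \<phi> n w \<in> \<F> \<and> continuous_on K (\<phi> n w)"
  \<comment> \<open>Besov exponent and scale\<close>
    and beta: "\<beta> = d_w / 2 - (d_f - d) / 2"
    and c_pos: "0 < c"
  shows "\<exists>\<xi> :: ('x \<Rightarrow> real) \<Rightarrow> ('x \<Rightarrow> real).
           (\<forall>f\<in>besov_closure \<nu> L \<alpha> d c \<beta>. \<xi> f \<in> \<F>) \<and>
           (\<forall>f\<in>besov_closure \<nu> L \<alpha> d c \<beta>. \<forall>g\<in>besov_closure \<nu> L \<alpha> d c \<beta>. \<forall>a b.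
              AE x in \<mu>. \<xi> (\<lambda>y. a * f y + b * g y) x = a * \<xi> f x + b * \<xi> g x) \<and>
           (\<exists>C. \<forall>f\<in>besov_closure \<nu> L \<alpha> d c \<beta>.
              form_norm \<mu> \<E> (\<xi> f) \<le> C * besov_norm \<nu> L \<alpha> d c \<beta> f) \<and>
           (\<forall>f\<in>besov_space \<nu> L \<alpha> d c \<beta>. continuous_on L f \<longrightarrow> \<xi> f \<in> \<F> \<and> continuous_on K (\<xi> f)) \<and>
           (\<forall>f\<in>besov_closure \<nu> L \<alpha> d c \<beta>.
              (\<exists>g. quasi_cont_modification \<mu> K \<F> \<E> (\<xi> f) g) \<and>
              (\<forall>g. quasi_cont_modification \<mu> K \<F> \<E> (\<xi> f) g \<longrightarrow> (AE x in \<nu>. g x = f x)))"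
proof -
  \<comment> \<open>Scales are real powers in the statement and integer powers in the
    locales.\<close>
  have inverse_power: "\<alpha> powr (- real n) = inverse \<alpha> ^ n" for n
    using alpha by (simp add: powr_minus powr_realpow power_inverse)
  have A3': "\<exists>k1>0. \<forall>x\<in>K. \<forall>y\<in>K. \<forall>n. \<forall>v\<in>words S n. \<forall>w\<in>words S n.
      x \<in> cell F K v \<and> y \<in> cell F K w \<and> dist x y < k1 * inverse \<alpha> ^ n \<longrightarrow> adjacent F K v w"
    using A3 unfolding inverse_power by blast
  interpret T: besov_setting F W S I \<alpha> K L \<GG> \<F> \<E> \<rho> FA \<Gamma> \<tau> \<iota> \<Phi> \<phi>bar \<phi> d \<beta> c
  proof (intro besov_setting.intro besov_setting_axioms.intro trace_setting.intro trace_setting_axioms.intro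
      trace_geometry.intro)
    show "1 < \<alpha>" "finite W" "S \<subseteq> W" "compact K" "K \<noteq> {}" "K = (\<Union>i\<in>S. F i ` K)" "subgroup \<GG> (BijGroup K)"
      "I \<subseteq> W" "card I < card S" "compact L" "L \<noteq> {}" "L = (\<Union>i\<in>I. F i ` L)" "L \<subseteq> K" "0 < \<rho>" "finite \<Gamma>" "0 < c"
      "\<Gamma> \<subseteq> {(n, w). 1 \<le> n \<and> w \<in> words_upto I n}" "d = ln (real (card I)) / ln \<alpha>"
      by (fact alpha W_fin S_sub K G_group I_sub I_card L A5 Gamma c_pos d)+
    show "\<exists>k1>0. \<forall>x\<in>K. \<forall>y\<in>K. \<forall>n. \<forall>v\<in>words S n. \<forall>w\<in>words S n.
        x \<in> cell F K v \<and> y \<in> cell F K w \<and> dist x y < k1 * inverse \<alpha> ^ n \<longrightarrow> adjacent F K v w"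
      by (fact A3')
    show "{x\<in>K. infinite {\<omega>. (\<forall>k. \<omega> k \<in> S) \<and> coding F K \<omega> = x}} \<in> null_sets (bernoulli_image F K S K)"
      using A4(1) unfolding mu .
    show "dirichlet_form (bernoulli_image F K S K) \<F> \<E>" "regular_form (bernoulli_image F K S K) K \<F> \<E>"
      "strong_local (bernoulli_image F K S K) K \<F> \<E>"
      using form unfolding mu .
    show "\<beta> = ln (\<rho> * real (card S)) / ln \<alpha> / 2 - (ln (real (card S)) / ln \<alpha> - d) / 2"
      using beta unfolding d_w d_f .
    show "dist (F i x) (F i y) = inverse \<alpha> * dist x y" if "i \<in> W" for i x y
      using similitude that by blast
    show "\<exists>j\<in>S. \<exists>\<Psi>\<in>\<GG>. \<forall>x\<in>K. F i x = F j (\<Psi> x)" if "i \<in> W" for i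
      using G_i that by blast
    show "\<exists>\<Psi>'\<in>\<GG>. \<exists>i'\<in>S. \<forall>x\<in>K. \<Psi> (F i x) = F i' (\<Psi>' x)" if "\<Psi> \<in> \<GG>" "i \<in> S" for \<Psi> i
      using G_ii that by blast
    show "dist (\<Psi> x) (\<Psi> y) = dist x y" if "\<Psi> \<in> \<GG>" "x \<in> K" "y \<in> K" for \<Psi> x y
      using G_isometry that by blast
    show "f \<circ> F i \<in> \<F>" if "f \<in> \<F>" "i \<in> S" for f i
      using A5(1) that by blast
    show "\<E> f f = \<rho> * (\<Sum>i\<in>S. \<E> (f \<circ> F i) (f \<circ> F i))" if "f \<in> \<F>" for f
      using A5(3) that by blast
    show "pullback (bernoulli_image F K S K) \<Psi> \<F> = \<F>" if "\<Psi> \<in> \<GG>" for \<Psi>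
      using A6 that unfolding mu by blast
    show "\<E> (f \<circ> \<Psi>) (f \<circ> \<Psi>) = \<E> f f" if "\<Psi> \<in> \<GG>" "f \<in> \<F>" for \<Psi> f
      using A6 that by blast
    show "\<tau> n w \<in> \<Gamma>"
      "whitney_match W F K I (bernoulli_image F K S K) FA n w (fst (\<tau> n w)) (snd (\<tau> n w)) (\<iota> n w) (\<Phi> n w)"
      if "1 \<le> n" "w \<in> words_upto I n" for n w
      using C1 that unfolding mu by blast+
    show "\<phi>bar m v \<in> \<F> \<and> (\<forall>x\<in>K. 0 \<le> \<phi>bar m v x \<and> \<phi>bar m v x \<le> 1) \<and>
        (\<forall>x\<in>cells F K (whitney_A W F K I m v). \<phi>bar m v x = 1)" if "(m, v) \<in> \<Gamma>" for m v
      using phibar that by fast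
    show "\<phi> n w x = (if x \<in> cells F K (whitney_B W F K I n w)
        then \<phi>bar (fst (\<tau> n w)) (snd (\<tau> n w)) (\<Phi> n w x) else 0)" if "1 \<le> n" "w \<in> words_upto I n" for n w x
      using phi that by blast
    show "\<phi> n w \<in> \<F> \<and> continuous_on K (\<phi> n w)" if "1 \<le> n" "w \<in> words_upto I n" for n w
      using C2 that by blast
  qed
  have \<mu>: "T.S.meas = \<mu>" and \<nu>: "T.I.meas = \<nu>"
    by (simp_all add: mu nu T.S.meas_def T.I.meas_def)
  obtain C where C: "0 < C" "\<And>A. compact A \<Longrightarrow> A \<subseteq> K \<Longrightarrow> emeasure \<nu> (A \<inter> L) \<le> ennreal C * capacity \<mu> K \<F> \<E> A"
    using A8 by blast
  show ?thesis
    by (rule T.trace_extension[unfolded \<mu> \<nu>, OF less_imp_le[OF C(1)] C(2)])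
qed

end
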